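(* Consider the maps $\mathrm{Sp}^{\mathcal I}(4)//\mathrm{GL}_2(\mathbb{R})\xrightarrow{p_0}\mathrm{Sp}(4)//\mathrm{Sp}(4)\xrightarrow{p_1}\mathbb{R}^2$, $[M_{A,B,C}]\mapsto[[M_{A,B,C}]]\mapsto(\mathrm{tr}A,\det A)$, and put $p_2=p_1\circ p_0$. Let $\Gamma\subset\mathbb{R}^2$ be the branch locus and use the decomposition of $\mathbb{R}^2$ given in the context. (i) Over $\mathbb{R}^2\setminus\Gamma$ the restricted maps $p_2^{-1}(\mathbb{R}^2\setminus\Gamma)\xrightarrow{p_0}p_1^{-1}(\mathbb{R}^2\setminus\Gamma)\xrightarrow{p_1}\mathbb{R}^2\setminus\Gamma$ are coverings (with number of sheets depending on the connected component). (ii) For a point $x\in\mathbb{R}^2$, the pair of cardinalities $(\#p_2^{-1}(x),\#p_1^{-1}(x))$ is: - $(4,4)$ if $x\in\mathcal{E}^2$; - $(4,2)$ if $x\in\mathcal{EH}^+\cup\mathcal{EH}^-$; - $(4,1)$ if $x\in\mathcal{H}^{++}\cup\mathcal{H}^{-+}\cup\mathcal{H}^{--}$; - $(1,1)$ if $x\in\mathcal{N}$; - $(3,3)$ if $x\in\Gamma_d^2$; - $(3,1)$ if $x\in\Gamma_d^1\cup\Gamma_d^3$; - $(2,2)$ if $x\in\Gamma_1^2\cup\Gamma_{-1}^2$; - $(2,1)$ if $x\in\Gamma_1^1\cup\Gamma_1^3\cup\Gamma_{-1}^1\cup\Gamma_{-1}^3$; - $(1,1)$ if $x\in\{(2,1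),(-2,1),(0,-1)\}$.
   Context: $\mathrm{Sp}(2n)$ is the group of real symplectic $2n\times 2n$ matrices, i.e. $M^TJM=J$ with $J=\begin{pmatrix}0&I\\-I&0\end{pmatrix}$; it acts on itself by conjugation. $\mathcal I=\begin{pmatrix}I&0\\0&-I\end{pmatrix}$ and $\mathrm{Sp}^{\mathcal I}(2n)=\{M\in\mathrm{Sp}(2n):M^{-1}=\mathcal I M\mathcal I\}$. Equivalently, $\mathrm{Sp}^{\mathcal I}(2n)$ consists of the matrices $M_{A,B,C}=\begin{pmatrix}A&B\\C&A^T\end{pmatrix}$ with $A,B,C\in \mathrm{M}_{n\times n}(\mathbb{R})$ satisfying $B=B^T$, $C=C^T$, $AB=BA^T$, $A^TC=CA$, $A^2-BC=I$. The group $\mathrm{GL}_n(\mathbb{R})$ acts on $\mathrm{Sp}^{\mathcal I}(2n)$ by $R_*(A,B,C)=(RAR^{-1},RBR^T,(R^T)^{-1}CR^{-1})$. For a Lie group $G$ acting on a manifold $X$, the orbit closure relation is $x\sim y\iff \overline{Gx}\cap\overline{Gy}\neq\emptyset$. When it is transitive (as is the case for the actions here), the GIT quotient is $X//G:=X/\sim$ with the quotient topology. $[M_{A,B,C}]$ denotes the class in $\mathrm{Sp}^{\mathcal I}(2n)//\mathrm{GL}_n(\mathbb{R})$ and $[[M_{A,B,C}]]$ the class in $\mathrm{Sp}(2n)//\mathrm{Sp}(2n)$. Every symplectic matrix is symplectically conjugate to an element of $\mathrm{Sp}^{\mathcal I}(2n)$ (Wonenburger), so every class in $\mathrm{Sp}(2n)//\mathrm{Sp}(2n)$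 is of the form $[[M_{A,B,C}]]$. The characteristic polynomial of $A$ is determined by that of $M_{A,B,C}$, so $p_1$ is well defined. Coordinates on $\mathbb{R}^2$ are $(\tau,\delta)$. Branch locus: $\Gamma=\Gamma_d\cup\Gamma_1\cup\Gamma_{-1}$ with $\Gamma_d=\{\delta=\tfrac14\tau^2\}$, $\Gamma_1=\{\delta=\tau-1\}$, $\Gamma_{-1}=\{\delta=-\tau-1\}$. Pieces of the branch locus: $\Gamma_d^1,\Gamma_d^2,\Gamma_d^3$ are the parts of $\Gamma_d$ with $\tau<-2$, $-2<\tau<2$, $\tau>2$ respectively; $\Gamma_1^1,\Gamma_1^2,\Gamma_1^3$ are the parts of $\Gamma_1$ with $\tau<0$, $0<\tau<2$, $\tau>2$; $\Gamma_{-1}^1,\Gamma_{-1}^2,\Gamma_{-1}^3$ are the parts of $\Gamma_{-1}$ with $\tau<-2$, $-2<\tau<0$, $\tau>0$. The remaining points of $\Gamma$ are $(2,1),(-2,1),(0,-1)$. Connected components of $\mathbb{R}^2\setminus\Gamma$: $\mathcal{E}^2=\{-2<\tau<2,\ \max(-\tau-1,\tau-1)<\delta<\tfrac14\tau^2\}$; $\mathcal{EH}^+=\{\tau>0,\ |\delta+1|<\tau\}$; $\mathcal{EH}^-=\{\tau<0,\ |\delta+1|<-\tau\}$; $\mathcal{H}^{-+}=\{\delta<-1,\ |\tau|<-\delta-1\}$; $\mathcal{H}^{++}=\{\tau>2,\ \tau-1<\delta<\tfrac14\tau^2\}$; $\mathcal{H}^{--}=\{\tau<-2,\ -\tau-1<\delta<\tfrac14\tau^2\}$;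 $\mathcal{N}=\{\delta>\tfrac14\tau^2\}$. *)

theory Defs
  imports "HOL-Analysis.Analysis"
begin

section \<open>Quotient topologies, coverings and GIT quotients\<close>

definition quotient_topology :: "'a topology \<Rightarrow> ('a \<Rightarrow> 'b) \<Rightarrow> 'b topology" where
  "quotient_topology X q =
     topology (\<lambda>V. V \<subseteq> q ` topspace X \<and> openin X {x \<in> topspace X. q x \<in> V})"

lemma openin_quotient_topology:
  "openin (quotient_topology X q) V \<longleftrightarrow>
     V \<subseteq> q ` topspace X \<and> openin X {x \<in> topspace X. q x \<in> V}"
proof -
  have "istopology (\<lambda>V. V \<subseteq> q ` topspace X \<and> openin X {x \<in> topspace X. q x \<in> V})"
    unfolding istopology_def
  proof (intro conjI allI impI)
    fix S T
    assume "S \<subseteq> q ` topspace X \<and> openin X {x \<in> topspace X. q x \<in> S}"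
      and "T \<subseteq> q ` topspace X \<and> openin X {x \<in> topspace X. q x \<in> T}"
    moreover have "{x \<in> topspace X. q x \<in> S \<inter> T}
        = {x \<in> topspace X. q x \<in> S} \<inter> {x \<in> topspace X. q x \<in> T}"
      by auto
    ultimately show "S \<inter> T \<subseteq> q ` topspace X" "openin X {x \<in> topspace X. q x \<in> S \<inter> T}"
      by auto
  next
    fix K
    assume K: "\<forall>S\<in>K. S \<subseteq> q ` topspace X \<and> openin X {x \<in> topspace X. q x \<in> S}"
    have "{x \<in> topspace X. q x \<in> \<Union>K} = (\<Union>S\<in>K. {x \<in> topspace X. q x \<in> S})"
      by auto
    with K show "\<Union>K \<subseteq> q ` topspace X" "openin X {x \<in> topspace X. q x \<in> \<Union>K}"
      by auto
  qed
  then show ?thesis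
    by (simp add: quotient_topology_def)
qed

lemma topspace_quotient_topology: "topspace (quotient_topology X q) = q ` topspace X"
proof
  show "topspace (quotient_topology X q) \<subseteq> q ` topspace X"
    using openin_topspace[of "quotient_topology X q"] by (simp only: openin_quotient_topology)
  have "{x \<in> topspace X. q x \<in> q ` topspace X} = topspace X"
    by auto
  then have "openin (quotient_topology X q) (q ` topspace X)"
    by (simp add: openin_quotient_topology)
  then show "q ` topspace X \<subseteq> topspace (quotient_topology X q)"
    by (rule openin_subset)
qed

lemma quotient_map_quotient_topology: "quotient_map X (quotient_topology X q) q"
  by (auto simp: quotient_map_def topspace_quotient_topology openin_quotient_topology)

text \<open>The counterpart of \<^const>\<open>covering_space\<close> for abstract topologies (GIT quotients are not
  subspaces of a topological type).\<close>

definition covering_map :: "'a topology \<Rightarrow> 'b topology \<Rightarrow> ('a \<Rightarrow> 'b) \<Rightarrow> bool" where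
  "covering_map X Y p \<longleftrightarrow>
     continuous_map X Y p \<and> p ` topspace X = topspace Y \<and>
     (\<forall>y \<in> topspace Y. \<exists>T. y \<in> T \<and> openin Y T \<and>
        (\<exists>\<U>. \<Union>\<U> = {x \<in> topspace X. p x \<in> T} \<and>
             (\<forall>U \<in> \<U>. openin X U) \<and>
             pairwise disjnt \<U> \<and>
             (\<forall>U \<in> \<U>. homeomorphic_map (subtopology X U) (subtopology Y T) p)))"

definition orbit :: "'g set \<Rightarrow> ('g \<Rightarrow> 'a \<Rightarrow> 'a) \<Rightarrow> 'a \<Rightarrow> 'a set" where
  "orbit G act x = {act g x | g. g \<in> G}"

definition orbit_closure_rel :: "'a topology \<Rightarrow> 'g set \<Rightarrow> ('g \<Rightarrow> 'a \<Rightarrow> 'a) \<Rightarrow> 'a rel" where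
  "orbit_closure_rel X G act =
     {(x, y). x \<in> topspace X \<and> y \<in> topspace X \<and>
              (X closure_of orbit G act x) \<inter> (X closure_of orbit G act y) \<noteq> {}}"

definition git_class :: "'a topology \<Rightarrow> 'g set \<Rightarrow> ('g \<Rightarrow> 'a \<Rightarrow> 'a) \<Rightarrow> 'a \<Rightarrow> 'a set" where
  "git_class X G act x = orbit_closure_rel X G act `` {x}"

definition git_quotient :: "'a topology \<Rightarrow> 'g set \<Rightarrow> ('g \<Rightarrow> 'a \<Rightarrow> 'a) \<Rightarrow> 'a set topology" where
  "git_quotient X G act = quotient_topology X (git_class X G act)"

lemma topspace_git_quotient:
  "topspace (git_quotient X G act) = topspace X // orbit_closure_rel X G act"
  by (auto simp: git_quotient_def topspace_quotient_topology quotient_def git_class_def)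


section \<open>Symplectic matrices\<close>

text \<open>A \<open>2n \<times> 2n\<close> matrix is indexed by \<open>'n + 'n\<close>, with \<open>n = CARD('n)\<close>.\<close>

type_synonym 'n sqmat = "real^'n^'n"
type_synonym 'n dmat = "real^('n + 'n)^('n + 'n)"

definition block_matrix ::
  "'n::finite sqmat \<Rightarrow> 'n sqmat \<Rightarrow> 'n sqmat \<Rightarrow> 'n sqmat \<Rightarrow> 'n dmat" where
  "block_matrix A B C D = (\<chi> i j. case (i, j) of
       (Inl k, Inl l) \<Rightarrow> A $ k $ l
     | (Inl k, Inr l) \<Rightarrow> B $ k $ l
     | (Inr k, Inl l) \<Rightarrow> C $ k $ l
     | (Inr k, Inr l) \<Rightarrow> D $ k $ l)"

definition block_A :: "'n::finite dmat \<Rightarrow> 'n sqmat" where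
  "block_A M = (\<chi> k l. M $ Inl k $ Inl l)"

definition block_B :: "'n::finite dmat \<Rightarrow> 'n sqmat" where
  "block_B M = (\<chi> k l. M $ Inl k $ Inr l)"

definition block_C :: "'n::finite dmat \<Rightarrow> 'n sqmat" where
  "block_C M = (\<chi> k l. M $ Inr k $ Inl l)"

definition J_mat :: "'n::finite dmat" where
  "J_mat = block_matrix 0 (mat 1) (- mat 1) 0"

definition I_mat :: "'n::finite dmat" where
  "I_mat = block_matrix (mat 1) 0 0 (- mat 1)"

definition Sp :: "'n::finite dmat set" where
  "Sp = {M. transpose M ** J_mat ** M = J_mat}"

definition SpI :: "'n::finite dmat set" where
  "SpI = {M \<in> Sp. matrix_inv M = I_mat ** M ** I_mat}"

definition M_ABC :: "'n::finite sqmat \<Rightarrow> 'n sqmat \<Rightarrow> 'n sqmat \<Rightarrow> 'n dmat" where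
  "M_ABC A B C = block_matrix A B C (transpose A)"

definition GL :: "'n::finite sqmat set" where
  "GL = {R. invertible R}"

definition conj_act :: "'n::finite dmat \<Rightarrow> 'n dmat \<Rightarrow> 'n dmat" where
  "conj_act N M = N ** M ** matrix_inv N"

definition GL_act :: "'n::finite sqmat \<Rightarrow> 'n dmat \<Rightarrow> 'n dmat" where
  "GL_act R M = M_ABC (R ** block_A M ** matrix_inv R)
                      (R ** block_B M ** transpose R)
                      (matrix_inv (transpose R) ** block_C M ** matrix_inv R)"

definition SpI_rel :: "'n::finite dmat rel" where
  "SpI_rel = orbit_closure_rel (top_of_set SpI) GL GL_act"

definition Sp_rel :: "'n::finite dmat rel" where
  "Sp_rel = orbit_closure_rel (top_of_set Sp) Sp conj_act"

definition SpI_class :: "'n::finite dmat \<Rightarrow> 'n dmat set" where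
  "SpI_class = git_class (top_of_set SpI) GL GL_act"

definition Sp_class :: "'n::finite dmat \<Rightarrow> 'n dmat set" where
  "Sp_class = git_class (top_of_set Sp) Sp conj_act"

definition SpI_git :: "'n::finite dmat set topology" where
  "SpI_git = git_quotient (top_of_set SpI) GL GL_act"

definition Sp_git :: "'n::finite dmat set topology" where
  "Sp_git = git_quotient (top_of_set Sp) Sp conj_act"


section \<open>The maps between the quotients for \<open>n = 2\<close>\<close>

text \<open>\<^const>\<open>the_elem\<close> picks the common value of a map on the representatives of a class. For
  \<open>p1\<close> only representatives of the form \<open>M_ABC A B C\<close> in \<^const>\<open>SpI\<close> are used.\<close>

definition p0 :: "2 dmat set \<Rightarrow> 2 dmat set" where
  "p0 c = the_elem (Sp_class ` c)"

definition p1 :: "2 dmat set \<Rightarrow> real \<times> real" where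
  "p1 d = the_elem ((\<lambda>M. (trace (block_A M), det (block_A M))) ` (d \<inter> SpI))"

definition p2 :: "2 dmat set \<Rightarrow> real \<times> real" where
  "p2 = p1 \<circ> p0"

definition preimage0 :: "2 dmat set \<Rightarrow> 2 dmat set set" where
  "preimage0 d = {c \<in> topspace SpI_git. p0 c = d}"

definition preimage1 :: "(real \<times> real) set \<Rightarrow> 2 dmat set set" where
  "preimage1 V = {d \<in> topspace Sp_git. p1 d \<in> V}"

definition preimage2 :: "(real \<times> real) set \<Rightarrow> 2 dmat set set" where
  "preimage2 V = {c \<in> topspace SpI_git. p2 c \<in> V}"


section \<open>The branch locus and the decomposition of the plane\<close>

definition Gamma_d :: "(real \<times> real) set" where
  "Gamma_d = {(\<tau>, \<delta>). \<delta> = \<tau>\<^sup>2 / 4}"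

definition Gamma_1 :: "(real \<times> real) set" where
  "Gamma_1 = {(\<tau>, \<delta>). \<delta> = \<tau> - 1}"

definition Gamma_m1 :: "(real \<times> real) set" where
  "Gamma_m1 = {(\<tau>, \<delta>). \<delta> = - \<tau> - 1}"

definition branch_locus :: "(real \<times> real) set" where
  "branch_locus = Gamma_d \<union> Gamma_1 \<union> Gamma_m1"

definition Gamma_d1 :: "(real \<times> real) set" where
  "Gamma_d1 = {(\<tau>, \<delta>) \<in> Gamma_d. \<tau> < -2}"

definition Gamma_d2 :: "(real \<times> real) set" where
  "Gamma_d2 = {(\<tau>, \<delta>) \<in> Gamma_d. -2 < \<tau> \<and> \<tau> < 2}"

definition Gamma_d3 :: "(real \<times> real) set" where
  "Gamma_d3 = {(\<tau>, \<delta>) \<in> Gamma_d. 2 < \<tau>}"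

definition Gamma_1_1 :: "(real \<times> real) set" where
  "Gamma_1_1 = {(\<tau>, \<delta>) \<in> Gamma_1. \<tau> < 0}"

definition Gamma_1_2 :: "(real \<times> real) set" where
  "Gamma_1_2 = {(\<tau>, \<delta>) \<in> Gamma_1. 0 < \<tau> \<and> \<tau> < 2}"

definition Gamma_1_3 :: "(real \<times> real) set" where
  "Gamma_1_3 = {(\<tau>, \<delta>) \<in> Gamma_1. 2 < \<tau>}"

definition Gamma_m1_1 :: "(real \<times> real) set" where
  "Gamma_m1_1 = {(\<tau>, \<delta>) \<in> Gamma_m1. \<tau> < -2}"

definition Gamma_m1_2 :: "(real \<times> real) set" where
  "Gamma_m1_2 = {(\<tau>, \<delta>) \<in> Gamma_m1. -2 < \<tau> \<and> \<tau> < 0}"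

definition Gamma_m1_3 :: "(real \<times> real) set" where
  "Gamma_m1_3 = {(\<tau>, \<delta>) \<in> Gamma_m1. 0 < \<tau>}"

definition region_E2 :: "(real \<times> real) set" where
  "region_E2 = {(\<tau>, \<delta>). -2 < \<tau> \<and> \<tau> < 2 \<and> max (- \<tau> - 1) (\<tau> - 1) < \<delta> \<and> \<delta> < \<tau>\<^sup>2 / 4}"

definition region_EHp :: "(real \<times> real) set" where
  "region_EHp = {(\<tau>, \<delta>). 0 < \<tau> \<and> \<bar>\<delta> + 1\<bar> < \<tau>}"

definition region_EHm :: "(real \<times> real) set" where
  "region_EHm = {(\<tau>, \<delta>). \<tau> < 0 \<and> \<bar>\<delta> + 1\<bar> < - \<tau>}"

definition region_Hmp :: "(real \<times> real) set" where
  "region_Hmp = {(\<tau>, \<delta>). \<delta> < -1 \<and> \<bar>\<tau>\<bar> < - \<delta> - 1}"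

definition region_Hpp :: "(real \<times> real) set" where
  "region_Hpp = {(\<tau>, \<delta>). 2 < \<tau> \<and> \<tau> - 1 < \<delta> \<and> \<delta> < \<tau>\<^sup>2 / 4}"

definition region_Hmm :: "(real \<times> real) set" where
  "region_Hmm = {(\<tau>, \<delta>). \<tau> < -2 \<and> - \<tau> - 1 < \<delta> \<and> \<delta> < \<tau>\<^sup>2 / 4}"

definition region_N :: "(real \<times> real) set" where
  "region_N = {(\<tau>, \<delta>). \<tau>\<^sup>2 / 4 < \<delta>}"

end

theory Submission
  imports Defs
begin

text \<open>
  The self-adjoint part \<open>S = (M + M\<^sup>-\<^sup>1)/2\<close> of a symplectic \<open>4 \<times> 4\<close> matrix satisfies a
  quadratic equation \<open>S\<^sup>2 - \<tau>S + \<delta> = 0\<close>, and \<open>(\<tau>, \<delta>) = (tr A, det A)\<close> on \<open>Sp\<^sup>I\<close>. For both group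
  actions every orbit closure contains exactly one matrix from an explicit list: if \<open>S\<close> has real
  eigenvalues, \<open>M\<close> degenerates to a sum of two blocks \<open>(a, b; c, a)\<close> with \<open>a\<close> an eigenvalue of \<open>S\<close>
  and \<open>b \<in> {0, 1, -1}\<close>; otherwise \<open>M\<close> is conjugate to one fixed matrix depending on \<open>(\<tau>, \<delta>)\<close> only.
  The sign of \<open>b\<close> is the sign of a form attached to the eigenvalue \<open>a\<close>, namely \<open>\<omega>(Mx, x)\<close> for
  \<open>Sp(4)\<close> and \<open>B\<close> for \<open>GL\<^sub>2\<close>. It is an invariant of the orbit closure when that form is
  semidefinite, which for \<open>Sp(4)\<close> requires \<open>a\<^sup>2 < 1\<close> and for \<open>GL\<^sub>2\<close> only \<open>a\<^sup>2 \<noteq> 1\<close>; at a double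
  eigenvalue the signature is an invariant because definiteness is open. Taking a positive value
  is open too, so the signs are locally constant over the complement of the branch locus and label
  the sheets.
\<close>

section \<open>Orbit closures and normal forms\<close>

text \<open>Two obstacles shape the proof. Orbits need not be closed, so an invariant has to survive
  limits. A sign is therefore recorded as "the form takes a value of this sign somewhere": this is
  open and invariant under the group, hence it passes from a limit back to every matrix that
  degenerates to it, and a matrix whose form is semidefinite cannot carry both signs. At a double
  eigenvalue the matrix may have a nilpotent part and its own form is out of reach, so a
  quantitative estimate around a definite limit is used instead. The other obstacle is that two
  groups act on two spaces. Embedding \<open>GL\<close> as block diagonal symplectic matrices turns
  both actions into conjugation, and one locale serves both, with two parameters: the set of test
  vectors and the predicate saying at which eigenvalues the sign is detected. In these terms
  \<open>p0\<close> only forgets signs, namely those at eigenvalues with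
  \<open>a\<^sup>2 > 1\<close>. The cardinalities count signs: a factor 2 for each detected simple
  eigenvalue, 3 unordered pairs at a detected double eigenvalue, and 1 for an undetected sign, an
  eigenvalue 1 or -1, or non-real eigenvalues.\<close>

lemma closure_of_top_of_set_iff:
  assumes "S \<subseteq> X"
  shows "y \<in> top_of_set X closure_of S \<longleftrightarrow> y \<in> X \<and> y \<in> closure S"
  using assms by (simp add: closure_of_subtopology Int_absorb1)

lemma quotient_continuous_map:
  "continuous_map (quotient_topology X q) Z f \<longleftrightarrow> continuous_map X Z (f \<circ> q)"
  by (rule continuous_compose_quotient_map_eq[symmetric]) (rule quotient_map_quotient_topology)

text \<open>The assumptions isolate what degenerations use of a group action: continuous maps that
  preserve the space and every orbit.\<close>

locale continuous_action =
  fixes X :: "'a::t2_space set" and G :: "'g set" and act :: "'g \<Rightarrow> 'a \<Rightarrow> 'a"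
  assumes act_continuous: "g \<in> G \<Longrightarrow> continuous_on X (act g)"
    and act_in: "g \<in> G \<Longrightarrow> x \<in> X \<Longrightarrow> act g x \<in> X"
    and orbit_refl: "x \<in> X \<Longrightarrow> x \<in> orbit G act x"
    and act_orbit: "g \<in> G \<Longrightarrow> x \<in> X \<Longrightarrow> y \<in> orbit G act x \<Longrightarrow> act g y \<in> orbit G act x"
begin

definition degenerates :: "'a \<Rightarrow> 'a \<Rightarrow> bool" where
  "degenerates x y \<longleftrightarrow> y \<in> X \<and> y \<in> closure (orbit G act x)"

lemma orbit_subset: "x \<in> X \<Longrightarrow> orbit G act x \<subseteq> X"
  by (auto simp: orbit_def act_in)

lemma degenerates_iff:
  "x \<in> X \<Longrightarrow> degenerates x y \<longleftrightarrow> y \<in> top_of_set X closure_of orbit G act x"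
  using closure_of_top_of_set_iff[OF orbit_subset] by (metis degenerates_def)

lemma degenerates_refl: "x \<in> X \<Longrightarrow> degenerates x x"
  using closure_subset orbit_refl by (auto simp: degenerates_def)

lemma degenerates_act: "x \<in> X \<Longrightarrow> g \<in> G \<Longrightarrow> degenerates x (act g x)"
  using closure_subset act_in by (force simp: degenerates_def orbit_def)

lemma degenerates_limit:
  assumes "x \<in> X" "y \<in> X" "\<And>n. g n \<in> G" "(\<lambda>n::nat. act (g n) x) \<longlonglongrightarrow> y"
  shows "degenerates x y"
proof -
  have "act (g n) x \<in> closure (orbit G act x)" for n
    using assms(3) closure_subset by (force simp: orbit_def)
  then have "y \<in> closure (orbit G act x)"
    using assms(4) by (meson closed_closure closed_sequentially)
  then show ?thesis using assms(2) by (simp add: degenerates_def)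
qed

text \<open>Each \<open>act g\<close> is continuous and preserves the orbit of \<open>x\<close>,
  hence also its closure. The closure contains \<open>y\<close>, so it contains the orbit of
  \<open>y\<close> and the closure of that orbit.\<close>

lemma degenerates_trans:
  assumes "x \<in> X" "degenerates x y" "degenerates y z"
  shows "degenerates x z"
proof -
  define T where "T = top_of_set X closure_of orbit G act x"
  have y: "y \<in> X" "y \<in> T"
    using assms(2) degenerates_iff[OF assms(1)] by (auto simp: degenerates_def T_def)
  have "act g y \<in> T" if g: "g \<in> G" for g
  proof -
    have "continuous_map (top_of_set X) (top_of_set X) (act g)"
      using act_continuous[OF g] act_in[OF g] by (auto simp: continuous_map_subtopology_eu)
    then have "act g ` T \<subseteq> top_of_set X closure_of (act g ` orbit G act x)"
      unfolding T_def by (rule continuous_map_image_closure_subset)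
    also have "\<dots> \<subseteq> T"
      unfolding T_def using act_orbit[OF g assms(1)] by (intro closure_of_mono) auto
    finally show ?thesis using y by auto
  qed
  then have "orbit G act y \<subseteq> T" by (auto simp: orbit_def)
  then have "top_of_set X closure_of orbit G act y \<subseteq> T"
    unfolding T_def by (intro closure_of_minimal closedin_closure_of)
  then show ?thesis
    using assms(3) degenerates_iff[OF assms(1)] degenerates_iff[OF y(1)] by (auto simp: T_def)
qed

end

text \<open>If every orbit closure meets the set of normal forms \<open>Z\<close> in exactly one point, then two
  points are related iff they have the same normal form, so the quotient is \<open>Z\<close> as a set.\<close>

locale git_normal_form = continuous_action X G act
  for X :: "'a::t2_space set" and G :: "'g set" and act +
  fixes Z :: "'a set"
  assumes Z_subset: "Z \<subseteq> X"
    and normal_form_exists: "x \<in> X \<Longrightarrow> \<exists>z\<in>Z. degenerates x z"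
    and normal_form_unique:
      "x \<in> X \<Longrightarrow> z \<in> Z \<Longrightarrow> z' \<in> Z \<Longrightarrow> degenerates x z \<Longrightarrow> degenerates x z' \<Longrightarrow> z = z'"
begin

definition nf :: "'a \<Rightarrow> 'a" where
  "nf x = (THE z. z \<in> Z \<and> degenerates x z)"

lemma nf_props: assumes "x \<in> X" shows "nf x \<in> Z" "degenerates x (nf x)"
proof -
  have "\<exists>!z. z \<in> Z \<and> degenerates x z"
    using normal_form_exists normal_form_unique assms by blast
  from theI'[OF this] show "nf x \<in> Z" "degenerates x (nf x)" by (auto simp: nf_def)
qed

lemma nf_in: "x \<in> X \<Longrightarrow> nf x \<in> X"
  using nf_props(1) Z_subset by blast

lemma nf_eqI: "x \<in> X \<Longrightarrow> z \<in> Z \<Longrightarrow> degenerates x z \<Longrightarrow> nf x = z"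
  using nf_props normal_form_unique by blast

lemma nf_Z: "z \<in> Z \<Longrightarrow> nf z = z"
  using Z_subset degenerates_refl by (intro nf_eqI) auto

lemma degenerates_nf_eq: 
  assumes "x \<in> X" "degenerates x y"
  shows "nf y = nf x"
proof -
  have "y \<in> X" using assms by (simp add: degenerates_def)
  then have "degenerates x (nf y)" using assms degenerates_trans nf_props by blast
  then show ?thesis using nf_eqI[OF assms(1)] nf_props \<open>y \<in> X\<close> by metis
qed

abbreviation (input) "rel \<equiv> orbit_closure_rel (top_of_set X) G act"
abbreviation (input) "cls \<equiv> git_class (top_of_set X) G act"
abbreviation (input) "quot \<equiv> git_quotient (top_of_set X) G act"

text \<open>A common point of two orbit closures has the normal form of both; conversely a shared
  normal form is itself such a common point. Transitivity of the relation is then immediate.\<close>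

lemma rel_iff: "(x, y) \<in> rel \<longleftrightarrow> x \<in> X \<and> y \<in> X \<and> nf x = nf y"
proof
  assume "(x, y) \<in> rel"
  then obtain u where "x \<in> X" "y \<in> X" "degenerates x u" "degenerates y u"
    by (auto simp: orbit_closure_rel_def simp flip: degenerates_iff)
  then show "x \<in> X \<and> y \<in> X \<and> nf x = nf y"
    using degenerates_nf_eq by metis
next
  assume *: "x \<in> X \<and> y \<in> X \<and> nf x = nf y"
  then have "degenerates x (nf x)" "degenerates y (nf x)" using nf_props by metis+
  then show "(x, y) \<in> rel"
    using * by (auto simp: orbit_closure_rel_def simp flip: degenerates_iff)
qed

lemma equiv_rel: "equiv X rel"
  by (intro equivI refl_onI symI transI) (auto simp: rel_iff)

lemma cls_eq: "x \<in> X \<Longrightarrow> cls x = {y \<in> X. nf y = nf x}"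
  by (auto simp: git_class_def rel_iff)

lemma cls_eq_iff: "x \<in> X \<Longrightarrow> y \<in> X \<Longrightarrow> cls x = cls y \<longleftrightarrow> nf x = nf y"
  using cls_eq by auto

lemma cls_nf: "x \<in> X \<Longrightarrow> cls (nf x) = cls x"
  using cls_eq_iff nf_Z nf_in nf_props by metis

lemma topspace_quot: "topspace quot = cls ` X"
  by (simp add: git_quotient_def topspace_quotient_topology)

lemma topspace_quot_Z: "topspace quot = cls ` Z"
proof -
  have "cls x \<in> cls ` Z" if "x \<in> X" for x
    using cls_nf[OF that] nf_props(1)[OF that] by (metis imageI)
  then show ?thesis using Z_subset unfolding topspace_quot by auto
qed

lemma inj_on_cls_Z: "inj_on cls Z"
proof (rule inj_onI)
  fix z z' assume "z \<in> Z" "z' \<in> Z" "cls z = cls z'"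
  moreover from this have "nf z = nf z'" using cls_eq_iff Z_subset by blast
  ultimately show "z = z'" by (simp add: nf_Z)
qed

lemma continuous_map_cls: "continuous_map (top_of_set X) quot cls"
  unfolding git_quotient_def by (rule quotient_imp_continuous_map[OF quotient_map_quotient_topology])

lemma continuous_map_quot_iff:
  "continuous_map quot Y f \<longleftrightarrow> continuous_map (top_of_set X) Y (f \<circ> cls)"
  unfolding git_quotient_def by (rule quotient_continuous_map)

lemma openin_quot_iff:
  "openin quot V \<longleftrightarrow> V \<subseteq> cls ` X \<and> openin (top_of_set X) {x \<in> X. cls x \<in> V}"
  by (simp add: git_quotient_def openin_quotient_topology)

end

section \<open>Covering maps built from continuous sections\<close>

definition open_sections ::
    "'a topology \<Rightarrow> 'b topology \<Rightarrow> ('a \<Rightarrow> 'b) \<Rightarrow> 'b set \<Rightarrow> 'i set \<Rightarrow> ('i \<Rightarrow> 'b \<Rightarrow> 'a) \<Rightarrow> bool" where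
  "open_sections X Y p T I s \<longleftrightarrow> openin Y T \<and> I \<noteq> {} \<and>
      (\<forall>i\<in>I. continuous_map (subtopology Y T) X (s i) \<and> openin X (s i ` T) \<and> (\<forall>t\<in>T. p (s i t) = t)) \<and>
      (\<forall>i\<in>I. \<forall>j\<in>I. i \<noteq> j \<longrightarrow> s i ` T \<inter> s j ` T = {}) \<and>
      {x \<in> topspace X. p x \<in> T} \<subseteq> (\<Union>i\<in>I. s i ` T)"

text \<open>The sheets are the images \<open>s i\<close> followed by \<open>T\<close>; each section
  is the continuous inverse of \<open>p\<close> on its sheet, and surjectivity comes from the index
  set being nonempty.\<close>

lemma covering_mapI:
  assumes cont: "continuous_map X Y p"
    and loc: "\<And>y. y \<in> topspace Y \<Longrightarrow> \<exists>T I s. y \<in> T \<and> open_sections X Y p T (I :: 'i set) s"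
  shows "covering_map X Y p"
  unfolding covering_map_def
proof (intro conjI ballI)
  show "continuous_map X Y p" by fact
  show "p ` topspace X = topspace Y"
  proof
    show "p ` topspace X \<subseteq> topspace Y"
      using cont by (simp add: continuous_map_image_subset_topspace)
    show "topspace Y \<subseteq> p ` topspace X"
    proof
      fix y assume "y \<in> topspace Y"
      from loc[OF this] obtain T s and i :: 'i where "y \<in> T" "openin X (s i ` T)" "p (s i y) = y"
        unfolding open_sections_def by blast
      then have "s i y \<in> topspace X" using openin_subset[of X "s i ` T"] by blast
      with \<open>p (s i y) = y\<close> show "y \<in> p ` topspace X" by (metis imageI)
    qed
  qed
  fix y assume "y \<in> topspace Y"
  from loc[OF this] obtain T and I :: "'i set" and s where y: "y \<in> T" and *: "open_sections X Y p T I s" by blast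
  from * have T: "openin Y T" "I \<noteq> {}"
    and s: "\<And>i. i \<in> I \<Longrightarrow> continuous_map (subtopology Y T) X (s i)"
      "\<And>i. i \<in> I \<Longrightarrow> openin X (s i ` T)" "\<And>i t. i \<in> I \<Longrightarrow> t \<in> T \<Longrightarrow> p (s i t) = t"
    and disj: "\<And>i j. i \<in> I \<Longrightarrow> j \<in> I \<Longrightarrow> i \<noteq> j \<Longrightarrow> s i ` T \<inter> s j ` T = {}"
    and cov: "{x \<in> topspace X. p x \<in> T} \<subseteq> (\<Union>i\<in>I. s i ` T)" by (auto simp: open_sections_def)
  have TY: "T \<subseteq> topspace Y" using T openin_subset by blast
  let ?U = "(\<lambda>i. s i ` T) ` I"
  have "\<Union>?U = {x \<in> topspace X. p x \<in> T}"
  proof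
    show "\<Union>?U \<subseteq> {x \<in> topspace X. p x \<in> T}"
    proof clarify
      fix i t assume "i \<in> I" "t \<in> T"
      then show "s i t \<in> topspace X \<and> p (s i t) \<in> T"
        using s(3)[of i t] openin_subset[OF s(2)[of i]] by auto
    qed
  qed (use cov in simp)
  moreover have "\<forall>U\<in>?U. openin X U" using s(2) by auto
  moreover have "pairwise disjnt ?U"
    unfolding pairwise_def disjnt_def
  proof (intro ballI impI)
    fix U W assume "U \<in> ?U" "W \<in> ?U" "U \<noteq> W"
    then obtain i j where "i \<in> I" "j \<in> I" "U = s i ` T" "W = s j ` T" "i \<noteq> j" by blast
    then show "U \<inter> W = {}" using disj by simp
  qed
  moreover have "homeomorphic_map (subtopology X U) (subtopology Y T) p" if "U \<in> ?U" for U
  proof -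
    obtain i where i: "i \<in> I" "U = s i ` T" using \<open>U \<in> ?U\<close> by blast
    have "homeomorphic_maps (subtopology X U) (subtopology Y T) p (s i)"
      unfolding homeomorphic_maps_def
    proof (intro conjI ballI)
      show "continuous_map (subtopology X U) (subtopology Y T) p"
        using cont s(3)[OF i(1)] i(2)
        by (auto simp: continuous_map_in_subtopology continuous_map_from_subtopology)
      show "continuous_map (subtopology Y T) (subtopology X U) (s i)"
        using s(1)[OF i(1)] i(2) by (auto simp: continuous_map_in_subtopology)
      show "s i (p x) = x" if "x \<in> topspace (subtopology X U)" for x
        using that i s(3) by auto
      show "p (s i t) = t" if "t \<in> topspace (subtopology Y T)" for t
        using that i s(3) by auto
    qed
    then show ?thesis using homeomorphic_map_maps by blast
  qed
  ultimately show "\<exists>T. y \<in> T \<and> openin Y T \<and> (\<exists>\<U>. \<Union>\<U> = {x \<in> topspace X. p x \<in> T} \<and>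
      (\<forall>U\<in>\<U>. openin X U) \<and> pairwise disjnt \<U> \<and>
      (\<forall>U\<in>\<U>. homeomorphic_map (subtopology X U) (subtopology Y T) p))"
    using y T(1) by (intro exI[of _ T] conjI exI[of _ ?U]) simp_all
qed

text \<open>The quotient depends on the action only through its orbits. This permits replacing
  \<open>GL_act\<close> by conjugation with embedded matrices.\<close>

lemma orbit_closure_rel_cong:
  assumes "\<And>x. x \<in> topspace X \<Longrightarrow> orbit G act x = orbit G' act' x"
  shows "orbit_closure_rel X G act = orbit_closure_rel X G' act'"
  using assms by (force simp: orbit_closure_rel_def)

lemma git_class_cong:
  assumes "\<And>x. x \<in> topspace X \<Longrightarrow> orbit G act x = orbit G' act' x"
  shows "git_class X G act = git_class X G' act'"
  using orbit_closure_rel_cong[of X G act G' act'] assms by (simp add: git_class_def fun_eq_iff)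

lemma git_quotient_cong:
  assumes "\<And>x. x \<in> topspace X \<Longrightarrow> orbit G act x = orbit G' act' x"
  shows "git_quotient X G act = git_quotient X G' act'"
  using git_class_cong[of X G act G' act'] assms by (simp add: git_quotient_def)

section \<open>Block matrices\<close>

lemma sum_UNIV_Plus:
  "sum f (UNIV :: ('a::finite + 'b::finite) set) = (\<Sum>i\<in>UNIV. f (Inl i)) + (\<Sum>i\<in>UNIV. f (Inr i))"
proof -
  have "sum f (UNIV <+> UNIV) = (\<Sum>i\<in>UNIV. f (Inl i)) + (\<Sum>i\<in>UNIV. f (Inr i))"
    by (subst sum.Plus) simp_all
  then show ?thesis by simp
qed

lemma sum_UNIV_dbl: "sum f (UNIV :: (2 + 2) set) = f (Inl 1) + f (Inl 2) + f (Inr 1) + f (Inr 2)"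
  by (simp add: sum_UNIV_Plus sum_2 add.assoc)

lemma forall_dbl: "(\<forall>i :: 2 + 2. P i) \<longleftrightarrow> P (Inl 1) \<and> P (Inl 2) \<and> P (Inr 1) \<and> P (Inr 2)"
  by (auto simp: forall_2 split_sum_all)

section \<open>Explicit 2 by 2 and block matrices\<close>

definition m2 :: "real \<Rightarrow> real \<Rightarrow> real \<Rightarrow> real \<Rightarrow> 2 sqmat" where
  "m2 a b c d = (\<chi> i j. if i = 1 then (if j = 1 then a else b) else (if j = 1 then c else d))"

lemma m2_nth [simp]:
  "m2 a b c d $ 1 $ 1 = a" "m2 a b c d $ 1 $ 2 = b"
  "m2 a b c d $ 2 $ 1 = c" "m2 a b c d $ 2 $ 2 = d"
  by (simp_all add: m2_def)

lemma m2_eq_iff: "(A :: 2 sqmat) = B \<longleftrightarrow>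
    A $ 1 $ 1 = B $ 1 $ 1 \<and> A $ 1 $ 2 = B $ 1 $ 2 \<and> A $ 2 $ 1 = B $ 2 $ 1 \<and> A $ 2 $ 2 = B $ 2 $ 2"
  by (auto simp: vec_eq_iff forall_2)

lemma m2_inject [simp]: "m2 a b c d = m2 a' b' c' d' \<longleftrightarrow> a = a' \<and> b = b' \<and> c = c' \<and> d = d'"
  by (auto simp: m2_eq_iff)

lemma m2_exists: obtains a b c d where "A = m2 a b c d"
proof
  show "A = m2 (A $ 1 $ 1) (A $ 1 $ 2) (A $ 2 $ 1) (A $ 2 $ 2)" by (simp add: m2_eq_iff)
qed

lemma m2_simps [simp]:
  "m2 a b c d ** m2 a' b' c' d' =
     m2 (a * a' + b * c') (a * b' + b * d') (c * a' + d * c') (c * b' + d * d')"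
  "m2 a b c d + m2 a' b' c' d' = m2 (a + a') (b + b') (c + c') (d + d')"
  "m2 a b c d - m2 a' b' c' d' = m2 (a - a') (b - b') (c - c') (d - d')"
  "- m2 a b c d = m2 (-a) (-b) (-c) (-d)"
  "x *\<^sub>R m2 a b c d = m2 (x * a) (x * b) (x * c) (x * d)"
  "transpose (m2 a b c d) = m2 a c b d"
  "trace (m2 a b c d) = a + d"
  "det (m2 a b c d) = a * d - b * c"
  by (simp_all add: m2_eq_iff matrix_matrix_mult_def sum_2 transpose_def trace_def det_2)

lemma mat_m2: "mat x = m2 x 0 0 x" and zero_m2: "(0 :: 2 sqmat) = m2 0 0 0 0"
  by (simp_all add: m2_eq_iff mat_def)

lemma block_nth [simp]:
  "block_matrix A B C D $ Inl k $ Inl l = A $ k $ l"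
  "block_matrix A B C D $ Inl k $ Inr l = B $ k $ l"
  "block_matrix A B C D $ Inr k $ Inl l = C $ k $ l"
  "block_matrix A B C D $ Inr k $ Inr l = D $ k $ l"
  by (simp_all add: block_matrix_def)

lemma block_matrix_mult [simp]:
  "block_matrix A B C D ** block_matrix A' B' C' D' =
     block_matrix (A ** A' + B ** C') (A ** B' + B ** D') (C ** A' + D ** C') (C ** B' + D ** D')"
  by (simp add: vec_eq_iff split_sum_all matrix_matrix_mult_def sum_UNIV_Plus)

lemma block_matrix_simps [simp]:
  "block_matrix A B C D + block_matrix A' B' C' D' = block_matrix (A + A') (B + B') (C + C') (D + D')"
  "block_matrix A B C D - block_matrix A' B' C' D' = block_matrix (A - A') (B - B') (C - C') (D - D')"
  "- block_matrix A B C D = block_matrix (- A) (- B) (- C) (- D)"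
  "x *\<^sub>R block_matrix A B C D = block_matrix (x *\<^sub>R A) (x *\<^sub>R B) (x *\<^sub>R C) (x *\<^sub>R D)"
  "transpose (block_matrix A B C D) =
     block_matrix (transpose A) (transpose C) (transpose B) (transpose D)"
  "trace (block_matrix A B C D) = trace A + trace D"
  "block_matrix A B C D = block_matrix A' B' C' D' \<longleftrightarrow> A = A' \<and> B = B' \<and> C = C' \<and> D = D'"
  "block_A (block_matrix A B C D) = A"
  "block_B (block_matrix A B C D) = B"
  "block_C (block_matrix A B C D) = C"
  by (auto simp: vec_eq_iff split_sum_all transpose_def trace_def sum_UNIV_Plus
      block_A_def block_B_def block_C_def)

lemma mat_block: "mat x = block_matrix (mat x) 0 0 (mat x)"
  by (simp add: vec_eq_iff split_sum_all mat_def)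

lemma block_exists: obtains A B C D where "M = block_matrix A B C D"
proof
  show "M = block_matrix (\<chi> k l. M $ Inl k $ Inl l) (\<chi> k l. M $ Inl k $ Inr l)
      (\<chi> k l. M $ Inr k $ Inl l) (\<chi> k l. M $ Inr k $ Inr l)"
    by (simp add: vec_eq_iff split_sum_all)
qed

lemma neg_matrix_mult [simp]: "(- A) ** (B :: real^'n^'m) = - (A ** B)" "A ** (- B) = - (A ** B)"
  by (simp_all add: vec_eq_iff matrix_matrix_mult_def sum_negf)

lemma transpose_arith [simp]:
  "transpose (- A :: real^'n^'m) = - transpose A"
  "transpose (A + B :: real^'n^'m) = transpose A + transpose B"
  "transpose (A - B :: real^'n^'m) = transpose A - transpose B"
  "transpose (x *\<^sub>R A :: real^'n^'m) = x *\<^sub>R transpose A"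
  "transpose (0 :: real^'n^'m) = 0"
  by (simp_all add: vec_eq_iff transpose_def)

lemma J_mat_square: "J_mat ** J_mat = - mat 1"
  by (simp add: J_mat_def mat_block[of 1])

text \<open>The adjoint for the symplectic form. It agrees with the inverse on \<open>Sp\<close>,
  but it is linear and defined for every matrix, so it can be computed blockwise and is visibly
  continuous.\<close>

definition spinv :: "'n::finite dmat \<Rightarrow> 'n dmat" where
  "spinv M = - (J_mat ** transpose M ** J_mat)"

lemma spinv_block [simp]: "spinv (block_matrix A B C D) =
    block_matrix (transpose D) (- transpose B) (- transpose C) (transpose A)"
  by (simp add: spinv_def J_mat_def)

lemma spinv_mult: "spinv (M ** N) = spinv N ** spinv M"
proof -
  have "spinv N ** spinv M = J_mat ** transpose N ** (J_mat ** J_mat) ** transpose M ** J_mat"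
    by (simp add: spinv_def matrix_mul_assoc)
  also have "\<dots> = spinv (M ** N)"
    by (simp add: J_mat_square spinv_def matrix_transpose_mul matrix_mul_assoc)
  finally show ?thesis by simp
qed

lemma spinv_spinv [simp]: "spinv (spinv M) = M"
  by (rule block_exists[of M]) simp

lemma Sp_iff_spinv_left: "M \<in> Sp \<longleftrightarrow> spinv M ** M = mat 1"
proof -
  have "J_mat ** (transpose M ** J_mat ** M) = - (spinv M ** M)"
    by (simp add: spinv_def matrix_mul_assoc)
  moreover have "J_mat ** X = J_mat ** Y \<longleftrightarrow> X = Y" for X Y :: "'a dmat"
  proof
    assume "J_mat ** X = J_mat ** Y"
    then have "(J_mat ** J_mat) ** X = (J_mat ** J_mat) ** Y" by (metis matrix_mul_assoc)
    then show "X = Y" by (simp add: J_mat_square)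
  qed simp
  ultimately have "M \<in> Sp \<longleftrightarrow> - (spinv M ** M) = - mat 1"
    unfolding Sp_def mem_Collect_eq by (metis J_mat_square)
  then show ?thesis by simp
qed

lemma Sp_spinv [simp]:
  assumes "M \<in> Sp" shows "spinv M ** M = mat 1" "M ** spinv M = mat 1"
  using assms Sp_iff_spinv_left matrix_left_right_inverse by blast+

lemma Sp_mult: "M \<in> Sp \<Longrightarrow> N \<in> Sp \<Longrightarrow> M ** N \<in> Sp"
proof -
  assume "M \<in> Sp" "N \<in> Sp"
  then have "spinv N ** (spinv M ** M) ** N = mat 1" by simp
  then show ?thesis by (simp add: Sp_iff_spinv_left spinv_mult matrix_mul_assoc)
qed

lemma Sp_spinv_mem: "M \<in> Sp \<Longrightarrow> spinv M \<in> Sp"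
  by (simp add: Sp_iff_spinv_left)

lemma Sp_mat_1: "mat 1 \<in> Sp"
  by (simp add: Sp_def)

lemma matrix_inv_eqI:
  assumes "A ** B = mat 1" shows "matrix_inv (A :: real^'n^'n) = B"
proof -
  have BA: "B ** A = mat 1" using assms matrix_left_right_inverse by blast
  then have "invertible A" using assms by (auto simp: invertible_def)
  then have "matrix_inv A ** A = mat 1"
    unfolding invertible_def matrix_inv_def by (rule someI2_ex) simp
  then have "matrix_inv A ** (A ** B) = B" by (simp add: matrix_mul_assoc)
  then show ?thesis using assms by simp
qed

lemma matrix_inv_Sp: "M \<in> Sp \<Longrightarrow> matrix_inv M = spinv M"
  by (simp add: matrix_inv_eqI)

lemma matrix_inv_invertible:
  assumes "invertible (A :: real^'n^'n)"
  shows "A ** matrix_inv A = mat 1" "matrix_inv A ** A = mat 1"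
proof -
  obtain B where "A ** B = mat 1" "B ** A = mat 1" using assms by (auto simp: invertible_def)
  then show "A ** matrix_inv A = mat 1" "matrix_inv A ** A = mat 1"
    using matrix_inv_eqI by metis+
qed

lemma conj_act_eq: "N \<in> Sp \<Longrightarrow> conj_act N M = N ** M ** spinv N"
  by (simp add: conj_act_def matrix_inv_Sp)

lemma conj_act_mem: "N \<in> Sp \<Longrightarrow> M \<in> Sp \<Longrightarrow> conj_act N M \<in> Sp"
  by (simp add: conj_act_eq Sp_mult Sp_spinv_mem)

lemma conj_act_mult:
  "N \<in> Sp \<Longrightarrow> N' \<in> Sp \<Longrightarrow> conj_act N (conj_act N' M) = conj_act (N ** N') M"
  by (simp add: conj_act_eq Sp_mult spinv_mult matrix_mul_assoc)

lemma conj_act_1: "conj_act (mat 1) M = M"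
proof -
  have "spinv (mat 1) = (mat 1 :: 'a dmat)" using Sp_spinv(2)[OF Sp_mat_1] by simp
  then show ?thesis by (simp add: conj_act_eq Sp_mat_1)
qed

text \<open>Reduces a conjugation to an intertwining relation, so explicit conjugations are verified
  without computing an inverse.\<close>

lemma conj_act_eqI:
  assumes "N \<in> Sp" "N ** M = M' ** N" shows "conj_act N M = M'"
proof -
  have "conj_act N M = (M' ** N) ** spinv N" using assms by (simp add: conj_act_eq)
  also have "\<dots> = M' ** (N ** spinv N)" by (rule matrix_mul_assoc[symmetric])
  finally show ?thesis using assms by simp
qed

lemma spinv_conj_act:
  "N \<in> Sp \<Longrightarrow> spinv (conj_act N M) = conj_act N (spinv M)"
  by (simp add: conj_act_eq spinv_mult matrix_mul_assoc)

lemma SpI_iff: "M \<in> SpI \<longleftrightarrow> M \<in> Sp \<and> spinv M = I_mat ** M ** I_mat"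
  by (auto simp: SpI_def matrix_inv_Sp)

lemma SpI_subset_Sp: "SpI \<subseteq> Sp"
  by (auto simp: SpI_def)

text \<open>The condition with \<open>I_mat\<close> fixes \<open>D\<close> and makes
  \<open>B\<close> and \<open>C\<close> symmetric. After that, \<open>M ** spinv M = mat 1\<close>
  gives four block equations, the last of which is the transpose of the first.\<close>

lemma SpI_block_iff: "block_matrix A B C D \<in> SpI \<longleftrightarrow>
    D = transpose A \<and> transpose B = B \<and> transpose C = C \<and> A ** B = B ** transpose A \<and>
    transpose A ** C = C ** A \<and> A ** A - B ** C = mat 1"
proof -
  have 1: "spinv (block_matrix A B C D) = I_mat ** block_matrix A B C D ** I_mat \<longleftrightarrow>
      D = transpose A \<and> transpose B = B \<and> transpose C = C"
    by (auto simp: I_mat_def)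
  have 2: "block_matrix A B C D \<in> Sp \<longleftrightarrow>
     A ** A - B ** C = mat 1 \<and> A ** B = B ** transpose A \<and> transpose A ** C = C ** A"
    if "D = transpose A \<and> transpose B = B \<and> transpose C = C"
  proof -
    have "block_matrix A B C D \<in> Sp \<longleftrightarrow> block_matrix A B C D ** spinv (block_matrix A B C D) = mat 1"
      using Sp_iff_spinv_left matrix_left_right_inverse by blast
    also have "\<dots> \<longleftrightarrow> A ** A - B ** C = mat 1 \<and> B ** transpose A = A ** B \<and>
        C ** A = transpose A ** C \<and> transpose A ** transpose A - C ** B = mat 1"
      using that by (simp add: mat_block[of 1] eq_commute[of "mat 1"])
    also have "transpose A ** transpose A - C ** B = mat 1 \<longleftrightarrow> A ** A - B ** C = mat 1"
    proof -
      have "transpose (A ** A - B ** C) = transpose A ** transpose A - C ** B"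
        using that by (simp add: matrix_transpose_mul)
      then show ?thesis by (metis transpose_mat transpose_transpose)
    qed
    finally show ?thesis by auto
  qed
  show ?thesis using 1 2 by (auto simp: SpI_iff)
qed

lemma M_ABC_SpI_iff: "M_ABC A B C \<in> SpI \<longleftrightarrow>
    transpose B = B \<and> transpose C = C \<and> A ** B = B ** transpose A \<and>
    transpose A ** C = C ** A \<and> A ** A - B ** C = mat 1"
  by (simp add: M_ABC_def SpI_block_iff)

lemma SpI_exists: 
  assumes "M \<in> SpI" obtains A B C where "M = M_ABC A B C"
  using assms by (rule_tac block_exists[of M]) (auto simp: SpI_block_iff M_ABC_def)

lemma block_M_ABC [simp]:
  "block_A (M_ABC A B C) = A" "block_B (M_ABC A B C) = B" "block_C (M_ABC A B C) = C"
  by (simp_all add: M_ABC_def)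

section \<open>Embedding the general linear group\<close>

text \<open>The standard embedding of the general linear group in the symplectic group, as the
  stabiliser of both Lagrangian coordinate subspaces.\<close>

definition dgl :: "'n::finite sqmat \<Rightarrow> 'n dmat" where
  "dgl R = block_matrix R 0 0 (matrix_inv (transpose R))"

lemma matrix_inv_transpose:
  "invertible (R :: real^'n^'n) \<Longrightarrow> matrix_inv (transpose R) = transpose (matrix_inv R)"
  by (intro matrix_inv_eqI)
    (simp add: matrix_transpose_mul[symmetric] matrix_inv_invertible transpose_mat)

lemma spinv_dgl: "invertible R \<Longrightarrow> spinv (dgl R) = block_matrix (matrix_inv R) 0 0 (transpose R)"
  by (simp add: dgl_def matrix_inv_transpose)

lemma dgl_Sp: "invertible R \<Longrightarrow> dgl R \<in> Sp"
  by (simp add: Sp_iff_spinv_left spinv_dgl)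
    (simp add: dgl_def mat_block[of 1] matrix_inv_transpose matrix_inv_invertible
      matrix_transpose_mul[symmetric] transpose_mat)

lemma conj_dgl: "invertible R \<Longrightarrow> conj_act (dgl R) (block_matrix A B C D) =
    block_matrix (R ** A ** matrix_inv R) (R ** B ** transpose R)
      (matrix_inv (transpose R) ** C ** matrix_inv R) (matrix_inv (transpose R) ** D ** transpose R)"
  by (simp add: conj_act_eq dgl_Sp spinv_dgl) (simp add: dgl_def)

lemma GL_act_eq_conj: "invertible R \<Longrightarrow> M \<in> SpI \<Longrightarrow> GL_act R M = conj_act (dgl R) M"
  by (erule SpI_exists) (simp add: GL_act_def M_ABC_def conj_dgl matrix_transpose_mul matrix_inv_transpose matrix_mul_assoc)

text \<open>Block diagonal matrices commute with \<open>I_mat\<close>, so the defining condition of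
  \<open>SpI\<close> is carried along.\<close>

lemma conj_dgl_SpI:
  assumes "invertible R" "M \<in> SpI" shows "conj_act (dgl R) M \<in> SpI"
proof -
  have M: "M \<in> Sp" "spinv M = I_mat ** M ** I_mat" using assms by (auto simp: SpI_iff)
  have R: "dgl R \<in> Sp" using assms by (simp add: dgl_Sp)
  have "dgl R ** I_mat = I_mat ** dgl R" "spinv (dgl R) ** I_mat = I_mat ** spinv (dgl R)"
    by (simp_all add: I_mat_def dgl_def)
  then have "conj_act (dgl R) (I_mat ** M ** I_mat) = I_mat ** conj_act (dgl R) M ** I_mat"
    using R by (simp add: conj_act_eq matrix_mul_assoc) (simp flip: matrix_mul_assoc)
  then show ?thesis
    using M R by (simp add: SpI_iff conj_act_mem spinv_conj_act)
qed

lemma dgl_mult: 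
  assumes "invertible R" "invertible S" shows "dgl (R ** S) = dgl R ** dgl S"
proof -
  have "R ** S ** (matrix_inv S ** matrix_inv R) = R ** (S ** matrix_inv S) ** matrix_inv R"
    by (simp only: matrix_mul_assoc)
  then have "matrix_inv (R ** S) = matrix_inv S ** matrix_inv R"
    using assms by (intro matrix_inv_eqI) (simp add: matrix_inv_invertible)
  then show ?thesis using assms
    by (simp add: dgl_def matrix_inv_transpose invertible_mult)
      (simp add: matrix_transpose_mul)
qed

lemma GL_act_eqI:
  assumes "invertible R" "R ** A = A' ** R" "R ** B ** transpose R = B'" "C = transpose R ** C' ** R"
  shows "conj_act (dgl R) (M_ABC A B C) = M_ABC A' B' C'"
proof (rule conj_act_eqI)
  show "dgl R \<in> Sp" using assms by (simp add: dgl_Sp)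
  have R: "matrix_inv (transpose R) ** transpose R = mat 1" "transpose R ** matrix_inv (transpose R) = mat 1"
    using assms(1) by (simp_all add: matrix_inv_invertible transpose_invertible)
  have "B' ** matrix_inv (transpose R) = R ** B ** (transpose R ** matrix_inv (transpose R))"
    using assms(3) by (simp add: matrix_mul_assoc)
  moreover have "matrix_inv (transpose R) ** C = (matrix_inv (transpose R) ** transpose R) ** C' ** R"
    using assms(4) by (simp add: matrix_mul_assoc)
  moreover have "matrix_inv (transpose R) ** transpose A = transpose A' ** matrix_inv (transpose R)"
  proof -
    have "transpose A ** transpose R = transpose R ** transpose A'"
      using assms(2) by (metis matrix_transpose_mul)
    then have "matrix_inv (transpose R) ** (transpose A ** transpose R) ** matrix_inv (transpose R)
       = (matrix_inv (transpose R) ** transpose R) ** transpose A' ** matrix_inv (transpose R)"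
      by (simp add: matrix_mul_assoc)
    moreover have "matrix_inv (transpose R) ** (transpose A ** transpose R) ** matrix_inv (transpose R)
        = matrix_inv (transpose R) ** transpose A ** (transpose R ** matrix_inv (transpose R))"
      by (simp only: matrix_mul_assoc)
    ultimately show ?thesis by (simp add: R)
  qed
  ultimately show "dgl R ** M_ABC A B C = M_ABC A' B' C' ** dgl R"
    using assms(2) by (simp add: dgl_def M_ABC_def R)
qed

lemma invertible_m2: "a * d - b * c \<noteq> 0 \<Longrightarrow> invertible (m2 a b c d)"
  by (simp add: invertible_det_nz)

section \<open>The symmetric part of a symplectic matrix\<close>

definition hsum :: "'n::finite dmat \<Rightarrow> 'n dmat" where
  "hsum M = (1/2) *\<^sub>R (M + spinv M)"

text \<open>Read off from \<open>hsum M\<close>, which is the block diagonal matrix of \<open>A\<close> and \<open>A\<^sup>T\<close> on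
  \<open>M_ABC A B C\<close>, the pair \<open>(tr A, det A)\<close> makes sense for every symplectic matrix.\<close>

definition base_pt :: "2 dmat \<Rightarrow> real \<times> real" where
  "base_pt M = (trace (hsum M) / 2, ((trace (hsum M))\<^sup>2 / 2 - trace (hsum M ** hsum M)) / 4)"

lemma matrix_scaleR_assoc [simp]:
  "(x *\<^sub>R A) ** (B :: real^'n^'m) = x *\<^sub>R (A ** B)" "A ** (x *\<^sub>R B) = x *\<^sub>R (A ** B)"
  by (simp_all add: vec_eq_iff matrix_matrix_mult_def sum_distrib_left mult_ac)

lemma matrix_mult_add_rdistrib: "((A + B) :: real^'n^'m) ** C = A ** C + B ** C"
  by (simp add: vec_eq_iff matrix_matrix_mult_def sum.distrib algebra_simps)

lemma hsum_conj_act: "N \<in> Sp \<Longrightarrow> hsum (conj_act N M) = conj_act N (hsum M)"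
  by (simp add: hsum_def spinv_conj_act)
    (simp add: conj_act_eq matrix_add_ldistrib matrix_mult_add_rdistrib)

lemma conj_act_matrix_mult:
  assumes "N \<in> Sp" shows "conj_act N X ** conj_act N Y = conj_act N (X ** Y)"
proof -
  have "conj_act N X ** conj_act N Y = N ** X ** (spinv N ** N) ** Y ** spinv N"
    using assms by (simp only: conj_act_eq matrix_mul_assoc)
  then show ?thesis using assms by (simp add: conj_act_eq matrix_mul_assoc)
qed

lemma trace_conj_act:
  assumes "N \<in> Sp" shows "trace (conj_act N X) = trace X"
proof -
  have "trace (conj_act N X) = trace (spinv N ** (N ** X))"
    using assms trace_mul_sym by (metis conj_act_eq)
  then show ?thesis using assms by (simp add: matrix_mul_assoc)
qed

lemma base_pt_conj_act: "N \<in> Sp \<Longrightarrow> base_pt (conj_act N M) = base_pt M"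
  by (simp add: base_pt_def hsum_conj_act conj_act_matrix_mult trace_conj_act)

lemma hsum_M_ABC:
  "transpose B = B \<Longrightarrow> transpose C = C \<Longrightarrow> hsum (M_ABC A B C) = block_matrix A 0 0 (transpose A)"
  by (simp add: hsum_def M_ABC_def)

text \<open>Here \<open>hsum\<close> is the block sum of \<open>A\<close> and its transpose: its
  trace is twice \<open>trace A\<close>, and the trace of its square is twice
  \<open>(trace A)\<^sup>2 - 2 * det A\<close>. The second component of \<open>base_pt\<close>
  solves this for \<open>det A\<close>.\<close>

lemma base_pt_M_ABC:
  assumes "M_ABC A B C \<in> SpI" shows "base_pt (M_ABC A B C) = (trace A, det A)"
proof -
  obtain a b c d where A: "A = m2 a b c d" by (rule m2_exists)
  have "hsum (M_ABC A B C) = block_matrix A 0 0 (transpose A)"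
    using assms by (intro hsum_M_ABC) (auto simp: M_ABC_SpI_iff)
  then show ?thesis
    by (simp add: base_pt_def A power2_eq_square field_simps)
qed

text \<open>The Cayley-Hamilton identity for the Pfaffian: \<open>hsum M\<close> is self-adjoint for the symplectic
  form, so its characteristic polynomial is a square.\<close>

lemma hsum_square:
  assumes "base_pt M = (t, d)"
  shows "hsum M ** hsum M = t *\<^sub>R hsum M - d *\<^sub>R mat 1"
proof -
  obtain A B C D where M: "M = block_matrix A B C D" by (rule block_exists)
  obtain a1 a2 a3 a4 where A: "A = m2 a1 a2 a3 a4" by (rule m2_exists)
  obtain b1 b2 b3 b4 where B: "B = m2 b1 b2 b3 b4" by (rule m2_exists)
  obtain c1 c2 c3 c4 where C: "C = m2 c1 c2 c3 c4" by (rule m2_exists)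
  obtain d1 d2 d3 d4 where D: "D = m2 d1 d2 d3 d4" by (rule m2_exists)
  define p1 p2 p3 p4 x y where "p1 = (a1 + d1) / 2" and "p2 = (a2 + d3) / 2" and "p3 = (a3 + d2) / 2"
    and "p4 = (a4 + d4) / 2" and "x = (b2 - b3) / 2" and "y = (c2 - c3) / 2"
  \<comment> \<open>A self-adjoint matrix has transposed diagonal blocks and skew off-diagonal
    blocks. The number \<open>d\<close> below turns out to be the Pfaffian expression
    \<open>p1 * p4 - p2 * p3 + x * y\<close>.\<close>
  then have H: "hsum M = block_matrix (m2 p1 p2 p3 p4) (m2 0 x (- x) 0) (m2 0 y (- y) 0) (m2 p1 p3 p2 p4)"
    by (simp add: hsum_def M A B C D add_divide_distrib diff_divide_distrib)
  have tr: "t = p1 + p4" using assms unfolding base_pt_def H by simp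
  have "d = ((2 * (p1 + p4))\<^sup>2 / 2 - 2 * (p1 * p1 + p4 * p4 + 2 * (p2 * p3) - 2 * (x * y))) / 4"
    using assms unfolding base_pt_def H by (auto simp: algebra_simps)
  then have "4 * d = 4 * (p1 * p4 - p2 * p3 + x * y)" by (simp add: power2_eq_square algebra_simps add_divide_distrib)
  then have "d = p1 * p4 - p2 * p3 + x * y" by simp
  with tr show ?thesis
    unfolding H mat_block[of 1] mat_m2 zero_m2 by (simp add: algebra_simps)
qed

lemma continuous_on_matrix_mult [continuous_intros]:
  fixes f :: "'a::topological_space \<Rightarrow> real^'n^'m" and g :: "'a \<Rightarrow> real^'k^'n"
  shows "continuous_on S f \<Longrightarrow> continuous_on S g \<Longrightarrow> continuous_on S (\<lambda>x. f x ** g x)"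
  unfolding matrix_matrix_mult_def by (intro continuous_intros)

lemma continuous_on_transpose [continuous_intros]:
  fixes f :: "'a::topological_space \<Rightarrow> real^'n^'m"
  shows "continuous_on S f \<Longrightarrow> continuous_on S (\<lambda>x. transpose (f x))"
  unfolding transpose_def by (intro continuous_intros)

lemma continuous_on_trace [continuous_intros]:
  fixes f :: "'a::topological_space \<Rightarrow> real^'n^'n"
  shows "continuous_on S f \<Longrightarrow> continuous_on S (\<lambda>x. trace (f x))"
  unfolding trace_def by (intro continuous_intros)

lemma continuous_on_hsum [continuous_intros]:
  "continuous_on S f \<Longrightarrow> continuous_on S (\<lambda>x. hsum (f x))"
  unfolding hsum_def spinv_def by (intro continuous_intros)

lemma continuous_on_base_pt: "continuous_on S base_pt"
  unfolding base_pt_def by (intro continuous_intros) auto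

lemma continuous_on_conj_act: "continuous_on S (conj_act N)"
  unfolding conj_act_def by (intro continuous_intros)

section \<open>Reduction to normal form under the general linear group\<close>

definition HI :: "'n::finite dmat set" where
  "HI = dgl ` GL"

lemma HI_Sp: "N \<in> HI \<Longrightarrow> N \<in> Sp"
  by (auto simp: HI_def GL_def dgl_Sp)

lemma HI_mult: "N \<in> HI \<Longrightarrow> N' \<in> HI \<Longrightarrow> N ** N' \<in> HI"
  by (auto simp: HI_def GL_def invertible_mult simp flip: dgl_mult)

lemma HI_1: "mat 1 \<in> HI"
proof -
  have "matrix_inv (mat 1) = (mat 1 :: 'a sqmat)" by (simp add: matrix_inv_eqI)
  then have "mat 1 = dgl (mat 1 :: 'a sqmat)" by (simp add: dgl_def mat_block[of 1] transpose_mat)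
  moreover have "invertible (mat 1 :: 'a sqmat)" by (auto simp: invertible_def)
  ultimately show ?thesis by (auto simp: HI_def GL_def)
qed

lemma conj_act_continuous_action:
  assumes "H \<subseteq> Sp" "X \<subseteq> Sp" "mat 1 \<in> H" "\<And>N N'. N \<in> H \<Longrightarrow> N' \<in> H \<Longrightarrow> N ** N' \<in> H"
    and "\<And>N M. N \<in> H \<Longrightarrow> M \<in> X \<Longrightarrow> conj_act N M \<in> X"
  shows "continuous_action X H conj_act"
proof
  show "continuous_on X (conj_act g)" for g by (rule continuous_on_conj_act)
  show "conj_act g x \<in> X" if "g \<in> H" "x \<in> X" for g x using that by fact
  show "x \<in> orbit H conj_act x" for x
    using assms(3) conj_act_1[of x] by (force simp: orbit_def)
  show "conj_act g y \<in> orbit H conj_act x" if g: "g \<in> H" and y: "y \<in> orbit H conj_act x" for g x y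
  proof -
    obtain h where "h \<in> H" "y = conj_act h x" using y by (auto simp: orbit_def)
    moreover from this have "conj_act g y = conj_act (g ** h) x"
      using assms(1) g conj_act_mult by blast
    ultimately show ?thesis using assms(4) g by (auto simp: orbit_def)
  qed
qed

interpretation actI: continuous_action SpI HI conj_act
proof (rule conj_act_continuous_action)
  show "conj_act N M \<in> SpI" if "N \<in> HI" "M \<in> SpI" for N M :: "'a dmat"
    using that by (auto simp: HI_def GL_def conj_dgl_SpI)
qed (auto simp: HI_Sp HI_1 HI_mult SpI_subset_Sp[THEN subsetD])

interpretation actS: continuous_action Sp Sp conj_act
  by (rule conj_act_continuous_action) (auto simp: Sp_mat_1 Sp_mult conj_act_mem)

lemma orbit_GL_act: "M \<in> SpI \<Longrightarrow> orbit GL GL_act M = orbit HI conj_act M"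
  by (auto simp: orbit_def HI_def GL_def GL_act_eq_conj) (metis GL_act_eq_conj)

lemma actI_imp_actS: "actI.degenerates M M' \<Longrightarrow> actS.degenerates M M'"
proof -
  assume *: "actI.degenerates M M'"
  have "orbit HI conj_act M \<subseteq> orbit Sp conj_act M"
    using HI_Sp by (fastforce simp: orbit_def)
  then have "closure (orbit HI conj_act M) \<subseteq> closure (orbit Sp conj_act M)"
    by (rule closure_mono)
  with * SpI_subset_Sp show ?thesis
    by (auto simp: actI.degenerates_def actS.degenerates_def)
qed

section \<open>Block sums and normal forms\<close>

definition Dg :: "real \<Rightarrow> real \<Rightarrow> real \<Rightarrow> real \<Rightarrow> real \<Rightarrow> real \<Rightarrow> 2 dmat" where
  "Dg a1 a2 b1 b2 c1 c2 = M_ABC (m2 a1 0 0 a2) (m2 b1 0 0 b2) (m2 c1 0 0 c2)"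

text \<open>For a sign \<open>e\<close> the entry \<open>(a\<^sup>2 - 1) * e\<close> is the solution
  \<open>c\<close> of \<open>a\<^sup>2 - e * c = 1\<close>. For \<open>a\<^sup>2 = 1\<close> and
  \<open>e = 0\<close> the block is \<open>a\<close> times the identity.\<close>

definition nfD :: "real \<Rightarrow> real \<Rightarrow> real \<Rightarrow> real \<Rightarrow> 2 dmat" where
  "nfD a1 a2 e1 e2 = Dg a1 a2 e1 e2 ((a1\<^sup>2 - 1) * e1) ((a2\<^sup>2 - 1) * e2)"

text \<open>The block \<open>A\<close> represents \<open>u + iv\<close>. The relation
  \<open>AB = BA\<^sup>T\<close> makes \<open>B\<close> symmetric of trace zero;
  \<open>diag(1, -1)\<close> is one such matrix, and \<open>C\<close> is then forced to be the
  inverse of \<open>B\<close> times \<open>A\<^sup>2 - I\<close>.\<close>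

definition nfN :: "real \<Rightarrow> real \<Rightarrow> 2 dmat" where
  "nfN u v = M_ABC (m2 u v (-v) u) (m2 1 0 0 (-1))
     (m2 (u\<^sup>2 - v\<^sup>2 - 1) (2 * u * v) (2 * u * v) (1 + v\<^sup>2 - u\<^sup>2))"

lemma Dg_SpI_iff: "Dg a1 a2 b1 b2 c1 c2 \<in> SpI \<longleftrightarrow> a1\<^sup>2 - b1 * c1 = 1 \<and> a2\<^sup>2 - b2 * c2 = 1"
  by (auto simp: Dg_def M_ABC_SpI_iff mat_m2 power2_eq_square)

lemma nfN_SpI: "nfN u v \<in> SpI"
  by (simp add: nfN_def M_ABC_SpI_iff mat_m2 power2_eq_square algebra_simps)

lemma base_pt_Dg: "Dg a1 a2 b1 b2 c1 c2 \<in> SpI \<Longrightarrow> base_pt (Dg a1 a2 b1 b2 c1 c2) = (a1 + a2, a1 * a2)"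
  by (simp add: Dg_def base_pt_M_ABC)

lemma base_pt_nfN: "base_pt (nfN u v) = (2 * u, u\<^sup>2 + v\<^sup>2)"
  using nfN_SpI[of u v] by (simp add: nfN_def base_pt_M_ABC power2_eq_square)

lemma Dg_inject [simp]: "Dg a1 a2 b1 b2 c1 c2 = Dg a1' a2' b1' b2' c1' c2' \<longleftrightarrow>
    a1 = a1' \<and> a2 = a2' \<and> b1 = b1' \<and> b2 = b2' \<and> c1 = c1' \<and> c2 = c2'"
  by (auto simp: Dg_def M_ABC_def)

lemma M_ABC_m2_SpI_iff:
  "M_ABC (m2 p q r s) (m2 b1 b2 b2' b3) (m2 c1 c2 c2' c3) \<in> SpI \<longleftrightarrow>
     b2' = b2 \<and> c2' = c2 \<and> p * b2 + q * b3 = b1 * r + b2 * s \<and> p * c2 + r * c3 = c1 * q + c2 * s \<and>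
     p * p + q * r - (b1 * c1 + b2 * c2) = 1 \<and> p * q + q * s = b1 * c2 + b2 * c3 \<and>
     r * p + s * r = b2 * c1 + b3 * c2 \<and> r * q + s * s - (b2 * c2 + b3 * c3) = 1"
  unfolding M_ABC_SpI_iff mat_m2 m2_simps m2_inject
  by (safe; simp add: mult.commute add.commute)

lemma M_ABC_SpI_sym:
  assumes "M_ABC A B C \<in> SpI" shows "transpose B = B" "transpose C = C"
  using assms by (simp_all only: M_ABC_SpI_iff)

lemma m2_symmetric_iff: "transpose (m2 a b c d) = m2 a b c d \<longleftrightarrow> c = b"
  unfolding m2_simps m2_inject by blast

text \<open>A matrix \<open>R\<close> intertwining \<open>A\<close> with the desired
  \<open>A'\<close> moves \<open>B\<close> by congruence and determines the new \<open>C\<close>,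
  both staying symmetric. The reductions below thus only have to find \<open>R\<close>.\<close>

lemma GL_reduce:
  fixes A B C :: "2 sqmat"
  assumes "det R \<noteq> 0" "R ** A = A' ** R" "M_ABC A B C \<in> SpI"
  shows "\<exists>N p q r x y z. N \<in> HI \<and> R ** B ** transpose R = m2 p q q r \<and>
    conj_act N (M_ABC A B C) = M_ABC A' (m2 p q q r) (m2 x y y z) \<and>
    M_ABC A' (m2 p q q r) (m2 x y y z) \<in> SpI"
proof -
  have R: "invertible R" using assms(1) by (simp add: invertible_det_nz)
  define C' where "C' = matrix_inv (transpose R) ** C ** matrix_inv R"
  have "transpose R ** C' ** R = (transpose R ** matrix_inv (transpose R)) ** C ** (matrix_inv R ** R)"
    unfolding C'_def by (simp only: matrix_mul_assoc)
  then have "C = transpose R ** C' ** R"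
    using R by (simp add: matrix_inv_invertible transpose_invertible)
  then have *: "conj_act (dgl R) (M_ABC A B C) = M_ABC A' (R ** B ** transpose R) C'"
    using R assms(2) by (intro GL_act_eqI) auto
  then have S: "M_ABC A' (R ** B ** transpose R) C' \<in> SpI"
    using conj_dgl_SpI[OF R assms(3)] by simp
  obtain p q q' r where B: "R ** B ** transpose R = m2 p q q' r" by (rule m2_exists)
  obtain x y y' z where C: "C' = m2 x y y' z" by (rule m2_exists)
  have "q' = q" "y' = y"
    using M_ABC_SpI_sym[OF S] unfolding B C m2_symmetric_iff .
  moreover have "dgl R \<in> HI" using R by (auto simp: HI_def GL_def)
  ultimately show ?thesis using * S unfolding B C by blast
qed

text \<open>Once \<open>A\<close> is diagonal with distinct entries, \<open>AB = BA\<^sup>T\<close>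
  and \<open>A\<^sup>TC = CA\<close> force \<open>B\<close> and \<open>C\<close> to be diagonal as
  well.\<close>

lemma SpI_diag_distinct:
  assumes "M \<in> SpI" "base_pt M = (a1 + a2, a1 * a2)" "a1 \<noteq> a2"
  obtains N b1 b2 c1 c2 where "N \<in> HI" "conj_act N M = Dg a1 a2 b1 b2 c1 c2"
proof -
  obtain A B C where M: "M = M_ABC A B C" using assms(1) by (rule SpI_exists)
  obtain p q r s where A: "A = m2 p q r s" by (rule m2_exists)
  have tr: "p + s = a1 + a2" and dt: "p * s - q * r = a1 * a2"
    using assms(1,2) unfolding M by (auto simp: base_pt_M_ABC A)
  have s: "s = a1 + a2 - p" using tr by simp
  have "q * r = (a1 - p) * (p - a2)" using dt unfolding s by (simp add: algebra_simps)
  \<comment> \<open>The rows of \<open>R\<close> are left eigenvectors of \<open>A\<close>: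
    \<open>(r, a_i - p)\<close> if \<open>r\<close> is nonzero, \<open>(a_i - s, q)\<close> if
    \<open>r\<close> vanishes but \<open>q\<close> does not. A diagonal \<open>A\<close> needs at
    most a swap.\<close>
  obtain R where R: "det R \<noteq> 0" "R ** A = m2 a1 0 0 a2 ** R"
  proof (cases "r = 0")
    case False
    have "a1 * (a1 - p) = r * q + (a1 - p) * s" "a2 * (a2 - p) = r * q + (a2 - p) * s"
      using \<open>q * r = _\<close> unfolding s by (simp_all add: algebra_simps)
    then have "m2 r (a1 - p) r (a2 - p) ** A = m2 a1 0 0 a2 ** m2 r (a1 - p) r (a2 - p)"
      unfolding A by (simp add: algebra_simps)
    moreover have "det (m2 r (a1 - p) r (a2 - p)) \<noteq> 0"
      using False assms(3) by (simp add: algebra_simps)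
    ultimately show ?thesis using that by blast
  next
    case True
    then have *: "a1 = p \<or> a2 = p" using \<open>q * r = _\<close> by auto
    show ?thesis
    proof (cases "q = 0")
      case False
      have "m2 (a1 - s) q (a2 - s) q ** A = m2 a1 0 0 a2 ** m2 (a1 - s) q (a2 - s) q"
        using * unfolding A s True by (auto simp: algebra_simps)
      moreover have "det (m2 (a1 - s) q (a2 - s) q) \<noteq> 0"
        using False assms(3) by (simp add: algebra_simps)
      ultimately show ?thesis using that by blast
    next
      case q: True
      show ?thesis
      proof (cases "a1 = p")
        case True
        have "mat 1 ** A = m2 a1 0 0 a2 ** mat 1"
          unfolding A s True q \<open>r = 0\<close> by simp
        then show ?thesis using that[of "mat 1"] by simp
      next
        case False
        then have "a2 = p" using * by simp
        have "m2 0 1 1 0 ** A = m2 a1 0 0 a2 ** m2 0 1 1 0"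
          unfolding A s \<open>a2 = p\<close> q \<open>r = 0\<close> by simp
        then show ?thesis using that[of "m2 0 1 1 0"] by simp
      qed
    qed
  qed
  obtain N b1 b b2 c1 c c2 where N: "N \<in> HI" "conj_act N M = M_ABC (m2 a1 0 0 a2) (m2 b1 b b b2) (m2 c1 c c c2)"
    "M_ABC (m2 a1 0 0 a2) (m2 b1 b b b2) (m2 c1 c c c2) \<in> SpI"
    using GL_reduce[OF R] assms(1) unfolding M by blast
  have "(a1 - a2) * b = 0" "(a1 - a2) * c = 0"
    using N(3) unfolding M_ABC_m2_SpI_iff by (simp_all add: algebra_simps)
  then have "b = 0" "c = 0" using assms(3) by simp_all
  then show ?thesis using that N by (simp add: Dg_def)
qed

text \<open>The complex equation \<open>(r + is)\<^sup>2(b - ic) = 1\<close>.\<close>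

lemma complex_square_real:
  fixes b c :: real
  assumes "(b, c) \<noteq> (0, 0)"
  obtains r s where "(r\<^sup>2 - s\<^sup>2) * b + 2 * r * s * c = 1" "(r\<^sup>2 - s\<^sup>2) * c = 2 * r * s * b"
proof -
  define w where "w = csqrt (inverse (Complex b (- c)))"
  have "Complex b (- c) \<noteq> 0" using assms by (auto simp: complex_eq_iff)
  then have "w ^ 2 * Complex b (- c) = 1" unfolding w_def by simp
  then show ?thesis
    using that[of "Re w" "Im w"] by (auto simp: complex_eq_iff power2_eq_square algebra_simps)
qed

text \<open>With \<open>A\<close> in the form \<open>u + iv\<close>, the block \<open>B\<close> is
  symmetric of trace zero, that is, a complex number. Matrices commuting with \<open>A\<close> are
  complex scalars and multiply \<open>B\<close> by a square, so a complex square root normalises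
  \<open>B\<close>; the equation for \<open>A\<^sup>2 - BC\<close> fixes \<open>C\<close>.\<close>

lemma SpI_complex:
  assumes "M \<in> SpI" "base_pt M = (2 * u, u\<^sup>2 + v\<^sup>2)" "v > 0"
  obtains N where "N \<in> HI" "conj_act N M = nfN u v"
proof -
  obtain A B C where M: "M = M_ABC A B C" using assms(1) by (rule SpI_exists)
  obtain p q r s where A: "A = m2 p q r s" by (rule m2_exists)
  have tr: "p + s = 2 * u" and dt: "p * s - q * r = u\<^sup>2 + v\<^sup>2"
    using assms(1,2) unfolding M by (auto simp: base_pt_M_ABC A)
  have s: "s = 2 * u - p" using tr by simp
  have qr: "q * r = - (v\<^sup>2 + (p - u)\<^sup>2)" using dt unfolding s by (simp add: algebra_simps power2_eq_square)
  have "v\<^sup>2 + (p - u)\<^sup>2 > 0" using assms(3) by (simp add: add_pos_nonneg)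
  then have q: "q \<noteq> 0" using qr by auto
  let ?A = "m2 u v (- v) u"
  have "m2 v 0 (p - u) q ** A = ?A ** m2 v 0 (p - u) q"
    unfolding A s using qr by (simp add: algebra_simps power2_eq_square)
  moreover have "det (m2 v 0 (p - u) q) \<noteq> 0" using q assms(3) by simp
  ultimately obtain N b c b' x y z where N: "N \<in> HI" 
    "conj_act N M = M_ABC ?A (m2 b c c b') (m2 x y y z)" "M_ABC ?A (m2 b c c b') (m2 x y y z) \<in> SpI"
    using GL_reduce assms(1) unfolding M by blast
  have eqs: "u * c + v * b' = - (b * v) + c * u" "u * u - v * v - (b * x + c * y) = 1"
      "2 * u * v - (b * y + c * z) = 0"
    using N(3) unfolding M_ABC_m2_SpI_iff by (simp_all add: algebra_simps)
  have "v * (b' + b) = 0" using eqs(1) by (simp add: algebra_simps)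
  then have b': "b' = - b" using assms(3) by simp
  \<comment> \<open>With \<open>B = 0\<close> one would have \<open>A\<^sup>2 = 1\<close>,
    impossible for non-real eigenvalues.\<close>
  have "(b, c) \<noteq> (0, 0)"
  proof
    assume "(b, c) = (0, 0)"
    then have "u * v = 0" "u * u - v * v = 1" using eqs by auto
    then have "- (v * v) = 1" using assms(3) by auto
    then show False using zero_le_square[of v] by linarith
  qed
  then obtain r s where rs: "(r\<^sup>2 - s\<^sup>2) * b + 2 * r * s * c = 1" "(r\<^sup>2 - s\<^sup>2) * c = 2 * r * s * b"
    by (rule complex_square_real)
  \<comment> \<open>Congruence by this matrix sends \<open>b - ic\<close> to
    \<open>(r + is)\<^sup>2 (b - ic)\<close>.\<close>
  let ?R = "m2 r s (- s) r"
  have "(r, s) \<noteq> (0, 0)" using rs by auto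
  then have "det ?R \<noteq> 0" by (simp add: sum_squares_eq_zero_iff)
  moreover have "?R ** ?A = ?A ** ?R" by (simp add: algebra_simps)
  ultimately obtain N' p' q' r' x' y' z' where N': "N' \<in> HI"
    "?R ** m2 b c c b' ** transpose ?R = m2 p' q' q' r'"
    "conj_act N' (M_ABC ?A (m2 b c c b') (m2 x y y z)) = M_ABC ?A (m2 p' q' q' r') (m2 x' y' y' z')"
    "M_ABC ?A (m2 p' q' q' r') (m2 x' y' y' z') \<in> SpI"
    using GL_reduce N(3) by blast
  have b2: "m2 p' q' q' r' = m2 1 0 0 (- 1)"
    using rs unfolding N'(2)[symmetric] b' by (simp add: algebra_simps power2_eq_square)
  have "x' = u\<^sup>2 - v\<^sup>2 - 1 \<and> y' = 2 * u * v \<and> z' = 1 + v\<^sup>2 - u\<^sup>2"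
    using N'(4) unfolding b2 M_ABC_m2_SpI_iff by (simp add: power2_eq_square)
  then have "conj_act N' (conj_act N M) = nfN u v"
    unfolding N(2) N'(3) b2 nfN_def by simp
  then show ?thesis
    using that[of "N' ** N"] N(1) N'(1) by (simp add: conj_act_mult HI_Sp HI_mult)
qed

lemma tendsto_m2 [tendsto_intros]:
  assumes "(a \<longlongrightarrow> a') F" "(b \<longlongrightarrow> b') F" "(c \<longlongrightarrow> c') F" "(d \<longlongrightarrow> d') F"
  shows "((\<lambda>x. m2 (a x) (b x) (c x) (d x)) \<longlongrightarrow> m2 a' b' c' d') F"
  unfolding m2_def by (intro tendsto_vec_lambda) (auto intro: assms)

lemma tendsto_block_matrix [tendsto_intros]:
  assumes "(a \<longlongrightarrow> a') F" "(b \<longlongrightarrow> b') F" "(c \<longlongrightarrow> c') F" "(d \<longlongrightarrow> d') F"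
  shows "((\<lambda>x. block_matrix (a x) (b x) (c x) (d x)) \<longlongrightarrow> block_matrix a' b' c' d') F"
proof -
  have "((\<lambda>x. block_matrix (a x) (b x) (c x) (d x) $ i $ j) \<longlongrightarrow> block_matrix a' b' c' d' $ i $ j) F" for i j
    by (cases i; cases j) (auto intro!: tendsto_intros assms)
  then show ?thesis by (intro vec_tendstoI)
qed

lemma conj_dgl_diag_M_ABC:
  assumes "s \<noteq> 0" "t \<noteq> 0"
  shows "conj_act (dgl (m2 s 0 0 t)) (M_ABC (m2 a1 a2 a3 a4) (m2 b1 b2 b3 b4) (m2 c1 c2 c3 c4)) =
    M_ABC (m2 a1 (s * a2 / t) (t * a3 / s) a4) (m2 (s\<^sup>2 * b1) (s * t * b2) (s * t * b3) (t\<^sup>2 * b4))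
      (m2 (c1 / s\<^sup>2) (c2 / (s * t)) (c3 / (s * t)) (c4 / t\<^sup>2))"
  using assms by (intro GL_act_eqI invertible_m2) (auto simp: field_simps power2_eq_square)

lemma dgl_m2_HI: "a * d - b * c \<noteq> 0 \<Longrightarrow> dgl (m2 a b c d) \<in> HI"
  by (auto simp: HI_def GL_def invertible_m2)

lemma Dg_swap: "conj_act (dgl (m2 0 1 1 0)) (Dg a1 a2 b1 b2 c1 c2) = Dg a2 a1 b2 b1 c2 c1"
  unfolding Dg_def by (intro GL_act_eqI invertible_m2) auto

text \<open>A diagonal scaling by \<open>r\<close> multiplies \<open>b\<close> by
  \<open>r\<^sup>2\<close> and divides \<open>c\<close> by it. If \<open>a\<^sup>2\<close> is not 1,
  then \<open>b\<close> is nonzero and a constant scaling turns it into its sign. If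
  \<open>a\<^sup>2 = 1\<close>, one of \<open>b\<close>, \<open>c\<close> vanishes and the other is
  scaled away in the limit.\<close>

lemma scaling_sequence:
  assumes "a\<^sup>2 - b * c = (1::real)"
  defines "e \<equiv> (if a\<^sup>2 = 1 then 0 else sgn b)"
  obtains r :: "nat \<Rightarrow> real" where "\<And>n. r n \<noteq> 0" "(\<lambda>n. (r n)\<^sup>2 * b) \<longlonglongrightarrow> e"
    "(\<lambda>n. c / (r n)\<^sup>2) \<longlonglongrightarrow> (a\<^sup>2 - 1) * e"
proof -
  have l: "(\<lambda>n. (1 / real (Suc n))\<^sup>2 * x) \<longlonglongrightarrow> 0" for x :: real
    using tendsto_mult[OF tendsto_power[OF LIMSEQ_Suc[OF lim_1_over_n], of 2] tendsto_const[of x]]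
    by simp
  consider "a\<^sup>2 \<noteq> 1" | "a\<^sup>2 = 1" "b = 0" | "a\<^sup>2 = 1" "c = 0" using assms(1) by force
  then show ?thesis
  proof cases
    case 1
    then have b: "b \<noteq> 0" using assms(1) by auto
    then have "(sqrt \<bar>b\<bar>)\<^sup>2 = \<bar>b\<bar>" by simp
    then have "(1 / sqrt \<bar>b\<bar>)\<^sup>2 * b = e" "c / (1 / sqrt \<bar>b\<bar>)\<^sup>2 = (a\<^sup>2 - 1) * e"
      using b 1 assms(1) by (auto simp: e_def power_divide sgn_real_def field_simps split: if_splits)
    then show ?thesis using that[of "\<lambda>_. 1 / sqrt \<bar>b\<bar>"] b by simp
  next
    case 2
    then show ?thesis
      using that[of "\<lambda>n. real (Suc n)"] l[of c] by (simp add: e_def power_divide)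
  next
    case 3
    then show ?thesis
      using that[of "\<lambda>n. 1 / real (Suc n)"] l[of b] by (simp add: e_def)
  qed
qed

lemma Dg_degenerates:
  assumes "Dg a1 a2 b1 b2 c1 c2 \<in> SpI"
  defines "e1 \<equiv> (if a1\<^sup>2 = 1 then 0 else sgn b1)" and "e2 \<equiv> (if a2\<^sup>2 = 1 then 0 else sgn b2)"
  shows "nfD a1 a2 e1 e2 \<in> SpI" "actI.degenerates (Dg a1 a2 b1 b2 c1 c2) (nfD a1 a2 e1 e2)"
proof -
  have *: "a1\<^sup>2 - b1 * c1 = 1" "a2\<^sup>2 - b2 * c2 = 1" using assms by (auto simp: Dg_SpI_iff)
  have e: "e1 * e1 = 1 \<or> a1\<^sup>2 = 1" "e2 * e2 = 1 \<or> a2\<^sup>2 = 1"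
    using * by (auto simp: e1_def e2_def sgn_real_def)
  then show S: "nfD a1 a2 e1 e2 \<in> SpI"
    unfolding nfD_def Dg_SpI_iff by (auto simp: algebra_simps)
  obtain s where s: "\<And>n. s n \<noteq> 0" "(\<lambda>n. (s n)\<^sup>2 * b1) \<longlonglongrightarrow> e1" "(\<lambda>n. c1 / (s n)\<^sup>2) \<longlonglongrightarrow> (a1\<^sup>2 - 1) * e1"
    using scaling_sequence[OF *(1)] unfolding e1_def by metis
  obtain t where t: "\<And>n. t n \<noteq> 0" "(\<lambda>n. (t n)\<^sup>2 * b2) \<longlonglongrightarrow> e2" "(\<lambda>n. c2 / (t n)\<^sup>2) \<longlonglongrightarrow> (a2\<^sup>2 - 1) * e2"
    using scaling_sequence[OF *(2)] unfolding e2_def by metis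
  show "actI.degenerates (Dg a1 a2 b1 b2 c1 c2) (nfD a1 a2 e1 e2)"
  proof (rule actI.degenerates_limit)
    show "dgl (m2 (s n) 0 0 (t n)) \<in> HI" for n using s(1) t(1) by (simp add: dgl_m2_HI)
    show "(\<lambda>n. conj_act (dgl (m2 (s n) 0 0 (t n))) (Dg a1 a2 b1 b2 c1 c2)) \<longlonglongrightarrow> nfD a1 a2 e1 e2"
      unfolding Dg_def nfD_def conj_dgl_diag_M_ABC[OF s(1) t(1)]
      using s t by (auto simp: M_ABC_def intro!: tendsto_intros)
  qed (use S assms in auto)
qed

text \<open>Completion of the square; if both diagonal entries vanish, sum and difference of the
  basis vectors diagonalise the form.\<close>

lemma symmetric_congruent_diag:
  obtains R x y where "det R \<noteq> 0" "R ** m2 p q q r ** transpose R = m2 x 0 0 y"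
proof -
  consider "q = 0" | "p \<noteq> 0" | "r \<noteq> 0" | "p = 0" "r = 0" by blast
  then show ?thesis
  proof cases
    case 1 then show ?thesis using that[of "m2 1 0 0 1"] by simp
  next
    case 2 then show ?thesis using that[of "m2 1 0 (- q / p) 1" p "r - q * q / p"] by (simp add: field_simps)
  next
    case 3 then show ?thesis using that[of "m2 1 (- q / r) 0 1" "p - q * q / r" r] by (simp add: field_simps)
  next
    case 4 then show ?thesis using that[of "m2 1 1 1 (-1)"] by simp
  qed
qed

text \<open>A scalar \<open>A\<close> commutes with every \<open>R\<close>, so \<open>B\<close> can
  be diagonalised freely. The off-diagonal entry of \<open>C\<close> is killed by both entries of
  \<open>B\<close>: it is zero, or \<open>B\<close> is zero and \<open>C\<close> can be diagonalised
  instead.\<close>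

lemma SpI_scalar_diag:
  assumes S: "M_ABC (m2 a 0 0 a) B C \<in> SpI"
  obtains N b1 b2 c1 c2 where "N \<in> HI" "conj_act N (M_ABC (m2 a 0 0 a) B C) = Dg a a b1 b2 c1 c2"
proof -
  let ?A = "m2 a 0 0 a"
  obtain p q q' r where B: "B = m2 p q q' r" by (rule m2_exists)
  have q: "q' = q" using M_ABC_SpI_sym(1)[OF S] unfolding B m2_symmetric_iff .
  have comm: "R ** ?A = ?A ** R" for R
    by (rule m2_exists[of R]) simp
  obtain R b1 b2 where R: "det R \<noteq> 0" "R ** B ** transpose R = m2 b1 0 0 b2"
    unfolding B q by (rule symmetric_congruent_diag)
  obtain N x y z where N: "N \<in> HI" "conj_act N (M_ABC ?A B C) = M_ABC ?A (m2 b1 0 0 b2) (m2 x y y z)"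
    and S': "M_ABC ?A (m2 b1 0 0 b2) (m2 x y y z) \<in> SpI"
    using GL_reduce[OF R(1) comm S] R(2) by auto
  have eqs: "a * a - b1 * x = 1" "b1 * y = 0" "b2 * y = 0" "a * a - b2 * z = 1"
    using S' unfolding M_ABC_m2_SpI_iff by auto
  show ?thesis
  proof (cases "y = 0")
    case True
    then show ?thesis using that N by (simp add: Dg_def)
  next
    case False
    then have b: "b1 = 0" "b2 = 0" using eqs by auto
    obtain R' c1 c2 where R': "det R' \<noteq> 0" "R' ** m2 x y y z ** transpose R' = m2 c1 0 0 c2"
      by (rule symmetric_congruent_diag)
    define T where "T = transpose (matrix_inv R')"
    have i: "invertible R'" using R' by (simp add: invertible_det_nz)
    then have T: "invertible T"
      unfolding T_def using matrix_inv_invertible by (metis invertible_def transpose_invertible)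
    have "transpose T ** m2 c1 0 0 c2 ** T = 
       (matrix_inv R' ** R') ** m2 x y y z ** (transpose R' ** transpose (matrix_inv R'))"
      unfolding T_def R'(2)[symmetric] by (simp add: matrix_mul_assoc)
    also have "\<dots> = m2 x y y z"
      using i by (simp add: matrix_inv_invertible matrix_transpose_mul[symmetric] transpose_mat)
    finally have "conj_act (dgl T) (M_ABC ?A (m2 b1 0 0 b2) (m2 x y y z)) = Dg a a 0 0 c1 c2"
      unfolding Dg_def b using comm by (intro GL_act_eqI T) (auto simp flip: zero_m2)
    moreover have "dgl T \<in> HI" using T by (auto simp: HI_def GL_def)
    ultimately show ?thesis
      using that[of "dgl T ** N"] N by (simp add: HI_mult conj_act_mult[symmetric] HI_Sp)
  qed
qed

text \<open>A non-scalar \<open>A\<close> is brought to a Jordan block, whose nilpotent entry is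
  scaled to zero by \<open>diag(t, 1/t)\<close> as \<open>t\<close> tends to zero. The limit has
  scalar \<open>A\<close>.\<close>

lemma SpI_double:
  assumes "M \<in> SpI" "base_pt M = (2 * a, a\<^sup>2)"
  obtains b1 b2 c1 c2 where "actI.degenerates M (Dg a a b1 b2 c1 c2)"
proof -
  obtain A B C where M: "M = M_ABC A B C" using assms(1) by (rule SpI_exists)
  obtain p q r s where A: "A = m2 p q r s" by (rule m2_exists)
  have tr: "p + s = 2 * a" and dt: "p * s - q * r = a\<^sup>2"
    using assms unfolding M by (auto simp: base_pt_M_ABC A)
  have s: "s = 2 * a - p" using tr by simp
  have qr: "q * r = - ((p - a)\<^sup>2)" using dt unfolding s by (simp add: algebra_simps power2_eq_square)
  have "\<exists>B C. M_ABC (m2 a 0 0 a) B C \<in> SpI \<and> actI.degenerates M (M_ABC (m2 a 0 0 a) B C)"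
  proof (cases "A = m2 a 0 0 a")
    case True
    then show ?thesis using assms(1) actI.degenerates_refl M by blast
  next
    case False
    then have qr0: "q \<noteq> 0 \<or> r \<noteq> 0" using qr s by (auto simp: A)
    obtain R where R: "det R \<noteq> 0" "R ** A = m2 a 1 0 a ** R"
    proof (cases "r = 0")
      case False
      then have "det (m2 0 1 r (a - p)) \<noteq> 0" by simp
      moreover have "m2 0 1 r (a - p) ** A = m2 a 1 0 a ** m2 0 1 r (a - p)"
        unfolding A s using qr by (simp add: algebra_simps power2_eq_square)
      ultimately show ?thesis using that by blast
    next
      case True
      then have "p = a" "q \<noteq> 0" using qr qr0 by auto
      then have "det (m2 1 0 0 q) \<noteq> 0" "m2 1 0 0 q ** A = m2 a 1 0 a ** m2 1 0 0 q"
        unfolding A s using True by (simp_all add: algebra_simps)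
      then show ?thesis using that by blast
    qed
    obtain N b1 b b2 c1 c c2 where N: "N \<in> HI"
      "conj_act N M = M_ABC (m2 a 1 0 a) (m2 b1 b b b2) (m2 c1 c c c2)"
      and S: "M_ABC (m2 a 1 0 a) (m2 b1 b b b2) (m2 c1 c c c2) \<in> SpI" (is "?J \<in> _")
      using GL_reduce[OF R] assms(1) unfolding M by blast
    \<comment> \<open>The entries \<open>b2\<close> and \<open>c1\<close> are exactly those that the
      scaling would blow up.\<close>
    have eqs: "b2 = 0" "c1 = 0" "a * a - b * c = 1"
      using S unfolding M_ABC_m2_SpI_iff by (simp_all add: algebra_simps)
    define t where "t = (\<lambda>n. 1 / real (Suc n))"
    have t: "t n \<noteq> 0" for n by (simp add: t_def)
    have t0: "t \<longlonglongrightarrow> 0" unfolding t_def using LIMSEQ_Suc[OF lim_1_over_n] by simp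
    have t2: "(\<lambda>n. (t n)\<^sup>2 * x) \<longlonglongrightarrow> 0" for x
      using tendsto_mult[OF tendsto_power[OF t0, of 2] tendsto_const[of x]] by simp
    have conj: "conj_act (dgl (m2 (t n) 0 0 (1 / t n))) ?J =
        M_ABC (m2 a ((t n)\<^sup>2 * 1) 0 a) (m2 ((t n)\<^sup>2 * b1) b b 0) (m2 0 c c ((t n)\<^sup>2 * c2))" for n
      using t[of n] by (simp add: conj_dgl_diag_M_ABC eqs power2_eq_square mult.commute)
    have S': "M_ABC (m2 a 0 0 a) (m2 0 b b 0) (m2 0 c c 0) \<in> SpI"
      using eqs by (simp add: M_ABC_m2_SpI_iff)
    have "actI.degenerates ?J (M_ABC (m2 a 0 0 a) (m2 0 b b 0) (m2 0 c c 0))"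
    proof (rule actI.degenerates_limit)
      show "dgl (m2 (t n) 0 0 (1 / t n)) \<in> HI" for n using t[of n] by (simp add: dgl_m2_HI)
      show "(\<lambda>n. conj_act (dgl (m2 (t n) 0 0 (1 / t n))) ?J) \<longlonglongrightarrow>
          M_ABC (m2 a 0 0 a) (m2 0 b b 0) (m2 0 c c 0)"
        unfolding conj unfolding M_ABC_def m2_simps by (intro tendsto_intros t2)
    qed (use S S' in auto)
    moreover have "actI.degenerates M ?J" using actI.degenerates_act[OF assms(1) N(1)] N(2) by simp
    ultimately show ?thesis using S' actI.degenerates_trans[OF assms(1)] by blast
  qed
  then obtain B' C' where D: "M_ABC (m2 a 0 0 a) B' C' \<in> SpI" "actI.degenerates M (M_ABC (m2 a 0 0 a) B' C')"
    by blast
  obtain N b1 b2 c1 c2 where "N \<in> HI" "conj_act N (M_ABC (m2 a 0 0 a) B' C') = Dg a a b1 b2 c1 c2"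
    using SpI_scalar_diag[OF D(1)] by metis
  then have "actI.degenerates M (Dg a a b1 b2 c1 c2)"
    using actI.degenerates_act[OF D(1)] actI.degenerates_trans[OF assms(1) D(2)] by metis
  then show ?thesis using that by blast
qed

section \<open>Reduction to normal form under the symplectic group\<close>

text \<open>The symplectic form \<open>x\<^sup>T J y\<close>.\<close>

definition om :: "real^(2 + 2) \<Rightarrow> real^(2 + 2) \<Rightarrow> real" where
  "om x y = x $ Inl 1 * y $ Inr 1 + x $ Inl 2 * y $ Inr 2 - x $ Inr 1 * y $ Inl 1 - x $ Inr 2 * y $ Inl 2"

lemma om_simps [simp]:
  "om (x + y) z = om x z + om y z" "om x (y + z) = om x y + om x z"
  "om (x - y) z = om x z - om y z" "om x (y - z) = om x y - om x z"
  "om (- x) y = - om x y" "om x (- y) = - om x y"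
  "om (c *\<^sub>R x) y = c * om x y" "om x (c *\<^sub>R y) = c * om x y"
  "om x 0 = 0" "om 0 y = 0" "om x x = 0"
  by (simp_all add: om_def algebra_simps)

lemma om_flip: "om x y = - om y x"
  by (simp add: om_def)

lemma om_adjoint: "om (X *v x) y = om x (spinv X *v y)"
proof -
  obtain A B C D where X: "X = block_matrix A B C D" by (rule block_exists)
  obtain a1 a2 a3 a4 where A: "A = m2 a1 a2 a3 a4" by (rule m2_exists)
  obtain b1 b2 b3 b4 where B: "B = m2 b1 b2 b3 b4" by (rule m2_exists)
  obtain c1 c2 c3 c4 where C: "C = m2 c1 c2 c3 c4" by (rule m2_exists)
  obtain d1 d2 d3 d4 where D: "D = m2 d1 d2 d3 d4" by (rule m2_exists)
  show ?thesis
    by (simp add: X A B C D om_def matrix_vector_mult_def sum_UNIV_dbl) (simp add: algebra_simps)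
qed

lemma om_nondegenerate:
  assumes "x \<noteq> 0" obtains y where "om x y = 1"
proof -
  have "\<exists>i. x $ i \<noteq> 0" using assms by (auto simp: vec_eq_iff)
  then consider "x $ Inl 1 \<noteq> 0" | "x $ Inl 2 \<noteq> 0" | "x $ Inr 1 \<noteq> 0" | "x $ Inr 2 \<noteq> 0"
    using forall_dbl[of "\<lambda>i. x $ i = 0"] by blast
  then have "\<exists>z. om x z \<noteq> 0"
  proof cases
    case 1 then show ?thesis by (intro exI[of _ "axis (Inr 1) 1"]) (simp add: om_def axis_def)
  next
    case 2 then show ?thesis by (intro exI[of _ "axis (Inr 2) 1"]) (simp add: om_def axis_def)
  next
    case 3 then show ?thesis by (intro exI[of _ "axis (Inl 1) 1"]) (simp add: om_def axis_def)
  next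
    case 4 then show ?thesis by (intro exI[of _ "axis (Inl 2) 1"]) (simp add: om_def axis_def)
  qed
  then obtain z where "om x z \<noteq> 0" by blast
  then show ?thesis using that[of "(1 / om x z) *\<^sub>R z"] by simp
qed

lemma om_ext: "(\<And>y. om x y = om x' y) \<Longrightarrow> x = x'"
  by (metis om_nondegenerate om_simps(3) diff_self right_minus_eq zero_neq_one)

lemma spinv_hsum: "spinv (hsum M) = hsum M"
proof -
  obtain A B C D where M: "M = block_matrix A B C D" by (rule block_exists)
  show ?thesis by (simp add: M hsum_def add.commute scaleR_minus_right[symmetric] del: scaleR_minus_right)
qed

lemma om_hsum: "om (hsum M *v x) y = om x (hsum M *v y)"
  by (simp add: om_adjoint spinv_hsum)

lemma om_Sp: "M \<in> Sp \<Longrightarrow> om (M *v x) (M *v y) = om x y"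
  by (simp add: om_adjoint matrix_vector_mul_assoc)

lemma matrix_vector_mult_minus: "(A :: real^'n^'m) *v (- x) = - (A *v x)"
  by (simp add: matrix_vector_mult_def vec_eq_iff sum_negf)

lemma spinv_vec: "spinv M *v x = 2 *\<^sub>R (hsum M *v x) - M *v x"
proof -
  have "spinv M = 2 *\<^sub>R hsum M - M" by (simp add: hsum_def)
  then show ?thesis by (simp add: matrix_vector_mult_diff_rdistrib scaleR_matrix_vector_assoc)
qed

lemma hsum_commute: "M \<in> Sp \<Longrightarrow> M *v (hsum M *v x) = hsum M *v (M *v x)"
  by (simp add: matrix_vector_mul_assoc hsum_def matrix_add_ldistrib matrix_mult_add_rdistrib)

lemma Sp_square_vec:
  assumes "M \<in> Sp" shows "M *v (M *v x) = 2 *\<^sub>R (M *v (hsum M *v x)) - x"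
proof -
  have "M *v (spinv M *v x) = x" using assms by (simp add: matrix_vector_mul_assoc)
  then show ?thesis
    by (simp add: spinv_vec matrix_vector_mult_diff_distrib matrix_vector_mult_scaleR algebra_simps)
qed

lemma hsum_square_vec:
  assumes "base_pt M = (t, d)"
  shows "hsum M *v (hsum M *v x) = t *\<^sub>R (hsum M *v x) - d *\<^sub>R x"
  by (simp add: matrix_vector_mul_assoc hsum_square[OF assms] matrix_vector_mult_diff_rdistrib
      scaleR_matrix_vector_assoc[symmetric])

text \<open>The bilinear form of \<open>hsum M\<close> is alternating and that of
  \<open>M - hsum M\<close> is symmetric. The quadratic form sees only the symmetric part, which
  polarisation shows to be zero.\<close>

lemma om_form_zero_imp:
  assumes "\<And>x. om (M *v x) x = 0"
  shows "M *v x = hsum M *v x"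
proof (rule om_ext)
  fix y
  have "om (M *v (x + y)) (x + y) = 0" "om (M *v x) x = 0" "om (M *v y) y = 0" by (rule assms)+
  then have "om (M *v x) y = - om (M *v y) x"
    by (simp add: matrix_vector_right_distrib)
  also have "\<dots> = om x (M *v y)" using om_flip[of x "M *v y"] by simp
  also have "\<dots> = om x (2 *\<^sub>R (hsum M *v y)) - om x (spinv M *v y)" by (simp add: spinv_vec)
  also have "\<dots> = 2 * om (hsum M *v x) y - om (M *v x) y" by (simp add: om_hsum om_adjoint[of M])
  finally show "om (M *v x) y = om (hsum M *v x) y" by simp
qed

section \<open>Symplectic bases and change of basis\<close>

definition sbasis :: "real^(2 + 2) \<Rightarrow> real^(2 + 2) \<Rightarrow> real^(2 + 2) \<Rightarrow> real^(2 + 2) \<Rightarrow> bool" where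
  "sbasis e1 e2 f1 f2 \<longleftrightarrow> om e1 f1 = 1 \<and> om e2 f2 = 1 \<and>
     om e1 e2 = 0 \<and> om e1 f2 = 0 \<and> om e2 f1 = 0 \<and> om f1 f2 = 0"

definition cols :: "real^(2 + 2) \<Rightarrow> real^(2 + 2) \<Rightarrow> real^(2 + 2) \<Rightarrow> real^(2 + 2) \<Rightarrow> 2 dmat" where
  "cols e1 e2 f1 f2 = block_matrix
     (m2 (e1 $ Inl 1) (e2 $ Inl 1) (e1 $ Inl 2) (e2 $ Inl 2))
     (m2 (f1 $ Inl 1) (f2 $ Inl 1) (f1 $ Inl 2) (f2 $ Inl 2))
     (m2 (e1 $ Inr 1) (e2 $ Inr 1) (e1 $ Inr 2) (e2 $ Inr 2))
     (m2 (f1 $ Inr 1) (f2 $ Inr 1) (f1 $ Inr 2) (f2 $ Inr 2))"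

text \<open>Coordinates are read off by pairing: the coefficient of \<open>z\<close> along
  \<open>e_i\<close> is \<open>om z f_i\<close>, and along \<open>f_i\<close> it is
  \<open>om e_i z\<close>.\<close>

definition in_basis where
  "in_basis e1 e2 f1 f2 X = block_matrix
     (m2 (om (X *v e1) f1) (om (X *v e2) f1) (om (X *v e1) f2) (om (X *v e2) f2))
     (m2 (om (X *v f1) f1) (om (X *v f2) f1) (om (X *v f1) f2) (om (X *v f2) f2))
     (m2 (om e1 (X *v e1)) (om e1 (X *v e2)) (om e2 (X *v e1)) (om e2 (X *v e2)))
     (m2 (om e1 (X *v f1)) (om e1 (X *v f2)) (om e2 (X *v f1)) (om e2 (X *v f2)))"

lemma column_cols:
  "column (Inl 1) (cols e1 e2 f1 f2) = e1" "column (Inl 2) (cols e1 e2 f1 f2) = e2"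
  "column (Inr 1) (cols e1 e2 f1 f2) = f1" "column (Inr 2) (cols e1 e2 f1 f2) = f2"
  by (simp_all add: vec_eq_iff forall_dbl column_def cols_def)

lemma spinv_cols_vec:
  "(spinv (cols e1 e2 f1 f2) *v x) $ Inl 1 = om x f1" "(spinv (cols e1 e2 f1 f2) *v x) $ Inl 2 = om x f2"
  "(spinv (cols e1 e2 f1 f2) *v x) $ Inr 1 = om e1 x" "(spinv (cols e1 e2 f1 f2) *v x) $ Inr 2 = om e2 x"
  by (simp_all add: cols_def matrix_vector_mult_def sum_UNIV_dbl om_def algebra_simps)

lemma spinv_cols_conj:
  "spinv (cols e1 e2 f1 f2) ** X ** cols e1 e2 f1 f2 = in_basis e1 e2 f1 f2 X"
proof -
  let ?N = "cols e1 e2 f1 f2"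
  have "(spinv ?N ** X ** ?N) $ i $ j = (spinv ?N *v (X *v column j ?N)) $ i" for i j
  proof -
    have *: "column j (spinv ?N ** X ** ?N) = spinv ?N *v (X *v column j ?N)"
      by (simp only: matrix_vector_mult_basis[symmetric] matrix_vector_mul_assoc matrix_mul_assoc)
    have "(spinv ?N ** X ** ?N) $ i $ j = column j (spinv ?N ** X ** ?N) $ i"
      by (simp add: column_def)
    then show ?thesis unfolding * .
  qed
  then show ?thesis by (simp add: in_basis_def vec_eq_iff forall_dbl column_cols spinv_cols_vec)
qed

text \<open>The identity matrix written in a symplectic basis is again the identity; by
  \<open>spinv_cols_conj\<close> this says that the matrix of columns is symplectic.\<close>

lemma sbasis_conj:
  assumes "sbasis e1 e2 f1 f2"
  obtains N where "N \<in> Sp" "\<And>X. conj_act N X = in_basis e1 e2 f1 f2 X"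
proof -
  let ?N = "cols e1 e2 f1 f2"
  have flips: "om e2 e1 = 0" "om f2 f1 = 0"
    using assms om_flip[of e2 e1] om_flip[of f2 f1] by (auto simp: sbasis_def)
  have "spinv ?N ** mat 1 ** ?N = block_matrix (m2 1 0 0 1) (m2 0 0 0 0) (m2 0 0 0 0) (m2 1 0 0 1)"
    unfolding spinv_cols_conj in_basis_def using assms flips by (simp add: sbasis_def)
  also have "\<dots> = mat 1" unfolding mat_block[of 1] mat_m2 zero_m2 ..
  finally have "spinv ?N ** ?N = mat 1" by simp
  then have "?N \<in> Sp" by (simp add: Sp_iff_spinv_left)
  then have "spinv ?N \<in> Sp" by (rule Sp_spinv_mem)
  then show ?thesis
    using that[of "spinv ?N"] by (simp add: conj_act_eq spinv_cols_conj)
qed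

text \<open>The map \<open>pr\<close> projects onto the \<open>om\<close>-orthogonal complement of
  the plane of \<open>e1\<close> and \<open>f1\<close>. By dimension some \<open>pr z\<close> is
  nonzero, and a partner of it may be projected too without changing their pairing.\<close>

lemma sbasis_extend:
  assumes "om e1 f1 = 1"
  obtains e2 f2 where "sbasis e1 e2 f1 f2"
proof -
  define pr where "pr z = z - om z f1 *\<^sub>R e1 + om z e1 *\<^sub>R f1" for z
  have fe: "om f1 e1 = - 1" using assms om_flip[of f1 e1] by simp
  have pr: "om e1 (pr z) = 0" "om f1 (pr z) = 0" "om (pr z) f1 = 0" for z
    using assms fe om_flip[of z e1] om_flip[of z f1] by (auto simp: pr_def)
  have "\<exists>z. z \<notin> span {e1, f1}"
  proof (rule ccontr)
    assume "\<nexists>z. z \<notin> span {e1, f1}"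
    then have "UNIV \<subseteq> span {e1, f1}" by blast
    then have "dim (UNIV :: (real^(2 + 2)) set) \<le> card {e1, f1}" by (intro dim_le_card) auto
    also have "\<dots> \<le> 2" by (simp add: card_insert_if)
    finally show False by (simp add: card_UNIV_sum)
  qed
  then obtain z where z: "z \<notin> span {e1, f1}" by blast
  have "pr z \<noteq> 0"
  proof
    assume "pr z = 0"
    then have "z = om z f1 *\<^sub>R e1 - om z e1 *\<^sub>R f1" by (simp add: pr_def algebra_simps)
    also have "\<dots> \<in> span {e1, f1}" by (intro span_diff span_scale span_base) auto
    finally show False using z by simp
  qed
  then obtain w where "om (pr z) w = 1" by (rule om_nondegenerate)
  then have "om (pr z) (pr w) = 1"
    using pr[of z] om_flip[of "pr z" e1] by (simp add: pr_def[of w])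
  then have "sbasis e1 (pr z) f1 (pr w)"
    using assms pr by (simp add: sbasis_def)
  then show ?thesis by (rule that)
qed

text \<open>A pair of 2 by 2 matrices acting on the planes \<open>(e1, f1)\<close> and
  \<open>(e2, f2)\<close>. Pairs of determinant 1 give the subgroup \<open>SL_2 x SL_2\<close> of
  \<open>Sp(4)\<close>.\<close>

definition Esl where
  "Esl pa q1 r1 s1 pb q2 r2 s2 =
     block_matrix (m2 pa 0 0 pb) (m2 q1 0 0 q2) (m2 r1 0 0 r2) (m2 s1 0 0 s2)"

lemma Esl_Sp_iff: "Esl pa q1 r1 s1 pb q2 r2 s2 \<in> Sp \<longleftrightarrow> pa * s1 - q1 * r1 = 1 \<and> pb * s2 - q2 * r2 = 1"
  unfolding Sp_iff_spinv_left Esl_def mat_block[of 1] mat_m2 zero_m2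
  by (auto simp: algebra_simps)

lemma Esl_mult: "Esl pa q1 r1 s1 pb q2 r2 s2 ** Esl pa' q1' r1' s1' pb' q2' r2' s2' =
   Esl (pa * pa' + q1 * r1') (pa * q1' + q1 * s1') (r1 * pa' + s1 * r1') (r1 * q1' + s1 * s1')
       (pb * pb' + q2 * r2') (pb * q2' + q2 * s2') (r2 * pb' + s2 * r2') (r2 * q2' + s2 * s2')"
  by (simp add: Esl_def)

lemma Dg_Esl: "Dg a1 a2 b1 b2 c1 c2 = Esl a1 b1 c1 a1 a2 b2 c2 a2"
  by (simp add: Dg_def M_ABC_def Esl_def)

text \<open>Written out in entries: a 2 by 2 matrix of trace \<open>2 * a\<close> is conjugate under
  \<open>SL_2\<close> to one with both diagonal entries \<open>a\<close>. A shear does this when an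
  off-diagonal entry is available; otherwise the matrix is diagonal, and a fixed matrix of
  determinant 1 averages the two entries.\<close>

lemma SL2_conj:
  fixes p q r s :: real
  assumes "p + s = 2 * a"
  shows "\<exists>x y z w b c. x * w - y * z = 1 \<and> x * p + y * r = a * x + b * z \<and> x * q + y * s = a * y + b * w \<and>
      z * p + w * r = c * x + a * z \<and> z * q + w * s = c * y + a * w"
proof -
  have s: "s = 2 * a - p" using assms by simp
  consider "q \<noteq> 0" | "r \<noteq> 0" | "q = 0" "r = 0" "p = a" | "q = 0" "r = 0" "p \<noteq> a" by blast
  then show ?thesis
  proof cases
    case 1
    show ?thesis
      by (rule exI[of _ 1], rule exI[of _ 0], rule exI[of _ "(p - a) / q"], rule exI[of _ 1], rule exI[of _ q],
          rule exI[of _ "r + (p - a) / q * p - a * ((p - a) / q)"])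
        (use 1 in \<open>simp add: s field_simps\<close>)
  next
    case 2
    show ?thesis
      by (rule exI[of _ 1], rule exI[of _ "(a - p) / r"], rule exI[of _ 0], rule exI[of _ 1],
          rule exI[of _ "q + (a - p) / r * s - a * ((a - p) / r)"], rule exI[of _ r])
        (use 2 in \<open>simp add: s field_simps\<close>)
  next
    case 3
    show ?thesis
      by (rule exI[of _ 1], rule exI[of _ 0], rule exI[of _ 0], rule exI[of _ 1], rule exI[of _ 0], rule exI[of _ 0])
        (use 3 in \<open>simp add: s\<close>)
  next
    case 4
    show ?thesis
      by (rule exI[of _ "1/2"], rule exI[of _ "- 1/2"], rule exI[of _ 1], rule exI[of _ 1],
          rule exI[of _ "(p - a) / 2"], rule exI[of _ "2 * (p - a)"])
        (use 4 in \<open>simp add: s field_simps\<close>)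
  qed
qed

lemma Esl_conj_Dg:
  assumes "pa + s1 = 2 * a1" "pb + s2 = 2 * a2"
  obtains N b1 b2 c1 c2 where "N \<in> Sp" "conj_act N (Esl pa q1 r1 s1 pb q2 r2 s2) = Dg a1 a2 b1 b2 c1 c2"
proof -
  obtain x y z w b c where 1: "x * w - y * z = 1 \<and> x * pa + y * r1 = a1 * x + b * z \<and> x * q1 + y * s1 = a1 * y + b * w \<and>
      z * pa + w * r1 = c * x + a1 * z \<and> z * q1 + w * s1 = c * y + a1 * w"
    using SL2_conj[OF assms(1)] by blast
  obtain x' y' z' w' b' c' where 2: "x' * w' - y' * z' = 1 \<and> x' * pb + y' * r2 = a2 * x' + b' * z' \<and> x' * q2 + y' * s2 = a2 * y' + b' * w' \<and>
      z' * pb + w' * r2 = c' * x' + a2 * z' \<and> z' * q2 + w' * s2 = c' * y' + a2 * w'"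
    using SL2_conj[OF assms(2)] by blast
  have "Esl x y z w x' y' z' w' \<in> Sp" using 1 2 by (simp add: Esl_Sp_iff)
  moreover have "conj_act (Esl x y z w x' y' z' w') (Esl pa q1 r1 s1 pb q2 r2 s2) = Dg a1 a2 b b' c c'"
    using 1 2 calculation by (intro conj_act_eqI) (simp_all add: Dg_Esl Esl_mult)
  ultimately show ?thesis by (rule that)
qed

text \<open>The cross conditions say that \<open>M\<close> preserves the planes
  \<open>(e1, f1)\<close> and \<open>(e2, f2)\<close>, so it becomes a pair of 2 by 2 blocks to
  which \<open>SL2_conj\<close> applies.\<close>

lemma Sp_split:
  assumes "M \<in> Sp" "sbasis e1 e2 f1 f2"
    and "hsum M *v e1 = a1 *\<^sub>R e1" "hsum M *v e2 = a2 *\<^sub>R e2"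
    and cross: "om (M *v e1) e2 = 0" "om (M *v e1) f2 = 0" "om (M *v f1) e2 = 0" "om (M *v f1) f2 = 0"
       "om (M *v e2) e1 = 0" "om (M *v e2) f1 = 0" "om (M *v f2) e1 = 0" "om (M *v f2) f1 = 0"
  obtains N b1 b2 c1 c2 where "N \<in> Sp" "conj_act N M = Dg a1 a2 b1 b2 c1 c2"
proof -
  obtain N where N: "N \<in> Sp" and conj: "\<And>X. conj_act N X = in_basis e1 e2 f1 f2 X"
    using sbasis_conj[OF assms(2)] by blast
  have cross': "om e2 (M *v e1) = 0" "om f2 (M *v e1) = 0" "om e2 (M *v f1) = 0" "om f2 (M *v f1) = 0"
       "om e1 (M *v e2) = 0" "om f1 (M *v e2) = 0" "om e1 (M *v f2) = 0" "om f1 (M *v f2) = 0"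
    using cross by (metis om_flip minus_zero)+
  have M': "conj_act N M = Esl (om (M *v e1) f1) (om (M *v f1) f1) (om e1 (M *v e1)) (om e1 (M *v f1))
      (om (M *v e2) f2) (om (M *v f2) f2) (om e2 (M *v e2)) (om e2 (M *v f2))"
    unfolding conj in_basis_def Esl_def by (simp add: cross cross')
  \<comment> \<open>The trace of a block equals \<open>om\<close> of \<open>(M + spinv M) e\<close>
    with \<open>f\<close>, which is \<open>2 * a\<close> because \<open>e\<close> is an eigenvector
    of \<open>hsum M\<close>.\<close>
  have diag: "om (M *v e) f + om e (M *v f) = 2 * a" if "hsum M *v e = a *\<^sub>R e" "om e f = 1" for e f a
  proof -
    have "om e (M *v f) = om (spinv M *v e) f" using om_adjoint[of "spinv M" e f] by simp
    then show ?thesis using that by (simp add: spinv_vec)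
  qed
  have "om e1 f1 = 1" "om e2 f2 = 1" using assms(2) by (auto simp: sbasis_def)
  then obtain N' b1 b2 c1 c2 where "N' \<in> Sp" "conj_act N' (conj_act N M) = Dg a1 a2 b1 b2 c1 c2"
    unfolding M' using Esl_conj_Dg[OF diag[OF assms(3)] diag[OF assms(4)]] by metis
  then show ?thesis using that[of "N' ** N"] N by (simp add: conj_act_mult Sp_mult)
qed

text \<open>By the quadratic equation, \<open>hsum M - a2\<close> maps everything into the
  \<open>a1\<close>-eigenspace. It is nonzero by the trace, and being self-adjoint it acts on that
  eigenspace as \<open>a1 - a2\<close>, so a partner \<open>y\<close> of \<open>e\<close> can be
  moved into the eigenspace with nonzero pairing.\<close>

lemma eigenplane_exists:
  assumes bp: "base_pt M = (a1 + a2, a1 * a2)" and "a1 \<noteq> a2"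
  obtains e f where "hsum M *v e = a1 *\<^sub>R e" "hsum M *v f = a1 *\<^sub>R f" "om e f = 1"
proof -
  let ?S = "hsum M"
  have eig: "?S *v (?S *v x - a2 *\<^sub>R x) = a1 *\<^sub>R (?S *v x - a2 *\<^sub>R x)" for x
    by (simp add: matrix_vector_mult_diff_distrib matrix_vector_mult_scaleR hsum_square_vec[OF bp] algebra_simps)
  have "\<exists>x. ?S *v x \<noteq> a2 *\<^sub>R x"
  proof (rule ccontr)
    assume "\<nexists>x. ?S *v x \<noteq> a2 *\<^sub>R x"
    then have "?S *v x = (a2 *\<^sub>R mat 1) *v x" for x by (simp add: scaleR_matrix_vector_assoc[symmetric])
    then have "?S = a2 *\<^sub>R mat 1" by (simp add: matrix_eq)
    then have "trace ?S = 4 * a2" by (simp add: trace_def mat_def sum_UNIV_dbl)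
    then show False using assms by (simp add: base_pt_def)
  qed
  then obtain x where x: "?S *v x - a2 *\<^sub>R x \<noteq> 0" by auto
  then obtain y where y: "om (?S *v x - a2 *\<^sub>R x) y = 1" by (rule om_nondegenerate)
  let ?e = "?S *v x - a2 *\<^sub>R x" and ?f = "?S *v y - a2 *\<^sub>R y"
  have "om ?e ?f = om (?S *v ?e) y - a2 * om ?e y" by (simp add: om_hsum)
  also have "\<dots> = a1 - a2" unfolding eig using y by (simp only: om_simps mult_1_right)
  finally have ef: "om ?e ?f = a1 - a2" .
  show ?thesis
  proof (rule that)
    show "?S *v ?e = a1 *\<^sub>R ?e" by (rule eig)
    show "?S *v ((1 / (a1 - a2)) *\<^sub>R ?f) = a1 *\<^sub>R ((1 / (a1 - a2)) *\<^sub>R ?f)"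
      using eig[of y] by (simp only: matrix_vector_mult_scaleR scaleR_left_commute)
    show "om ?e ((1 / (a1 - a2)) *\<^sub>R ?f) = 1"
      unfolding om_simps(8) ef using assms(2) by simp
  qed
qed

text \<open>Eigenspaces of the self-adjoint \<open>hsum M\<close> for distinct eigenvalues are
  \<open>om\<close>-orthogonal, and \<open>M\<close> preserves them because it commutes with
  \<open>hsum M\<close>.\<close>

lemma Sp_diag_distinct:
  assumes M: "M \<in> Sp" and bp: "base_pt M = (a1 + a2, a1 * a2)" and "a1 \<noteq> a2"
  obtains N b1 b2 c1 c2 where "N \<in> Sp" "conj_act N M = Dg a1 a2 b1 b2 c1 c2"
proof -
  obtain e1 f1 where 1: "hsum M *v e1 = a1 *\<^sub>R e1" "hsum M *v f1 = a1 *\<^sub>R f1" "om e1 f1 = 1"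
    using eigenplane_exists[OF bp assms(3)] by blast
  have bp': "base_pt M = (a2 + a1, a2 * a1)" using bp by (simp add: add.commute mult.commute)
  obtain e2 f2 where 2: "hsum M *v e2 = a2 *\<^sub>R e2" "hsum M *v f2 = a2 *\<^sub>R f2" "om e2 f2 = 1"
    using eigenplane_exists[OF bp'] assms(3) by metis
  have orth: "om x y = 0" if "hsum M *v x = a *\<^sub>R x" "hsum M *v y = b *\<^sub>R y" "a \<noteq> b" for x y a b
    using om_hsum[of M x y] that by simp
  have inv: "hsum M *v (M *v x) = a *\<^sub>R (M *v x)" if "hsum M *v x = a *\<^sub>R x" for x a
    using hsum_commute[OF M, of x] that by (simp add: matrix_vector_mult_scaleR)
  have "sbasis e1 e2 f1 f2"
    using 1 2 orth assms(3) by (auto simp: sbasis_def)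
  then show ?thesis
    using that Sp_split[OF M _ 1(1) 2(1)] orth[OF inv[OF 1(1)]] orth[OF inv[OF 1(2)]]
      orth[OF inv[OF 2(1)]] orth[OF inv[OF 2(2)]] 1 2 assms(3) by metis
qed

text \<open>Here \<open>M\<close> satisfies a quadratic equation, so \<open>f\<close> and
  \<open>M f\<close> span an invariant plane. If \<open>om (M f) f\<close> is nonzero, the plane is
  symplectic and its complement is invariant too; if this form vanishes identically,
  \<open>M\<close> is scalar.\<close>

lemma Sp_scalar_diag:
  assumes M: "M \<in> Sp" and S: "hsum M = a *\<^sub>R mat 1"
  obtains N b1 b2 c1 c2 where "N \<in> Sp" "conj_act N M = Dg a a b1 b2 c1 c2"
proof (cases "\<exists>x. om (M *v x) x \<noteq> 0")
  case True
  then obtain f1 where f1: "om (M *v f1) f1 \<noteq> 0" by blast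
  define k where "k = om (M *v f1) f1"
  define e1 where "e1 = (1 / k) *\<^sub>R (M *v f1)"
  have k: "k \<noteq> 0" using f1 by (simp add: k_def)
  have Sx: "hsum M *v x = a *\<^sub>R x" for x by (simp add: S scaleR_matrix_vector_assoc[symmetric])
  have "om e1 f1 = 1" using k by (simp add: e1_def k_def)
  then obtain e2 f2 where sb: "sbasis e1 e2 f1 f2" by (rule sbasis_extend)
  have Mf: "M *v f1 = k *\<^sub>R e1" using k by (simp add: e1_def)
  have Me: "M *v e1 = (2 * a) *\<^sub>R e1 - (1 / k) *\<^sub>R f1"
    by (simp add: e1_def matrix_vector_mult_scaleR Sp_square_vec[OF M] Sx algebra_simps)
  have adj: "om (M *v x) y = om x ((2 * a) *\<^sub>R y - M *v y)" for x y
    by (simp add: om_adjoint[of M] spinv_vec Sx)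
  have *: "om e1 e2 = 0" "om e1 f2 = 0" "om f1 e2 = 0" "om f1 f2 = 0"
      "om e2 e1 = 0" "om f2 e1 = 0" "om e2 f1 = 0" "om f2 f1 = 0"
    using sb om_flip[of f1 e2] om_flip[of e2 e1] om_flip[of f2 e1] om_flip[of f2 f1]
    by (auto simp: sbasis_def)
  have "om (M *v x) e1 = 0 \<and> om (M *v x) f1 = 0" if "x = e2 \<or> x = f2" for x
    using that * unfolding adj Mf Me by auto
  moreover have "om (M *v e1) x = 0 \<and> om (M *v f1) x = 0" if "x = e2 \<or> x = f2" for x
    using that * unfolding Mf Me by auto
  ultimately show ?thesis using that Sp_split[OF M sb Sx Sx] by metis
next
  case False
  then have "M *v x = hsum M *v x" for x by (intro om_form_zero_imp) auto
  then have Ma: "M = a *\<^sub>R mat 1" by (simp add: matrix_eq S)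
  have "conj_act (mat 1) M = Dg a a 0 0 0 0"
    unfolding conj_act_1 Ma by (simp add: Dg_def M_ABC_def mat_block[of 1] mat_m2 zero_m2)
  then show ?thesis using that Sp_mat_1 by blast
qed

text \<open>With \<open>P = hsum M - a\<close> and \<open>P\<^sup>2 = 0\<close>, the vectors
  \<open>P u\<close> and \<open>P w\<close> span an \<open>M\<close>-invariant Lagrangian plane. In
  an adapted symplectic basis \<open>M\<close> is block upper triangular, and scaling that plane
  removes the upper right block, which carries the nilpotent part.\<close>

lemma Sp_nilpotent_degenerates:
  assumes M: "M \<in> Sp" and bp: "base_pt M = (2 * a, a\<^sup>2)" and "hsum M \<noteq> a *\<^sub>R mat 1"
  obtains M' where "M' \<in> Sp" "hsum M' = a *\<^sub>R mat 1" "actS.degenerates M M'"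
proof -
  define P where "P x = hsum M *v x - a *\<^sub>R x" for x
  have PP: "P (P x) = 0" for x
    by (simp add: P_def matrix_vector_mult_diff_distrib matrix_vector_mult_scaleR hsum_square_vec[OF bp])
      (simp add: vec_eq_iff algebra_simps power2_eq_square)
  have Padj: "om (P x) y = om x (P y)" for x y by (simp add: P_def om_hsum)
  have PM: "P (M *v x) = M *v P x" for x
    by (simp add: P_def matrix_vector_mult_diff_distrib matrix_vector_mult_scaleR hsum_commute[OF M])
  have Pself: "om (P x) x = 0" for x using Padj[of x x] om_flip[of x "P x"] by simp
  have Plin: "P (c *\<^sub>R x) = c *\<^sub>R P x" "P (x - y) = P x - P y" "P (- x) = - P x" for c x y
    by (simp_all add: P_def matrix_vector_mult_diff_distrib matrix_vector_mult_scaleR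
        matrix_vector_mult_minus algebra_simps)
  have "\<exists>u. P u \<noteq> 0"
  proof (rule ccontr)
    assume "\<nexists>u. P u \<noteq> 0"
    then have "hsum M *v x = (a *\<^sub>R mat 1) *v x" for x
      by (auto simp: P_def scaleR_matrix_vector_assoc[symmetric])
    then show False using assms(3) by (simp add: matrix_eq)
  qed
  then obtain u where "P u \<noteq> 0" by blast
  then obtain w where w: "om (P u) w = 1" by (rule om_nondegenerate)
  \<comment> \<open>The correction term in \<open>f1\<close> makes \<open>om f1 f2\<close> vanish,
    since \<open>om (P w) u = -1\<close>.\<close>
  define e1 e2 f1 f2 where "e1 = P u" and "e2 = - P w" and "f1 = w + om w u *\<^sub>R P w" and "f2 = u"
  have "om (P w) u = -1" using w Padj[of w u] om_flip[of w "P u"] by simp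
  moreover have "om (P u) (P w) = 0" by (simp add: Padj PP)
  moreover have "om (P w) (P w) = 0" by simp
  ultimately have sb: "sbasis e1 e2 f1 f2"
    using w Pself by (simp add: sbasis_def e1_def e2_def f1_def f2_def)
  have Pe: "P e1 = 0" "P e2 = 0" by (simp_all add: e1_def e2_def PP Plin)
  then have Se: "hsum M *v e1 = a *\<^sub>R e1" "hsum M *v e2 = a *\<^sub>R e2" by (simp_all add: P_def)
  obtain N where N: "N \<in> Sp" and conj: "\<And>X. conj_act N X = in_basis e1 e2 f1 f2 X"
    using sbasis_conj[OF sb] by blast
  have PMP: "om (P x) (M *v P y) = 0" for x y by (simp add: Padj PM PP)
  have Mneg: "M *v (- x) = - (M *v x)" for x by (rule matrix_vector_mult_minus)
  have "om e1 (M *v e1) = 0" "om e1 (M *v e2) = 0" "om e2 (M *v e1) = 0" "om e2 (M *v e2) = 0"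
    by (simp_all add: e1_def e2_def PMP Mneg)
  then obtain A B D where M1: "conj_act N M = block_matrix A B 0 D"
    unfolding conj[of M] in_basis_def zero_m2 by metis
  have M1S: "block_matrix A B 0 D \<in> Sp" using conj_act_mem[OF N M] M1 by simp
  have Seo: "om x (hsum M *v y) = om (hsum M *v x) y" for x y by (simp add: om_hsum)
  have "conj_act N (hsum M) = block_matrix (m2 a 0 0 a)
     (m2 (om (hsum M *v f1) f1) (om (hsum M *v f2) f1) (om (hsum M *v f1) f2) (om (hsum M *v f2) f2)) 0 (m2 a 0 0 a)"
    unfolding conj in_basis_def Seo Se using sb om_flip[of e2 e1] by (simp add: sbasis_def zero_m2)
  then have "hsum (block_matrix A B 0 D) = block_matrix (m2 a 0 0 a)
     (m2 (om (hsum M *v f1) f1) (om (hsum M *v f2) f1) (om (hsum M *v f1) f2) (om (hsum M *v f2) f2)) 0 (m2 a 0 0 a)"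
    using hsum_conj_act[OF N, of M] M1 by simp
  then have AD: "(1/2) *\<^sub>R (A + transpose D) = m2 a 0 0 a" "(1/2) *\<^sub>R (D + transpose A) = m2 a 0 0 a"
    by (simp_all add: hsum_def)
  let ?L = "block_matrix A 0 0 D"
  have LS: "?L \<in> Sp"
    using M1S unfolding Sp_iff_spinv_left by (simp add: mat_block[of 1])
  have "hsum ?L = a *\<^sub>R mat 1"
    using AD by (simp add: hsum_def mat_block[of 1] mat_m2)
  moreover have "actS.degenerates (block_matrix A B 0 D) ?L"
  proof (rule actS.degenerates_limit)
    define t where "t = (\<lambda>n. 1 / real (Suc n))"
    have t: "t n \<noteq> 0" for n by (simp add: t_def)
    have t0: "t \<longlonglongrightarrow> 0" unfolding t_def using LIMSEQ_Suc[OF lim_1_over_n] by simp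
    define T :: "nat \<Rightarrow> 2 dmat" where "T n = block_matrix (t n *\<^sub>R mat 1) 0 0 ((1 / t n) *\<^sub>R mat 1)" for n
    show T: "T n \<in> Sp" for n
      using t[of n] by (simp add: T_def Sp_iff_spinv_left mat_block[of 1] transpose_mat)
    have "conj_act (T n) (block_matrix A B 0 D) = block_matrix A ((t n)\<^sup>2 *\<^sub>R B) 0 D" for n
      using t[of n] by (intro conj_act_eqI T) (simp add: T_def power2_eq_square)
    moreover have "(\<lambda>n. (t n)\<^sup>2 *\<^sub>R B) \<longlonglongrightarrow> 0"
      using tendsto_scaleR[OF tendsto_power[OF t0, of 2] tendsto_const[of B]] by simp
    then have "(\<lambda>n. block_matrix A ((t n)\<^sup>2 *\<^sub>R B) 0 D) \<longlonglongrightarrow> ?L"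
      by (intro tendsto_intros)
    ultimately show "(\<lambda>n. conj_act (T n) (block_matrix A B 0 D)) \<longlonglongrightarrow> ?L" by simp
  qed (use LS M1S in auto)
  then have "actS.degenerates M ?L"
    using actS.degenerates_act[OF M N] actS.degenerates_trans[OF M] M1 by metis
  ultimately show ?thesis using that LS by blast
qed

lemma Sp_double:
  assumes M: "M \<in> Sp" and bp: "base_pt M = (2 * a, a\<^sup>2)"
  obtains b1 b2 c1 c2 where "actS.degenerates M (Dg a a b1 b2 c1 c2)"
proof -
  obtain M' where M': "M' \<in> Sp" "hsum M' = a *\<^sub>R mat 1" "actS.degenerates M M'"
    using Sp_nilpotent_degenerates[OF M bp] actS.degenerates_refl[OF M] M by metis
  obtain N b1 b2 c1 c2 where "N \<in> Sp" "conj_act N M' = Dg a a b1 b2 c1 c2"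
    using Sp_scalar_diag[OF M'(1,2)] by metis
  then have "actS.degenerates M (Dg a a b1 b2 c1 c2)"
    using actS.degenerates_act[OF M'(1)] actS.degenerates_trans[OF M M'(3)] by metis
  then show ?thesis by (rule that)
qed

text \<open>When \<open>hsum M\<close> has non-real eigenvalues, it turns the space into a complex plane and the
  symplectic form into a complex one; the symplectic basis starts from a vector \<open>f\<close> at which the
  resulting complex quadratic form \<open>(\<alpha>, \<beta>)\<close> takes the value 1.\<close>

lemma Sp_complex:
  assumes M: "M \<in> Sp" and bp: "base_pt M = (2 * u, u\<^sup>2 + v\<^sup>2)" and v: "v > 0"
  obtains N where "N \<in> Sp" "conj_act N M = nfN u v"
proof -
  let ?S = "hsum M"
  \<comment> \<open>The complex structure: \<open>K\<^sup>2 = -1\<close>, and \<open>K\<close> is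
    self-adjoint and commutes with \<open>M\<close>. In terms of it \<open>hsum M\<close> is
    multiplication by \<open>u + iv\<close>.\<close>
  define K where "K x = (1 / v) *\<^sub>R (?S *v x - u *\<^sub>R x)" for x
  have Sx: "?S *v x = u *\<^sub>R x + v *\<^sub>R K x" for x using v by (simp add: K_def)
  have KK: "K (K x) = - x" for x
  proof -
    have "K (K x) = (1 / v / v) *\<^sub>R (?S *v (?S *v x) - (2 * u) *\<^sub>R (?S *v x) + u\<^sup>2 *\<^sub>R x)"
      by (simp add: K_def matrix_vector_mult_diff_distrib matrix_vector_mult_scaleR)
        (simp add: vec_eq_iff algebra_simps power2_eq_square)
    also have "\<dots> = (1 / v / v) *\<^sub>R (- (v\<^sup>2 *\<^sub>R x))"
      by (simp add: hsum_square_vec[OF bp] algebra_simps)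
    also have "\<dots> = - x" using v by (simp add: power2_eq_square)
    finally show ?thesis .
  qed
  have Kadj: "om (K x) y = om x (K y)" for x y by (simp add: K_def om_hsum)
  have Kself: "om (K x) x = 0" "om x (K x) = 0" for x using Kadj[of x x] om_flip[of x "K x"] by simp_all
  have Mlin: "M *v (c *\<^sub>R x) = c *\<^sub>R (M *v x)" "M *v (x + y) = M *v x + M *v y"
    "M *v (x - y) = M *v x - M *v y" "M *v (- x) = - (M *v x)" for c x y
    by (simp_all add: matrix_vector_mult_scaleR matrix_vector_right_distrib
        matrix_vector_mult_diff_distrib matrix_vector_mult_minus)
  have KM: "K (M *v x) = M *v K x" for x
    by (simp add: K_def Mlin hsum_commute[OF M])
  have Klin: "K (c *\<^sub>R x) = c *\<^sub>R K x" "K (x + y) = K x + K y" for c x y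
    by (simp_all add: K_def matrix_vector_mult_scaleR matrix_vector_right_distrib algebra_simps)
  have "\<exists>f. om (M *v f) f \<noteq> 0"
  proof (rule ccontr)
    assume "\<nexists>f. om (M *v f) f \<noteq> 0"
    then have MS: "M *v x = ?S *v x" for x by (intro om_form_zero_imp) auto
    obtain x :: "real^(2 + 2)" where x: "x \<noteq> 0" by (metis axis_eq_0_iff zero_neq_one)
    have 1: "?S *v (?S *v y) = y" for y
      using Sp_square_vec[OF M, of y] unfolding MS by (simp add: algebra_simps) (metis add_right_cancel diff_add_cancel scaleR_2 add.commute)
    have 2: "y = (2 * u) *\<^sub>R (?S *v y) - (u\<^sup>2 + v\<^sup>2) *\<^sub>R y" for y
      using hsum_square_vec[OF bp, of y] 1 by simp
    \<comment> \<open>The complex number \<open>q - ip\<close> is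
      \<open>1 - (u + iv)\<^sup>2\<close>. It annihilates the nonzero vector \<open>x\<close>, hence
      is zero, contradicting \<open>v > 0\<close>.\<close>
    define p q where "p = 2 * u * v" and "q = 1 + u\<^sup>2 + v\<^sup>2 - 2 * u\<^sup>2"
    have qx: "q *\<^sub>R x = p *\<^sub>R K x"
    proof (subst vec_eq_iff, rule allI)
      fix i
      show "(q *\<^sub>R x) $ i = (p *\<^sub>R K x) $ i"
        using arg_cong[OF 2[of x], of "\<lambda>z. z $ i"] unfolding Sx
        by (simp add: p_def q_def algebra_simps power2_eq_square)
    qed
    have "q *\<^sub>R K x = K (q *\<^sub>R x)" by (simp only: Klin)
    also have "\<dots> = - (p *\<^sub>R x)" unfolding qx by (simp add: Klin KK)
    finally have "p *\<^sub>R (q *\<^sub>R K x) = - ((p * p) *\<^sub>R x)" by simp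
    then have "q *\<^sub>R (q *\<^sub>R x) = - ((p * p) *\<^sub>R x)" unfolding qx by (simp add: mult.commute)
    then have "(q * q + p * p) *\<^sub>R x = 0" by (simp add: scaleR_add_left)
    then have "q * q + p * p = 0" using x by (simp only: scaleR_eq_0_iff) simp
    then have "(1 + v\<^sup>2 - u\<^sup>2)\<^sup>2 + (2 * u * v)\<^sup>2 = 0" by (simp add: p_def q_def power2_eq_square algebra_simps)
    then have "1 + v\<^sup>2 - u\<^sup>2 = 0" "u = 0" using v by (simp_all add: sum_power2_eq_zero_iff)
    then show False using zero_le_power2[of v] by simp
  qed
  then obtain f where f: "om (M *v f) f \<noteq> 0" by blast
  define \<alpha> \<beta> where "\<alpha> = om (M *v f) f" and "\<beta> = om (M *v f) (K f)"
  obtain r s where rs: "(r\<^sup>2 - s\<^sup>2) * \<alpha> + 2 * r * s * \<beta> = 1" "(r\<^sup>2 - s\<^sup>2) * \<beta> = 2 * r * s * \<alpha>"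
    using complex_square_real[of \<alpha> \<beta>] f by (auto simp: \<alpha>_def)
  \<comment> \<open>The complex value at \<open>f\<close> is \<open>\<alpha> - i\<beta>\<close>;
    replacing \<open>f\<close> by \<open>(r + sK) f\<close> multiplies it by
    \<open>(r + is)\<^sup>2\<close>.\<close>
  define g where "g = r *\<^sub>R f + s *\<^sub>R K f"
  define h where "h = K g"
  have Mg: "om (M *v K x) y = om (M *v x) (K y)" for x y
    by (simp add: KM[symmetric] Kadj)
  have g1: "om (M *v g) g = 1"
    using rs unfolding g_def by (simp add: Mlin Mg KK \<alpha>_def \<beta>_def algebra_simps power2_eq_square)
  have g2: "om (M *v g) h = 0"
    using rs unfolding h_def g_def by (simp add: Mlin Klin Mg KK \<alpha>_def \<beta>_def algebra_simps power2_eq_square)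
  have gram: "om g h = 0" "om h g = 0" "om (M *v h) g = 0" "om (M *v h) h = - 1" "om (M *v g) (M *v h) = 0"
      "om (M *v h) (M *v g) = 0"
    using g1 g2 by (simp_all add: h_def Kself Mg KK om_Sp[OF M])
  note gram = gram g1 g2
  have gram': "om g (M *v g) = - 1" "om h (M *v g) = 0" "om g (M *v h) = 0" "om h (M *v h) = 1"
    using gram om_flip[of g "M *v g"] om_flip[of h "M *v g"] om_flip[of g "M *v h"] om_flip[of h "M *v h"] by simp_all
  have Kh: "K h = - g" by (simp add: h_def KK)
  have MM: "M *v (M *v g) = (2 * u) *\<^sub>R (M *v g) + (2 * v) *\<^sub>R (M *v h) - g"
    "M *v (M *v h) = (2 * u) *\<^sub>R (M *v h) - (2 * v) *\<^sub>R (M *v g) - h"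
    by (simp_all add: Sp_square_vec[OF M] Sx Mlin h_def[symmetric] Kh algebra_simps)
  \<comment> \<open>Solved from the last two columns of \<open>nfN u v\<close>, which prescribe
    \<open>M g\<close> and \<open>M h\<close> in the basis \<open>e1, e2, g, h\<close>.\<close>
  define e1 e2 where "e1 = M *v g - u *\<^sub>R g - v *\<^sub>R h" and "e2 = u *\<^sub>R h - v *\<^sub>R g - M *v h"
  have sb: "sbasis e1 e2 g h"
    unfolding sbasis_def e1_def e2_def by (simp add: gram gram' algebra_simps)
  obtain N where N: "N \<in> Sp" and conj: "\<And>X. conj_act N X = in_basis e1 e2 g h X"
    using sbasis_conj[OF sb] by blast
  have "conj_act N M = nfN u v"
    unfolding conj in_basis_def nfN_def M_ABC_def e1_def e2_def
    by (simp add: Mlin MM gram gram' algebra_simps power2_eq_square)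
  then show ?thesis using that N by blast
qed

text \<open>An exchange of \<open>e1\<close> and \<open>f1\<close> with scale \<open>x\<close> turns
  \<open>(b, c)\<close> into \<open>(- x\<^sup>2 c, - b / x\<^sup>2)\<close>. This reverses the sign
  of \<open>b\<close> exactly when \<open>b\<close> and \<open>c\<close> have the same sign, that
  is, when \<open>a1\<^sup>2 > 1\<close>.\<close>

lemma nfD_flip_fst:
  assumes "a1\<^sup>2 > 1" obtains N where "N \<in> Sp" "conj_act N (nfD a1 a2 (- 1) e2) = nfD a1 a2 1 e2"
proof -
  define x where "x = 1 / sqrt (a1\<^sup>2 - 1)"
  have x: "x \<noteq> 0" "x * x * (a1\<^sup>2 - 1) = 1" using assms by (auto simp: x_def field_simps)
  let ?N = "Esl 0 x (- 1 / x) 0 1 0 0 1"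
  have "?N \<in> Sp" using x by (simp add: Esl_Sp_iff)
  moreover have "conj_act ?N (nfD a1 a2 (- 1) e2) = nfD a1 a2 1 e2"
  proof (rule conj_act_eqI)
    have "(a1\<^sup>2 - 1) * x = 1 / x" using x by (simp add: field_simps)
    then show "?N ** nfD a1 a2 (- 1) e2 = nfD a1 a2 1 e2 ** ?N"
      by (simp add: nfD_def Dg_Esl Esl_mult) (simp add: field_simps)
  qed fact
  ultimately show ?thesis by (rule that)
qed

lemma nfD_swap: "conj_act (dgl (m2 0 1 1 0)) (nfD a1 a2 e1 e2) = nfD a2 a1 e2 e1"
  by (simp add: nfD_def Dg_swap)

section \<open>Krein signatures\<close>

definition disc :: "real \<times> real \<Rightarrow> real" where
  "disc x = (fst x)\<^sup>2 / 4 - snd x"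

text \<open>If \<open>disc x < 0\<close>, then \<open>root1 x\<close> and \<open>root2 x\<close> are meaningless (\<^term>\<open>sqrt\<close> is odd), but
  still continuous in \<open>x\<close>.\<close>

definition root1 :: "real \<times> real \<Rightarrow> real" where
  "root1 x = fst x / 2 + sqrt (disc x)"

definition root2 :: "real \<times> real \<Rightarrow> real" where
  "root2 x = fst x / 2 - sqrt (disc x)"

lemma roots_sum_prod: "disc x \<ge> 0 \<Longrightarrow> x = (root1 x + root2 x, root1 x * root2 x)"
  by (simp add: prod_eq_iff root1_def root2_def algebra_simps)
    (simp add: disc_def power2_eq_square)

lemma roots_less_iff: "root2 x < root1 x \<longleftrightarrow> disc x > 0"
  by (simp add: root1_def root2_def)

lemma disc_sum_prod: "disc (a1 + a2, a1 * a2) = ((a1 - a2) / 2)\<^sup>2"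
  by (simp add: disc_def power2_eq_square field_simps)

lemma roots_of_sum_prod:
  assumes "a1 \<ge> a2" shows "root1 (a1 + a2, a1 * a2) = a1" "root2 (a1 + a2, a1 * a2) = a2"
proof -
  have "sqrt (((a1 - a2) / 2)\<^sup>2) = (a1 - a2) / 2" unfolding real_sqrt_abs using assms by simp
  then show "root1 (a1 + a2, a1 * a2) = a1" "root2 (a1 + a2, a1 * a2) = a2"
    unfolding root1_def root2_def disc_sum_prod by (simp_all add: add_divide_distrib diff_divide_distrib)
qed

lemma continuous_on_disc [continuous_intros]:
  "continuous_on S f \<Longrightarrow> continuous_on S (\<lambda>x. disc (f x))"
  unfolding disc_def by (intro continuous_intros) auto

lemma continuous_on_root [continuous_intros]:
  "continuous_on S f \<Longrightarrow> continuous_on S (\<lambda>x. root1 (f x))"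
  "continuous_on S f \<Longrightarrow> continuous_on S (\<lambda>x. root2 (f x))"
  unfolding root1_def root2_def by (intro continuous_intros; simp)+

text \<open>For \<open>c = 0\<close>, \<open>d = 1\<close> this is the form whose signature on the eigenspaces of \<open>M\<close> is the
  Krein signature; a factor \<open>c *\<^sub>R hsum M + d\<close> vanishing at one root isolates the other one.\<close>

definition qf :: "2 dmat \<Rightarrow> real \<Rightarrow> real \<Rightarrow> real^(2 + 2) \<Rightarrow> real" where
  "qf M c d x = om (M *v (c *\<^sub>R (hsum M *v x) + d *\<^sub>R x)) x"

text \<open>The coefficients are functions of \<open>base_pt M\<close> so that the
  eigenvalue-isolating factor varies continuously with \<open>M\<close> and one condition makes
  sense on the whole space.\<close>

definition attains ::
    "(real^(2 + 2)) set \<Rightarrow> real \<Rightarrow> (real \<times> real \<Rightarrow> real) \<Rightarrow> (real \<times> real \<Rightarrow> real) \<Rightarrow> 2 dmat \<Rightarrow> bool" where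
  "attains V s c d M \<longleftrightarrow> (\<exists>x\<in>V. s * qf M (c (base_pt M)) (d (base_pt M)) x > 0)"

lemma conj_act_vec: "N \<in> Sp \<Longrightarrow> conj_act N M *v (N *v x) = N *v (M *v x)"
proof -
  assume N: "N \<in> Sp"
  have "conj_act N M *v (N *v x) = (N ** M ** (spinv N ** N)) *v x"
    by (simp only: conj_act_eq[OF N] matrix_vector_mul_assoc matrix_mul_assoc)
  then show ?thesis using N by (simp add: matrix_vector_mul_assoc)
qed

lemma qf_conj_act:
  assumes N: "N \<in> Sp" shows "qf (conj_act N M) c d (N *v x) = qf M c d x"
proof -
  have "c *\<^sub>R (N *v (hsum M *v x)) + d *\<^sub>R (N *v x) = N *v (c *\<^sub>R (hsum M *v x) + d *\<^sub>R x)"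
    by (simp add: matrix_vector_right_distrib matrix_vector_mult_scaleR)
  then show ?thesis
    by (simp only: qf_def hsum_conj_act[OF N] conj_act_vec[OF N] om_Sp[OF N])
qed

lemma continuous_on_matrix_vector_mult [continuous_intros]:
  fixes f :: "'a::topological_space \<Rightarrow> real^'n^'m" and g :: "'a \<Rightarrow> real^'n"
  shows "continuous_on S f \<Longrightarrow> continuous_on S g \<Longrightarrow> continuous_on S (\<lambda>x. f x *v g x)"
  unfolding matrix_vector_mult_def by (intro continuous_intros)

lemma continuous_on_om [continuous_intros]:
  "continuous_on S f \<Longrightarrow> continuous_on S g \<Longrightarrow> continuous_on S (\<lambda>x. om (f x) (g x))"
  unfolding om_def by (intro continuous_intros)

text \<open>A union, over the test vectors, of strict inequalities between continuous functions of
  \<open>M\<close>.\<close>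

lemma open_attains:
  assumes "continuous_on UNIV c" "continuous_on UNIV d"
  shows "open {M. attains V s c d M}"
proof -
  have cb: "continuous_on UNIV (\<lambda>M. c (base_pt M))" "continuous_on UNIV (\<lambda>M. d (base_pt M))"
    using assms continuous_on_base_pt continuous_on_compose2[of UNIV _ UNIV base_pt] by blast+
  have "open {M. 0 < s * qf M (c (base_pt M)) (d (base_pt M)) x}" for x
    unfolding qf_def by (intro open_Collect_less continuous_intros cb)
  then have "open (\<Union>x\<in>V. {M. 0 < s * qf M (c (base_pt M)) (d (base_pt M)) x})" by blast
  moreover have "{M. attains V s c d M} = (\<Union>x\<in>V. {M. 0 < s * qf M (c (base_pt M)) (d (base_pt M)) x})"
    by (auto simp: attains_def)
  ultimately show ?thesis by simp
qed

lemma qf_Dg: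
  assumes "Dg a1 a2 b1 b2 c1 c2 \<in> SpI"
  shows "qf (Dg a1 a2 b1 b2 c1 c2) c d x =
    (c * a1 + d) * (b1 * (x $ Inr 1)\<^sup>2 - c1 * (x $ Inl 1)\<^sup>2) +
    (c * a2 + d) * (b2 * (x $ Inr 2)\<^sup>2 - c2 * (x $ Inl 2)\<^sup>2)"
proof -
  have "hsum (Dg a1 a2 b1 b2 c1 c2) = block_matrix (m2 a1 0 0 a2) 0 0 (m2 a1 0 0 a2)"
    unfolding Dg_def by (subst hsum_M_ABC) simp_all
  then show ?thesis
    by (simp add: qf_def om_def Dg_def M_ABC_def matrix_vector_mult_def sum_UNIV_dbl power2_eq_square algebra_simps)
qed

lemma Dg_Sp_imp_SpI: "Dg a1 a2 b1 b2 c1 c2 \<in> Sp \<Longrightarrow> Dg a1 a2 b1 b2 c1 c2 \<in> SpI"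
  by (simp add: Dg_Esl Esl_Sp_iff) (simp add: Dg_Esl[symmetric] Dg_SpI_iff power2_eq_square)

section \<open>Crude norm estimates: 4 terms in the form, 16 entries in the matrix\<close>

lemma om_bound: "\<bar>om x y\<bar> \<le> 4 * (norm x * norm y)"
proof -
  have "\<bar>x $ i * y $ j\<bar> \<le> norm x * norm y" for i j
    unfolding abs_mult by (intro mult_mono component_le_norm_cart) auto
  from this[of "Inl 1" "Inr 1"] this[of "Inl 2" "Inr 2"] this[of "Inr 1" "Inl 1"] this[of "Inr 2" "Inl 2"]
  show ?thesis unfolding om_def by linarith
qed

lemma matrix_vector_bound:
  fixes A :: "real^(2 + 2)^(2 + 2)" shows "norm (A *v x) \<le> 16 * norm A * norm x"
proof -
  have "\<bar>A $ i $ j\<bar> \<le> norm A" for i j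
    by (rule order_trans[OF component_le_norm_cart Finite_Cartesian_Product.norm_nth_le])
  then have "onorm ((*v) A) \<le> real CARD(2 + 2) * real CARD(2 + 2) * norm A"
    by (intro onorm_le_matrix_component)
  then have "onorm ((*v) A) \<le> 16 * norm A" by (simp add: card_UNIV_sum)
  moreover have "norm (A *v x) \<le> onorm ((*v) A) * norm x"
    by (intro onorm matrix_vector_mul_bounded_linear)
  ultimately show ?thesis by (meson mult_right_mono norm_ge_zero order_trans)
qed

lemma norm_dbl: "(norm (x :: real^(2 + 2)))\<^sup>2 = (x $ Inl 1)\<^sup>2 + (x $ Inl 2)\<^sup>2 + (x $ Inr 1)\<^sup>2 + (x $ Inr 2)\<^sup>2"
  unfolding power2_norm_eq_inner inner_vec_def by (simp add: sum_UNIV_dbl power2_eq_square)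

section \<open>Normal forms for both quotients\<close>

text \<open>Where the sign is not detected, 1 is the chosen representative. At
  \<open>a\<^sup>2 = 1\<close> the block degenerates to \<open>a\<close> times the identity, whence
  0.\<close>

definition signs :: "(real \<Rightarrow> bool) \<Rightarrow> real \<Rightarrow> real set" where
  "signs sgd a = (if a\<^sup>2 = 1 then {0} else if sgd a then {1, - 1} else {1})"

text \<open>The inequalities \<open>a2 \<le> a1\<close> and, for equal eigenvalues,
  \<open>e2 \<le> e1\<close> choose one of the two orders in which the blocks can be listed.\<close>

definition nforms :: "(real \<Rightarrow> bool) \<Rightarrow> 2 dmat set" where
  "nforms sgd = {nfD a1 a2 e1 e2 | a1 a2 e1 e2. a2 \<le> a1 \<and> e1 \<in> signs sgd a1 \<and> e2 \<in> signs sgd a2 \<and>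
      (a1 = a2 \<longrightarrow> e2 \<le> e1)} \<union> {nfN u v | u v. v > 0}"

lemma nfD_SpI: "e1 \<in> signs sgd a1 \<Longrightarrow> e2 \<in> signs sgd a2 \<Longrightarrow> nfD a1 a2 e1 e2 \<in> SpI"
  by (auto simp: nfD_def Dg_SpI_iff signs_def split: if_splits)

lemma nforms_SpI: "nforms sgd \<subseteq> SpI"
  by (auto simp: nforms_def nfD_SpI nfN_SpI)

lemma base_pt_nfD: "nfD a1 a2 e1 e2 \<in> SpI \<Longrightarrow> base_pt (nfD a1 a2 e1 e2) = (a1 + a2, a1 * a2)"
  unfolding nfD_def by (rule base_pt_Dg)

lemma nfD_inject: "nfD a1 a2 e1 e2 = nfD a1' a2' e1' e2' \<longleftrightarrow> a1 = a1' \<and> a2 = a2' \<and> e1 = e1' \<and> e2 = e2'"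
  by (auto simp: nfD_def)

lemma nforms_nfD:
  "a2 \<le> a1 \<Longrightarrow> e1 \<in> signs sgd a1 \<Longrightarrow> e2 \<in> signs sgd a2 \<Longrightarrow> (a1 = a2 \<Longrightarrow> e2 \<le> e1) \<Longrightarrow>
    nfD a1 a2 e1 e2 \<in> nforms sgd"
  unfolding nforms_def by blast

lemma nforms_nfN: "v > 0 \<Longrightarrow> nfN u v \<in> nforms sgd"
  unfolding nforms_def by blast

lemma nforms_cases:
  assumes "z \<in> nforms sgd"
  obtains (N) u v where "z = nfN u v" "v > 0" "disc (base_pt z) < 0"
    | (D) a1 a2 e1 e2 where "z = nfD a1 a2 e1 e2" "a2 \<le> a1" "e1 \<in> signs sgd a1" "e2 \<in> signs sgd a2"
      "a1 = a2 \<Longrightarrow> e2 \<le> e1" "base_pt z = (a1 + a2, a1 * a2)" "disc (base_pt z) \<ge> 0"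
proof -
  consider u v where "z = nfN u v" "v > 0"
    | a1 a2 e1 e2 where "z = nfD a1 a2 e1 e2" "a2 \<le> a1" "e1 \<in> signs sgd a1" "e2 \<in> signs sgd a2"
      "a1 = a2 \<longrightarrow> e2 \<le> e1"
    using assms unfolding nforms_def by blast
  then show ?thesis
  proof cases
    case 1
    then have "disc (base_pt z) < 0" by (simp add: base_pt_nfN disc_def power_mult_distrib)
    with 1 show ?thesis using N by blast
  next
    case 2
    then have "base_pt z = (a1 + a2, a1 * a2)" by (simp add: base_pt_nfD nfD_SpI)
    moreover from this have "disc (base_pt z) \<ge> 0" by (simp add: disc_sum_prod)
    ultimately show ?thesis using 2 D by blast
  qed
qed

text \<open>Common framework for the two quotients. For \<open>a\<close> with \<open>sgd a\<close> the sign attached to the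
  eigenvalue \<open>a\<close> of \<open>hsum M\<close> is an invariant, because the corresponding form is semidefinite on \<open>V\<close>;
  for the other \<open>a\<close> with \<open>a\<^sup>2 \<noteq> 1\<close> the two signs are conjugate.\<close>

locale krein =
  fixes X H :: "2 dmat set" and V :: "(real^(2 + 2)) set" and sgd :: "real \<Rightarrow> bool"
  assumes X_Sp: "X \<subseteq> Sp" and SpI_X: "SpI \<subseteq> X"
    and H_Sp: "H \<subseteq> Sp" and HI_H: "HI \<subseteq> H"
    and H_mult: "N \<in> H \<Longrightarrow> N' \<in> H \<Longrightarrow> N ** N' \<in> H"
    and H_spinv: "N \<in> H \<Longrightarrow> spinv N \<in> H"
    and conj_X: "N \<in> H \<Longrightarrow> M \<in> X \<Longrightarrow> conj_act N M \<in> X"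
    and H_V: "N \<in> H \<Longrightarrow> x \<in> V \<Longrightarrow> N *v x \<in> V"
    and axis_V: "axis (Inr k) 1 \<in> V"
    and sgd_noteq: "sgd a \<Longrightarrow> a\<^sup>2 \<noteq> 1"
    and sgd_V: "sgd a \<Longrightarrow> a\<^sup>2 > 1 \<Longrightarrow> x \<in> V \<Longrightarrow> x $ Inl k = 0"
    and sgd_cong: "sgn (a\<^sup>2 - 1) = sgn (b\<^sup>2 - 1) \<Longrightarrow> sgd a = sgd b"
    and flip_fst: "\<not> sgd a1 \<Longrightarrow> a1\<^sup>2 \<noteq> 1 \<Longrightarrow> \<exists>N\<in>H. conj_act N (nfD a1 a2 (- 1) e2) = nfD a1 a2 1 e2"
    and diag_distinct: "M \<in> X \<Longrightarrow> base_pt M = (a1 + a2, a1 * a2) \<Longrightarrow> a1 \<noteq> a2 \<Longrightarrow>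
      \<exists>N\<in>H. \<exists>b1 b2 c1 c2. conj_act N M = Dg a1 a2 b1 b2 c1 c2"
    and double: "M \<in> X \<Longrightarrow> base_pt M = (2 * a, a\<^sup>2) \<Longrightarrow>
      \<exists>b1 b2 c1 c2. Dg a a b1 b2 c1 c2 \<in> X \<inter> closure (orbit H conj_act M)"
    and complex: "M \<in> X \<Longrightarrow> base_pt M = (2 * u, u\<^sup>2 + v\<^sup>2) \<Longrightarrow> v > 0 \<Longrightarrow>
      \<exists>N\<in>H. conj_act N M = nfN u v"
begin

sublocale continuous_action X H conj_act
  using H_Sp X_Sp HI_1 HI_H H_mult conj_X by (intro conj_act_continuous_action) auto

lemma base_pt_degenerates:
  assumes "M \<in> X" "degenerates M M'" shows "base_pt M' = base_pt M"
proof -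
  have "closed {Y. base_pt Y = base_pt M}"
    by (intro closed_Collect_eq continuous_on_base_pt continuous_intros)
  moreover have "orbit H conj_act M \<subseteq> {Y. base_pt Y = base_pt M}"
    using H_Sp base_pt_conj_act by (auto simp: orbit_def)
  ultimately have "closure (orbit H conj_act M) \<subseteq> {Y. base_pt Y = base_pt M}"
    by (simp add: closure_minimal)
  then show ?thesis using assms by (auto simp: degenerates_def)
qed

lemma attains_conj: "N \<in> H \<Longrightarrow> attains V s c d M \<Longrightarrow> attains V s c d (conj_act N M)"
  using H_Sp H_V qf_conj_act base_pt_conj_act unfolding attains_def by (metis subsetD)

lemma attains_conj_iff: 
  assumes "N \<in> H" shows "attains V s c d (conj_act N M) \<longleftrightarrow> attains V s c d M"
proof -
  have "conj_act (spinv N) (conj_act N M) = M"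
    using assms H_Sp H_spinv by (simp add: subsetD conj_act_mult conj_act_1)
  then show ?thesis using attains_conj assms H_spinv by metis
qed

text \<open>The open set of matrices attaining the sign contains a limit of the orbit of
  \<open>M\<close>, so it meets the orbit; by invariance it contains \<open>M\<close>.\<close>

lemma attains_degenerates:
  assumes "degenerates M M'" "attains V s c d M'" "continuous_on UNIV c" "continuous_on UNIV d"
  shows "attains V s c d M"
proof -
  have "M' \<in> closure (orbit H conj_act M)" using assms(1) by (simp add: degenerates_def)
  then have "orbit H conj_act M \<inter> {Y. attains V s c d Y} \<noteq> {}"
    using assms(2) open_Int_closure_eq_empty[OF open_attains[OF assms(3,4)], of V s "orbit H conj_act M"]
    by blast
  then show ?thesis using attains_conj_iff by (auto simp: orbit_def)
qed

text \<open>For \<open>a\<^sup>2 < 1\<close> the product \<open>b * c\<close> is negative, so both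
  terms of the form have the same sign. For \<open>a\<^sup>2 > 1\<close> the vectors of
  \<open>V\<close> leave only the term with \<open>b\<close>.\<close>

lemma semidefinite:
  assumes "sgd a" "a\<^sup>2 - b * c = 1" "x \<in> V" "y \<in> V"
    and "0 < s * (b * (x $ Inr k)\<^sup>2 - c * (x $ Inl k)\<^sup>2)" "0 < - s * (b * (y $ Inr k)\<^sup>2 - c * (y $ Inl k)\<^sup>2)"
  shows False
proof (cases "a\<^sup>2 > 1")
  case True
  then have "x $ Inl k = 0" "y $ Inl k = 0" using sgd_V assms by auto
  then have *: "0 < s * b * (x $ Inr k)\<^sup>2" "0 < - (s * b) * (y $ Inr k)\<^sup>2" using assms(5,6) by (simp_all add: algebra_simps)
  then show False by (metis mult_less_0_iff neg_0_less_iff_less not_less_iff_gr_or_eq zero_less_mult_iff zero_less_power2 power2_less_0)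
next
  case False
  then have bc: "b * c < 0" using sgd_noteq[OF assms(1)] assms(2) by linarith
  then consider "b > 0" "c < 0" | "b < 0" "c > 0" by (auto simp: mult_less_0_iff)
  then show False
  proof cases
    case 1
    then have "b * (z $ Inr k)\<^sup>2 - c * (z $ Inl k)\<^sup>2 \<ge> 0" for z
      by (simp add: mult_nonpos_nonneg order_trans[of _ 0])
    from this[of x] this[of y] show False using assms(5,6)
      by (metis mult_minus_left neg_0_less_iff_less not_less zero_less_mult_iff mult_less_0_iff less_asym)
  next
    case 2
    then have "b * (z $ Inr k)\<^sup>2 - c * (z $ Inl k)\<^sup>2 \<le> 0" for z
      by (simp add: mult_nonpos_nonneg order_trans[of _ 0])
    from this[of x] this[of y] show False using assms(5,6)
      by (metis mult_minus_left neg_0_less_iff_less not_less zero_less_mult_iff mult_less_0_iff less_asym)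
  qed
qed

text \<open>The factors are \<open>hsum M - a2\<close> for \<open>att1\<close> and
  \<open>a1 - hsum M\<close> for \<open>att2\<close>: each kills one eigenspace and acts on the
  other as the positive number \<open>a1 - a2\<close>. At a double eigenvalue no such separation
  exists and \<open>att0\<close> uses the plain form.\<close>

abbreviation (input) "att1 s \<equiv> attains V s (\<lambda>_. 1) (\<lambda>x. - root2 x)"
abbreviation (input) "att2 s \<equiv> attains V s (\<lambda>_. - 1) root1"
abbreviation (input) "att0 s \<equiv> attains V s (\<lambda>_. 0) (\<lambda>_. 1)"

lemma degenerates_att:
  assumes "degenerates M M'"
  shows "att1 s M' \<Longrightarrow> att1 s M" "att2 s M' \<Longrightarrow> att2 s M" "att0 s M' \<Longrightarrow> att0 s M"
  by (rule attains_degenerates[OF assms]; (assumption | intro continuous_intros))+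

lemma att_Dg:
  assumes "Dg a1 a2 b1 b2 c1 c2 \<in> SpI" "a2 < a1"
  shows "att1 s (Dg a1 a2 b1 b2 c1 c2) \<longleftrightarrow> (\<exists>x\<in>V. 0 < s * (b1 * (x $ Inr 1)\<^sup>2 - c1 * (x $ Inl 1)\<^sup>2))"
    "att2 s (Dg a1 a2 b1 b2 c1 c2) \<longleftrightarrow> (\<exists>x\<in>V. 0 < s * (b2 * (x $ Inr 2)\<^sup>2 - c2 * (x $ Inl 2)\<^sup>2))"
proof -
  have *: "0 < s * ((a1 - a2) * y) \<longleftrightarrow> 0 < s * y" for y
  proof -
    have "s * ((a1 - a2) * y) = (a1 - a2) * (s * y)" by simp
    then show ?thesis using assms(2) by (simp only: zero_less_mult_iff) auto
  qed
  show "att1 s (Dg a1 a2 b1 b2 c1 c2) \<longleftrightarrow> (\<exists>x\<in>V. 0 < s * (b1 * (x $ Inr 1)\<^sup>2 - c1 * (x $ Inl 1)\<^sup>2))"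
    "att2 s (Dg a1 a2 b1 b2 c1 c2) \<longleftrightarrow> (\<exists>x\<in>V. 0 < s * (b2 * (x $ Inr 2)\<^sup>2 - c2 * (x $ Inl 2)\<^sup>2))"
    using assms *[symmetric] unfolding attains_def base_pt_Dg[OF assms(1)] qf_Dg[OF assms(1)]
    by (simp_all add: roots_of_sum_prod)
qed

lemma att_nfD:
  assumes "nfD a1 a2 e1 e2 \<in> SpI" "a2 < a1"
  shows "e1 = s \<Longrightarrow> s * s = 1 \<Longrightarrow> att1 s (nfD a1 a2 e1 e2)"
    "e2 = s \<Longrightarrow> s * s = 1 \<Longrightarrow> att2 s (nfD a1 a2 e1 e2)"
proof -
  note att = att_Dg[OF assms(1)[unfolded nfD_def] assms(2), folded nfD_def]
  show "e1 = s \<Longrightarrow> s * s = 1 \<Longrightarrow> att1 s (nfD a1 a2 e1 e2)"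
    unfolding att by (rule bexI[OF _ axis_V[of 1]]) (simp add: axis_def)
  show "e2 = s \<Longrightarrow> s * s = 1 \<Longrightarrow> att2 s (nfD a1 a2 e1 e2)"
    unfolding att by (rule bexI[OF _ axis_V[of 2]]) (simp add: axis_def)
qed

text \<open>For distinct eigenvalues \<open>M\<close> itself, and not merely a limit of its orbit,
  is conjugate to a block sum, so semidefiniteness applies to \<open>M\<close>.\<close>

lemma att_exclusive:
  assumes M: "M \<in> X" "base_pt M = (a1 + a2, a1 * a2)" "a2 < a1"
  shows "sgd a1 \<Longrightarrow> att1 s M \<Longrightarrow> att1 (- s) M \<Longrightarrow> False"
    "sgd a2 \<Longrightarrow> att2 s M \<Longrightarrow> att2 (- s) M \<Longrightarrow> False"
proof -
  obtain N b1 b2 c1 c2 where N: "N \<in> H" "conj_act N M = Dg a1 a2 b1 b2 c1 c2"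
    using diag_distinct[OF M(1,2)] M(3) by blast
  have S: "Dg a1 a2 b1 b2 c1 c2 \<in> SpI"
    using conj_X[OF N(1) M(1)] X_Sp N(2) by (auto intro: Dg_Sp_imp_SpI)
  then have bc: "a1\<^sup>2 - b1 * c1 = 1" "a2\<^sup>2 - b2 * c2 = 1" by (auto simp: Dg_SpI_iff)
  note att = att_Dg[OF S M(3), folded N(2), unfolded attains_conj_iff[OF N(1)]]
  show "sgd a1 \<Longrightarrow> att1 s M \<Longrightarrow> att1 (- s) M \<Longrightarrow> False"
    unfolding att using semidefinite[OF _ bc(1)] by blast
  show "sgd a2 \<Longrightarrow> att2 s M \<Longrightarrow> att2 (- s) M \<Longrightarrow> False"
    unfolding att using semidefinite[OF _ bc(2)] by blast
qed

lemma att0_nfD: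
  assumes "nfD a a e1 e2 \<in> SpI" "e1 = s \<or> e2 = s" "s * s = 1"
  shows "att0 s (nfD a a e1 e2)"
proof -
  let ?x = "axis (Inr (if e1 = s then 1 else 2)) 1 :: real^(2 + 2)"
  have "s * qf (nfD a a e1 e2) 0 1 ?x > 0"
    using assms unfolding nfD_def by (subst qf_Dg) (auto simp: axis_def)
  then show ?thesis using axis_V unfolding attains_def by blast
qed

text \<open>Definiteness on \<open>V\<close> is an open condition.\<close>

lemma att0_definite:
  assumes deg: "degenerates M (nfD a a s s)" and "sgd a" and s: "s = 1 \<or> s = - 1"
  shows "\<not> att0 (- s) M"
proof
  assume att: "att0 (- s) M"
  let ?z = "nfD a a s s"
  have S: "?z \<in> SpI" using s sgd_noteq[OF assms(2)] assms(2) by (intro nfD_SpI[of _ sgd]) (auto simp: signs_def)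
  \<comment> \<open>On \<open>V\<close> the form is bounded below by \<open>k\<close> times the
    squared norm. The constant is the smaller of its coefficients 1 and
    \<open>1 - a\<^sup>2\<close>, or 1 when only the \<open>Inr\<close> coordinates remain.\<close>
  obtain k where k: "k > 0" "\<And>x. x \<in> V \<Longrightarrow> s * qf ?z 0 1 x \<ge> k * (norm x)\<^sup>2"
  proof (cases "a\<^sup>2 > 1")
    case True
    have "s * qf ?z 0 1 x \<ge> 1 * (norm x)\<^sup>2" if "x \<in> V" for x
      using sgd_V[OF assms(2) True that] s S unfolding nfD_def norm_dbl
      by (subst qf_Dg) auto
    then show ?thesis using that[of 1] by auto
  next
    case False
    then have a: "1 - a\<^sup>2 > 0" using sgd_noteq[OF assms(2)] by simp
    have "s * qf ?z 0 1 x \<ge> (1 - a\<^sup>2) * (norm x)\<^sup>2" if "x \<in> V" for x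
    proof -
      have "s * qf ?z 0 1 x = (x $ Inr 1)\<^sup>2 + (x $ Inr 2)\<^sup>2 + (1 - a\<^sup>2) * ((x $ Inl 1)\<^sup>2 + (x $ Inl 2)\<^sup>2)"
        using s S unfolding nfD_def by (subst qf_Dg) (auto simp: algebra_simps)
      moreover have "(1 - a\<^sup>2) * ((x $ Inr 1)\<^sup>2 + (x $ Inr 2)\<^sup>2) \<le> 1 * ((x $ Inr 1)\<^sup>2 + (x $ Inr 2)\<^sup>2)"
        by (intro mult_right_mono) auto
      moreover have "(1 - a\<^sup>2) * (norm x)\<^sup>2 = (1 - a\<^sup>2) * ((x $ Inr 1)\<^sup>2 + (x $ Inr 2)\<^sup>2) +
          (1 - a\<^sup>2) * ((x $ Inl 1)\<^sup>2 + (x $ Inl 2)\<^sup>2)"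
        unfolding norm_dbl by (simp add: algebra_simps)
      ultimately show ?thesis by (simp only: mult_1_left)
    qed
    then show ?thesis using that a by blast
  qed
  have "?z \<in> closure (orbit H conj_act M)" using deg by (simp add: degenerates_def)
  \<comment> \<open>Here 64 is the product of the constants in \<open>om_bound\<close> and
    \<open>matrix_vector_bound\<close>: a perturbation below \<open>k / 64\<close> changes the form
    by at most \<open>k\<close> times the squared norm.\<close>
  moreover have "k / 64 > 0" using k by simp
  ultimately obtain Y where Y: "Y \<in> orbit H conj_act M" "dist Y ?z < k / 64"
    by (meson closure_approachable)
  have "\<not> att0 (- s) Y"
  proof
    assume "att0 (- s) Y"
    then obtain x where x: "x \<in> V" "- s * qf Y 0 1 x > 0" by (auto simp: attains_def)
    have "qf Y 0 1 x - qf ?z 0 1 x = om ((Y - ?z) *v x) x"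
      by (simp add: qf_def matrix_vector_mult_diff_rdistrib)
    then have "\<bar>qf Y 0 1 x - qf ?z 0 1 x\<bar> \<le> 4 * (norm ((Y - ?z) *v x) * norm x)"
      using om_bound by simp
    also have "\<dots> \<le> 4 * ((16 * norm (Y - ?z) * norm x) * norm x)"
      by (intro mult_left_mono mult_right_mono matrix_vector_bound) auto
    also have "\<dots> = 64 * norm (Y - ?z) * (norm x)\<^sup>2" by (simp add: power2_eq_square)
    also have "\<dots> \<le> k * (norm x)\<^sup>2"
      using Y(2) by (intro mult_right_mono) (auto simp: dist_norm)
    finally have "\<bar>qf Y 0 1 x - qf ?z 0 1 x\<bar> \<le> s * qf ?z 0 1 x" using k(2)[OF x(1)] by linarith
    then show False using s x(2) by auto
  qed
  moreover have "att0 (- s) Y" using Y(1) att attains_conj by (auto simp: orbit_def)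
  ultimately show False by blast
qed

lemma flip_snd: 
  assumes "\<not> sgd a2" "a2\<^sup>2 \<noteq> 1" shows "\<exists>N\<in>H. conj_act N (nfD a1 a2 e1 (- 1)) = nfD a1 a2 e1 1"
proof -
  let ?T = "dgl (m2 0 1 1 0)"
  have T: "?T \<in> H" using HI_H dgl_m2_HI[of 0 0 1 1] by auto
  obtain N where N: "N \<in> H" "conj_act N (nfD a2 a1 (- 1) e1) = nfD a2 a1 1 e1"
    using flip_fst[OF assms] by blast
  have "conj_act (?T ** (N ** ?T)) (nfD a1 a2 e1 (- 1)) = nfD a1 a2 e1 1"
    using N T H_Sp by (simp add: conj_act_mult[symmetric] H_mult subsetD nfD_swap)
  then show ?thesis using N T H_mult by blast
qed

text \<open>Replaces a sign that elements of \<open>H\<close> can flip by its representative 1. For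
  the symplectic group this is the effect of \<open>p0\<close> on one sign.\<close>

definition red :: "real \<Rightarrow> real \<Rightarrow> real" where
  "red a e = (if sgd a \<or> a\<^sup>2 = 1 then e else 1)"

lemma red_signs: "e \<in> signs (\<lambda>a. a\<^sup>2 \<noteq> 1) a \<Longrightarrow> red a e \<in> signs sgd a"
  using sgd_noteq[of a] by (auto simp: red_def signs_def split: if_splits)

lemma degenerates_red:
  assumes "e1 \<in> signs (\<lambda>a. a\<^sup>2 \<noteq> 1) a1" "e2 \<in> signs (\<lambda>a. a\<^sup>2 \<noteq> 1) a2"
  shows "degenerates (nfD a1 a2 e1 e2) (nfD a1 a2 (red a1 e1) (red a2 e2))"
proof -
  have X: "nfD a1 a2 e1 e2 \<in> X" using nfD_SpI[OF assms] SpI_X by blast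
  have 1: "degenerates (nfD a1 a2 e1 e2) (nfD a1 a2 (red a1 e1) e2)"
  proof (cases "red a1 e1 = e1")
    case False
    then have "\<not> sgd a1" "a1\<^sup>2 \<noteq> 1" "red a1 e1 = 1" "e1 = - 1"
      using assms(1) by (auto simp: red_def signs_def split: if_splits)
    then obtain N where "N \<in> H" "conj_act N (nfD a1 a2 e1 e2) = nfD a1 a2 (red a1 e1) e2"
      using flip_fst[of a1 a2 e2] by auto
    then show ?thesis using degenerates_act[OF X] by metis
  qed (use X degenerates_refl in simp)
  then have X': "nfD a1 a2 (red a1 e1) e2 \<in> X" by (simp add: degenerates_def)
  have "degenerates (nfD a1 a2 (red a1 e1) e2) (nfD a1 a2 (red a1 e1) (red a2 e2))"
  proof (cases "red a2 e2 = e2")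
    case False
    then have "\<not> sgd a2" "a2\<^sup>2 \<noteq> 1" "red a2 e2 = 1" "e2 = - 1"
      using assms(2) by (auto simp: red_def signs_def split: if_splits)
    then obtain N where "N \<in> H" "conj_act N (nfD a1 a2 (red a1 e1) e2) = nfD a1 a2 (red a1 e1) (red a2 e2)"
      using flip_snd[of a2 a1 "red a1 e1"] by auto
    then show ?thesis using degenerates_act[OF X'] by metis
  qed (use X' degenerates_refl in simp)
  then show ?thesis using 1 degenerates_trans[OF X] by blast
qed

lemma degenerates_Dg:
  assumes M: "M \<in> X" "base_pt M = (a1 + a2, a1 * a2)"
  shows "\<exists>b1 b2 c1 c2. Dg a1 a2 b1 b2 c1 c2 \<in> SpI \<and> degenerates M (Dg a1 a2 b1 b2 c1 c2)"
proof -
  have "\<exists>b1 b2 c1 c2. degenerates M (Dg a1 a2 b1 b2 c1 c2)"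
  proof (cases "a1 = a2")
    case True
    then have "base_pt M = (2 * a1, a1\<^sup>2)" using M by (simp add: power2_eq_square)
    then show ?thesis using double[OF M(1)] True by (auto simp: degenerates_def)
  next
    case False
    then show ?thesis using diag_distinct[OF M] degenerates_act[OF M(1)] by metis
  qed
  then show ?thesis using X_Sp Dg_Sp_imp_SpI unfolding degenerates_def by blast
qed

lemma degenerates_HI:
  assumes "actI.degenerates M M'" shows "degenerates M M'"
proof -
  have "orbit HI conj_act M \<subseteq> orbit H conj_act M"
    using HI_H by (fastforce simp: orbit_def)
  then have "closure (orbit HI conj_act M) \<subseteq> closure (orbit H conj_act M)"
    by (rule closure_mono)
  with assms SpI_X show ?thesis
    by (auto simp: actI.degenerates_def degenerates_def)
qed

lemma nform_exists:
  assumes M: "M \<in> X" shows "\<exists>z\<in>nforms sgd. degenerates M z"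
proof (cases "disc (base_pt M) < 0")
  case True
  define u v where "u = fst (base_pt M) / 2" and "v = sqrt (- disc (base_pt M))"
  have "v > 0" "v\<^sup>2 = - disc (base_pt M)" using True by (simp_all add: v_def)
  then have "base_pt M = (2 * u, u\<^sup>2 + v\<^sup>2)" by (simp add: prod_eq_iff u_def disc_def power_divide)
  then obtain N where "N \<in> H" "conj_act N M = nfN u v" using complex[OF M] \<open>v > 0\<close> by blast
  then have "degenerates M (nfN u v)" using degenerates_act[OF M] by metis
  then show ?thesis using nforms_nfN[OF \<open>v > 0\<close>] by blast
next
  case False
  define a1 a2 where "a1 = root1 (base_pt M)" and "a2 = root2 (base_pt M)"
  have le: "a2 \<le> a1" using False by (simp add: a1_def a2_def root1_def root2_def)
  have bp: "base_pt M = (a1 + a2, a1 * a2)"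
    unfolding a1_def a2_def using False by (intro roots_sum_prod) simp
  obtain b1 b2 c1 c2 where D: "Dg a1 a2 b1 b2 c1 c2 \<in> SpI" "degenerates M (Dg a1 a2 b1 b2 c1 c2)"
    using degenerates_Dg[OF M bp] by blast
  define e1 e2 where "e1 = (if a1\<^sup>2 = 1 then 0 else sgn b1)" and "e2 = (if a2\<^sup>2 = 1 then 0 else sgn b2)"
  have e: "e1 \<in> signs (\<lambda>a. a\<^sup>2 \<noteq> 1) a1" "e2 \<in> signs (\<lambda>a. a\<^sup>2 \<noteq> 1) a2"
    using D(1) by (auto simp: e1_def e2_def signs_def Dg_SpI_iff sgn_real_def)
  \<comment> \<open>Scaling inside \<open>HI\<close> keeps every sign; those that \<open>H\<close>
    can flip are normalised afterwards by \<open>red\<close>.\<close>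
  have "degenerates M (nfD a1 a2 e1 e2)"
    using Dg_degenerates(2)[OF D(1)] D(2) degenerates_trans[OF M] degenerates_HI unfolding e1_def e2_def by blast
  then have deg: "degenerates M (nfD a1 a2 (red a1 e1) (red a2 e2))"
    using degenerates_red[OF e] degenerates_trans[OF M] by blast
  show ?thesis
  \<comment> \<open>At a double eigenvalue the signs may come in the wrong order; interchanging the
    blocks corrects this.\<close>
  proof (cases "a1 = a2 \<and> red a1 e1 < red a2 e2")
    case False
    then have "nfD a1 a2 (red a1 e1) (red a2 e2) \<in> nforms sgd"
      using le red_signs e by (intro nforms_nfD) auto
    then show ?thesis using deg by blast
  next
    case True
    then have "nfD a1 a2 (red a2 e2) (red a1 e1) \<in> nforms sgd"
      using red_signs[OF e(1)] red_signs[OF e(2)] by (intro nforms_nfD) auto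
    moreover have "degenerates (nfD a1 a2 (red a1 e1) (red a2 e2)) (nfD a1 a2 (red a2 e2) (red a1 e1))"
    proof -
      have "dgl (m2 0 1 1 0) \<in> H" using HI_H dgl_m2_HI[of 0 0 1 1] by auto
      then show ?thesis
        using degenerates_act[of "nfD a1 a2 (red a1 e1) (red a2 e2)"] deg True nfD_swap
        unfolding degenerates_def by metis
    qed
    ultimately show ?thesis using deg degenerates_trans[OF M] by blast
  qed
qed

section \<open>Uniqueness of the normal form\<close>

lemma signs_cases:
  assumes "e \<in> signs sgd a" "e' \<in> signs sgd a" "e \<noteq> e'"
  shows "sgd a" "(e = 1 \<and> e' = - 1) \<or> (e = - 1 \<and> e' = 1)"
  using assms by (auto simp: signs_def split: if_splits)

lemma nform_unique_distinct:
  assumes M: "M \<in> X" and lt: "a2 < a1"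
    and z: "e1 \<in> signs sgd a1" "e2 \<in> signs sgd a2" "e1' \<in> signs sgd a1" "e2' \<in> signs sgd a2"
    and deg: "degenerates M (nfD a1 a2 e1 e2)" "degenerates M (nfD a1 a2 e1' e2')"
  shows "e1 = e1'" "e2 = e2'"
proof -
  have S: "nfD a1 a2 e1 e2 \<in> SpI" "nfD a1 a2 e1' e2' \<in> SpI" using z nfD_SpI by auto
  have bM: "base_pt M = (a1 + a2, a1 * a2)"
    using base_pt_degenerates[OF M deg(1)] base_pt_nfD[OF S(1)] by simp
  have att: "att1 s M" if "e1 = s \<or> e1' = s" "s * s = 1" for s
    using that(1)
  proof
    assume "e1 = s"
    then show ?thesis using degenerates_att(1)[OF deg(1)] att_nfD(1)[OF S(1) lt] that(2) by blast
  next
    assume "e1' = s"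
    then show ?thesis using degenerates_att(1)[OF deg(2)] att_nfD(1)[OF S(2) lt] that(2) by blast
  qed
  have att': "att2 s M" if "e2 = s \<or> e2' = s" "s * s = 1" for s
    using that(1)
  proof
    assume "e2 = s"
    then show ?thesis using degenerates_att(2)[OF deg(1)] att_nfD(2)[OF S(1) lt] that(2) by blast
  next
    assume "e2' = s"
    then show ?thesis using degenerates_att(2)[OF deg(2)] att_nfD(2)[OF S(2) lt] that(2) by blast
  qed
  show "e1 = e1'"
  proof (rule ccontr)
    assume "e1 \<noteq> e1'"
    note c = signs_cases[OF z(1) z(3) this]
    then have "att1 1 M" "att1 (- 1) M" using att[of 1] att[of "- 1"] by auto
    then show False using att_exclusive(1)[OF M bM lt c(1)] by blast
  qed
  show "e2 = e2'"
  proof (rule ccontr)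
    assume "e2 \<noteq> e2'"
    note c = signs_cases[OF z(2) z(4) this]
    then have "att2 1 M" "att2 (- 1) M" using att'[of 1] att'[of "- 1"] by auto
    then show False using att_exclusive(2)[OF M bM lt c(1)] by blast
  qed
qed

text \<open>The three ordered pairs of signs are positive definite, indefinite and negative
  definite. Every sign of a limit is attained by \<open>M\<close>, and a definite limit prevents
  \<open>M\<close> from attaining the opposite sign.\<close>

lemma nform_unique_double:
  assumes M: "M \<in> X" and sg: "sgd a"
    and z: "e1 \<in> {1, - 1}" "e2 \<in> {1, - 1}" "e1' \<in> {1, - 1}" "e2' \<in> {1, - 1}" "e2 \<le> e1" "e2' \<le> e1'"
    and deg: "degenerates M (nfD a a e1 e2)" "degenerates M (nfD a a e1' e2')"
  shows "e1 = e1' \<and> e2 = e2'"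
proof -
  have "e1 \<in> signs sgd a" "e2 \<in> signs sgd a" "e1' \<in> signs sgd a" "e2' \<in> signs sgd a"
    using z sg sgd_noteq[OF sg] by (simp_all add: signs_def)
  then have S: "nfD a a e1 e2 \<in> SpI" "nfD a a e1' e2' \<in> SpI" using nfD_SpI by blast+
  have att: "att0 s M" if "e1 = s \<or> e2 = s" "s * s = 1" for s
    using att0_nfD[OF S(1) that] by (rule degenerates_att(3)[OF deg(1)])
  have att': "att0 s M" if "e1' = s \<or> e2' = s" "s * s = 1" for s
    using att0_nfD[OF S(2) that] by (rule degenerates_att(3)[OF deg(2)])
  have def1: "\<not> att0 (- s) M" if "e1 = s" "e2 = s" "s = 1 \<or> s = - 1" for s
    using att0_definite[OF _ sg that(3)] deg(1) that by blast
  have def2: "\<not> att0 (- s) M" if "e1' = s" "e2' = s" "s = 1 \<or> s = - 1" for s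
    using att0_definite[OF _ sg that(3)] deg(2) that by blast
  have A: "e1 = 1 \<or> e2 = 1 \<Longrightarrow> att0 1 M" "e1 = - 1 \<or> e2 = - 1 \<Longrightarrow> att0 (- 1) M"
    "e1' = 1 \<or> e2' = 1 \<Longrightarrow> att0 1 M" "e1' = - 1 \<or> e2' = - 1 \<Longrightarrow> att0 (- 1) M"
    using att[of 1] att[of "- 1"] att'[of 1] att'[of "- 1"] by simp_all
  have B: "e1 = 1 \<Longrightarrow> e2 = 1 \<Longrightarrow> \<not> att0 (- 1) M" "e1 = - 1 \<Longrightarrow> e2 = - 1 \<Longrightarrow> \<not> att0 1 M"
    "e1' = 1 \<Longrightarrow> e2' = 1 \<Longrightarrow> \<not> att0 (- 1) M" "e1' = - 1 \<Longrightarrow> e2' = - 1 \<Longrightarrow> \<not> att0 1 M"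
    using def1[of 1] def1[of "- 1"] def2[of 1] def2[of "- 1"] by simp_all
  from z(1-4) have "e1 = 1 \<or> e1 = - 1" "e2 = 1 \<or> e2 = - 1" "e1' = 1 \<or> e1' = - 1" "e2' = 1 \<or> e2' = - 1"
    by simp_all
  then show ?thesis using A B z(5,6) by (elim disjE) simp_all
qed

lemma nform_unique:
  assumes M: "M \<in> X" and z: "z \<in> nforms sgd" "z' \<in> nforms sgd" and deg: "degenerates M z" "degenerates M z'"
  shows "z = z'"
proof -
  have bp: "base_pt z' = base_pt z"
    using base_pt_degenerates[OF M deg(1)] base_pt_degenerates[OF M deg(2)] by simp
  from z(1) show ?thesis
  proof (cases rule: nforms_cases)
    case (N u v)
    note N1 = this
    from z(2) show ?thesis
    proof (cases rule: nforms_cases)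
      case (N u' v')
      then have "u' = u" "v'\<^sup>2 = v\<^sup>2" using bp N1 base_pt_nfN by auto
      then show ?thesis using N N1 by simp
    next
      case D
      then show ?thesis using bp N1 by simp
    qed
  next
    case (D a1 a2 e1 e2)
    note D1 = this
    from z(2) show ?thesis
    proof (cases rule: nforms_cases)
      case N
      then show ?thesis using bp D1 by simp
    next
      case (D a1' a2' e1' e2')
      have a: "a1' = a1" "a2' = a2"
        using bp D(6) D1(6) roots_of_sum_prod[OF D(2)] roots_of_sum_prod[OF D1(2)] by simp_all
      note D2 = D(1,3-5)[unfolded a]
      show ?thesis
      proof (cases "a1 = a2")
        case False
        then have "a2 < a1" using D1(2) by simp
        then have "e1 = e1'" "e2 = e2'"
          using nform_unique_distinct[OF M _ D1(3,4) D2(2,3)] deg unfolding D1(1) D2(1) by blast+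
        then show ?thesis using D1(1) D2(1) by simp
      next
        case eq: True
        have "e1 = e1' \<and> e2 = e2'"
        proof (cases "sgd a1")
          case False
          then show ?thesis using D1(3,4) D2(2,3) signs_cases(1) unfolding eq by blast
        next
          case True
          then have "signs sgd a2 = {1, - 1}" using sgd_noteq eq by (simp add: signs_def)
          then show ?thesis
            using nform_unique_double[OF M True] D1(3,4,5) D2(2,3,4) deg
            unfolding D1(1) D2(1) eq by blast
        qed
        then show ?thesis using D1(1) D2(1) by simp
      qed
    qed
  qed
qed

sublocale git_normal_form X H conj_act "nforms sgd"
  using nforms_SpI SpI_X nform_exists nform_unique by unfold_locales auto

end

section \<open>Local sections over the complement of the branch locus\<close>

abbreviation regular :: "(real \<times> real) set" where
  "regular \<equiv> - branch_locus"

text \<open>The products \<open>(1 - a1) * (1 - a2)\<close> and \<open>(1 + a1) * (1 + a2)\<close>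
  vanish on the two lines, which therefore say that 1 or -1 is a root. Both lines are tangent to the
  parabola, so they avoid the points with \<open>disc x < 0\<close>.\<close>

lemma branch_locus_iff:
  "x \<in> branch_locus \<longleftrightarrow> \<not> (disc x < 0 \<or> disc x > 0 \<and> (root1 x)\<^sup>2 \<noteq> 1 \<and> (root2 x)\<^sup>2 \<noteq> 1)"
proof -
  obtain t d where x: "x = (t, d)" by (cases x)
  have G: "x \<in> branch_locus \<longleftrightarrow> disc x = 0 \<or> d = t - 1 \<or> d = - t - 1"
    by (auto simp: x branch_locus_def Gamma_d_def Gamma_1_def Gamma_m1_def disc_def)
  consider "disc x < 0" | "disc x = 0" | "disc x > 0" by linarith
  then show ?thesis
  proof cases
    case 1
    have "(t / 2 - 1)\<^sup>2 \<ge> 0" "(t / 2 + 1)\<^sup>2 \<ge> 0" by simp_all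
    then have "d \<noteq> t - 1" "d \<noteq> - t - 1"
      using 1 by (auto simp: x disc_def power2_eq_square algebra_simps)
    then show ?thesis using 1 G by simp
  next
    case 2
    then show ?thesis using G by simp
  next
    case 3
    then have td: "t = root1 x + root2 x" "d = root1 x * root2 x" using roots_sum_prod[of x] by (auto simp: x)
    have "(1 - root1 x) * (1 - root2 x) = 1 - t + d" "(1 + root1 x) * (1 + root2 x) = 1 + t + d"
      unfolding td by (simp_all add: algebra_simps)
    then have "d = t - 1 \<longleftrightarrow> root1 x = 1 \<or> root2 x = 1" "d = - t - 1 \<longleftrightarrow> root1 x = - 1 \<or> root2 x = - 1"
      by (auto simp: eq_diff_eq) (smt (verit) mult_eq_0_iff)+
    then show ?thesis using 3 G by (auto simp: power2_eq_1_iff)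
  qed
qed

text \<open>Fixes the position of both squared roots relative to 1. Such a set is evenly covered as
  a whole, although it may be a union of components: the condition does not separate roots above 1
  from roots below -1.\<close>

definition nbh :: "real \<times> real \<Rightarrow> (real \<times> real) set" where
  "nbh y = (if disc y < 0 then {x. disc x < 0} else
     {x. disc x > 0 \<and> sgn ((root1 x)\<^sup>2 - 1) = sgn ((root1 y)\<^sup>2 - 1) \<and>
         sgn ((root2 x)\<^sup>2 - 1) = sgn ((root2 y)\<^sup>2 - 1)})"

text \<open>The labels of the sheets. Over non-real eigenvalues there is one sheet, with the
  placeholder label \<open>(0, 0)\<close>.\<close>

definition idx :: "(real \<Rightarrow> bool) \<Rightarrow> real \<times> real \<Rightarrow> (real \<times> real) set" where
  "idx sgd y = (if disc y < 0 then {(0, 0)} else signs sgd (root1 y) \<times> signs sgd (root2 y))"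

definition sec :: "real \<times> real \<Rightarrow> real \<times> real \<Rightarrow> 2 dmat" where
  "sec i x = (if disc x < 0 then nfN (fst x / 2) (sqrt (- disc x))
     else nfD (root1 x) (root2 x) (fst i) (snd i))"

lemma nbh_self: "y \<in> regular \<Longrightarrow> y \<in> nbh y"
  by (auto simp: nbh_def branch_locus_iff)

lemma nbh_regular: "y \<in> regular \<Longrightarrow> nbh y \<subseteq> regular"
  by (auto simp: nbh_def branch_locus_iff sgn_real_def split: if_splits)

lemma open_nbh:
  assumes "y \<in> regular" shows "open (nbh y)"
proof -
  have sg: "open {x. sgn (f x) = sgn r}" if "continuous_on UNIV f" "r \<noteq> 0"
    for f :: "real \<times> real \<Rightarrow> real" and r
  proof (cases "r > 0")
    case True
    then have "{x. sgn (f x) = sgn r} = {x. 0 < f x}" by (auto simp: sgn_real_def)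
    then show ?thesis using that(1) by (simp add: open_Collect_less)
  next
    case False
    then have "{x. sgn (f x) = sgn r} = {x. f x < 0}" using that(2) by (auto simp: sgn_real_def)
    then show ?thesis using that(1) by (simp add: open_Collect_less)
  qed
  show ?thesis
  proof (cases "disc y < 0")
    case True
    have "open {x. disc x < 0}" by (intro open_Collect_less continuous_intros)
    then show ?thesis using True by (simp add: nbh_def)
  next
    case False
    then have "(root1 y)\<^sup>2 - 1 \<noteq> 0" "(root2 y)\<^sup>2 - 1 \<noteq> 0" using assms by (auto simp: branch_locus_iff)
    then have "open {x. sgn ((root1 x)\<^sup>2 - 1) = sgn ((root1 y)\<^sup>2 - 1)}"
        "open {x. sgn ((root2 x)\<^sup>2 - 1) = sgn ((root2 y)\<^sup>2 - 1)}"
      by (auto intro!: sg continuous_intros)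
    moreover have "open {x. 0 < disc x}" by (intro open_Collect_less continuous_intros)
    ultimately show ?thesis using False by (simp add: nbh_def open_Collect_conj)
  qed
qed

lemma continuous_on_M_ABC [continuous_intros]:
  assumes "continuous_on S a" "continuous_on S b" "continuous_on S c"
  shows "continuous_on S (\<lambda>x. M_ABC (a x) (b x) (c x))"
  using assms unfolding continuous_on_def M_ABC_def transpose_def
  by (intro ballI tendsto_intros) auto

lemma continuous_on_m2 [continuous_intros]:
  assumes "continuous_on S a" "continuous_on S b" "continuous_on S c" "continuous_on S d"
  shows "continuous_on S (\<lambda>x. m2 (a x) (b x) (c x) (d x))"
  using assms unfolding continuous_on_def by (intro ballI tendsto_intros) auto

lemma continuous_on_sec: "continuous_on (nbh y) (sec i)"
proof (cases "disc y < 0")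
  case True
  have "continuous_on (nbh y) (\<lambda>x. nfN (fst x / 2) (sqrt (- disc x)))"
    unfolding nfN_def by (intro continuous_intros) auto
  moreover have "sec i x = nfN (fst x / 2) (sqrt (- disc x))" if "x \<in> nbh y" for x
    using that True by (simp add: nbh_def sec_def)
  ultimately show ?thesis by (metis (no_types, lifting) continuous_on_cong)
next
  case False
  have "continuous_on (nbh y) (\<lambda>x. nfD (root1 x) (root2 x) (fst i) (snd i))"
    unfolding nfD_def Dg_def by (intro continuous_intros)
  moreover have "sec i x = nfD (root1 x) (root2 x) (fst i) (snd i)" if "x \<in> nbh y" for x
    using that False by (simp add: nbh_def sec_def)
  ultimately show ?thesis by (metis (no_types, lifting) continuous_on_cong)
qed

lemma sec_nforms:
  assumes "disc x \<noteq> 0" "i \<in> idx sgd x"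
  shows "sec i x \<in> nforms sgd" "base_pt (sec i x) = x"
proof -
  have "sec i x \<in> nforms sgd \<and> base_pt (sec i x) = x"
  proof (cases "disc x < 0")
    case True
    then have "base_pt (nfN (fst x / 2) (sqrt (- disc x))) = x"
      by (simp add: base_pt_nfN prod_eq_iff disc_def power_divide)
    then show ?thesis using True by (simp add: sec_def nforms_nfN)
  next
    case False
    then have lt: "root2 x < root1 x" using assms(1) roots_less_iff by auto
    have i: "fst i \<in> signs sgd (root1 x)" "snd i \<in> signs sgd (root2 x)"
      using assms(2) False by (auto simp: idx_def)
    have "base_pt (nfD (root1 x) (root2 x) (fst i) (snd i)) = x"
      using base_pt_nfD[OF nfD_SpI[OF i]] roots_sum_prod[of x] False by simp
    moreover have "nfD (root1 x) (root2 x) (fst i) (snd i) \<in> nforms sgd"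
      using lt i by (intro nforms_nfD) auto
    ultimately show ?thesis using False by (simp add: sec_def)
  qed
  then show "sec i x \<in> nforms sgd" "base_pt (sec i x) = x" by auto
qed

lemma nforms_sec:
  assumes "z \<in> nforms sgd" "disc (base_pt z) \<noteq> 0"
  shows "\<exists>i\<in>idx sgd (base_pt z). z = sec i (base_pt z)"
  using assms(1)
proof (cases rule: nforms_cases)
  case (N u v)
  then have "sqrt (- disc (base_pt z)) = v"
    by (simp add: base_pt_nfN disc_def power_mult_distrib)
  then have "z = sec (0, 0) (base_pt z)" using N by (simp add: sec_def base_pt_nfN)
  then show ?thesis using N(3) by (auto simp: idx_def)
next
  case (D a1 a2 e1 e2)
  have r: "root1 (base_pt z) = a1" "root2 (base_pt z) = a2"
    using roots_of_sum_prod[OF D(2)] D(6) by simp_all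
  have "z = sec (e1, e2) (base_pt z)" using D(1,7) r by (simp add: sec_def)
  moreover have "(e1, e2) \<in> idx sgd (base_pt z)" using D(3,4,7) r by (simp add: idx_def)
  ultimately show ?thesis by blast
qed

lemma sec_inj: "i \<in> idx sgd x \<Longrightarrow> j \<in> idx sgd x \<Longrightarrow> sec i x = sec j x \<Longrightarrow> i = j"
  by (auto simp: idx_def sec_def nfD_inject split: if_splits)

lemma card_nforms_sec:
  assumes "disc x \<noteq> 0" shows "card {z \<in> nforms sgd. base_pt z = x} = card (idx sgd x)"
proof -
  have "{z \<in> nforms sgd. base_pt z = x} = (\<lambda>i. sec i x) ` idx sgd x"
  proof
    show "{z \<in> nforms sgd. base_pt z = x} \<subseteq> (\<lambda>i. sec i x) ` idx sgd x"
      using nforms_sec assms by blast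
    show "(\<lambda>i. sec i x) ` idx sgd x \<subseteq> {z \<in> nforms sgd. base_pt z = x}"
      using sec_nforms[OF assms] by blast
  qed
  then show ?thesis using sec_inj by (simp add: card_image inj_on_def)
qed

lemma card_nforms_double:
  assumes "disc x = 0" and noteq: "\<And>a. sgd a \<Longrightarrow> a\<^sup>2 \<noteq> 1"
  shows "card {z \<in> nforms sgd. base_pt z = x} = (if sgd (fst x / 2) then 3 else 1)"
proof -
  define a where "a = fst x / 2"
  have r: "root1 x = a" "root2 x = a" using assms(1) by (simp_all add: root1_def root2_def a_def)
  have x: "x = (a + a, a * a)" using roots_sum_prod[of x] assms(1) r by simp
  have set: "{z \<in> nforms sgd. base_pt z = x} =
      {nfD a a e1 e2 | e1 e2. e1 \<in> signs sgd a \<and> e2 \<in> signs sgd a \<and> e2 \<le> e1}" (is "?L = ?R")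
  proof
    show "?R \<subseteq> ?L" by (auto simp: base_pt_nfD nfD_SpI x intro: nforms_nfD)
    show "?L \<subseteq> ?R"
    proof
      fix z assume z: "z \<in> ?L"
      then have "z \<in> nforms sgd" by simp
      then show "z \<in> ?R"
      proof (cases rule: nforms_cases)
        case N
        then show ?thesis using z assms(1) by simp
      next
        case (D a1 a2 e1 e2)
        have "a1 = a" "a2 = a"
          using roots_of_sum_prod[OF D(2)] D(6) z r by auto
        then show ?thesis using D by auto
      qed
    qed
  qed
  show ?thesis
  proof (cases "sgd a")
    case True
    then have "signs sgd a = {1, - 1}" using noteq by (simp add: signs_def)
    then have "?R = {nfD a a 1 1, nfD a a 1 (- 1), nfD a a (- 1) (- 1)}" by (auto simp: nfD_inject)
    then show ?thesis unfolding set using True by (simp add: nfD_inject a_def[symmetric])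
  next
    case False
    then obtain e where "signs sgd a = {e}" by (cases "a\<^sup>2 = 1") (auto simp: signs_def)
    then have "?R = {nfD a a e e}" by auto
    then show ?thesis unfolding set using False by (simp add: a_def[symmetric])
  qed
qed

context krein
begin

lemma signs_cong: "sgn (a\<^sup>2 - 1) = sgn (b\<^sup>2 - 1) \<Longrightarrow> signs sgd a = signs sgd b"
  using sgd_cong[of a b] by (auto simp: signs_def sgn_real_def split: if_splits)

lemma idx_cong: "x \<in> nbh y \<Longrightarrow> idx sgd x = idx sgd y"
proof (cases "disc y < 0")
  case False
  assume "x \<in> nbh y"
  then have "disc x > 0" "sgn ((root1 x)\<^sup>2 - 1) = sgn ((root1 y)\<^sup>2 - 1)"
      "sgn ((root2 x)\<^sup>2 - 1) = sgn ((root2 y)\<^sup>2 - 1)"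
    using False by (simp_all add: nbh_def)
  with signs_cong[OF this(2)] signs_cong[OF this(3)] show ?thesis using False by (simp add: idx_def)
qed (simp add: idx_def nbh_def)

lemma nbh_disc: "y \<in> regular \<Longrightarrow> x \<in> nbh y \<Longrightarrow> disc x \<noteq> 0"
  using subsetD[OF nbh_regular, of y x] by (auto simp: branch_locus_iff)

lemma sec_in: 
  assumes "y \<in> regular" "x \<in> nbh y" "i \<in> idx sgd y"
  shows "sec i x \<in> nforms sgd" "base_pt (sec i x) = x" "sec i x \<in> X"
  using sec_nforms[OF nbh_disc[OF assms(1,2)], of i sgd] assms idx_cong Z_subset by auto

lemma nf_base_pt: "M \<in> X \<Longrightarrow> base_pt (nf M) = base_pt M"
  using base_pt_degenerates nf_props by blast

lemma cls_sec_iff: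
  assumes y: "y \<in> regular" and i: "i \<in> idx sgd y" and M: "M \<in> X"
  shows "cls M \<in> (\<lambda>x. cls (sec i x)) ` nbh y \<longleftrightarrow> base_pt M \<in> nbh y \<and> nf M = sec i (base_pt M)"
proof
  assume "cls M \<in> (\<lambda>x. cls (sec i x)) ` nbh y"
  then obtain x where x: "x \<in> nbh y" "cls M = cls (sec i x)" by blast
  note s = sec_in[OF y x(1) i]
  have "nf M = sec i x" using x(2) cls_eq_iff[OF M s(3)] nf_Z[OF s(1)] by simp
  moreover from this have "base_pt M = x" using nf_base_pt[OF M] s(2) by simp
  ultimately show "base_pt M \<in> nbh y \<and> nf M = sec i (base_pt M)" using x(1) by simp
next
  assume *: "base_pt M \<in> nbh y \<and> nf M = sec i (base_pt M)"
  then have "cls M = cls (sec i (base_pt M))" using cls_nf[OF M] by simp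
  then show "cls M \<in> (\<lambda>x. cls (sec i x)) ` nbh y" using * by blast
qed

text \<open>Turns membership in a sheet into open conditions. Attaining the detected signs of
  \<open>i\<close> suffices: the opposite signs are then excluded, and an undetected sign has only
  one possible label.\<close>

lemma nf_eq_sec_iff:
  assumes y: "y \<in> regular" and i: "i \<in> idx sgd y" and M: "M \<in> X" "base_pt M \<in> nbh y"
  shows "nf M = sec i (base_pt M) \<longleftrightarrow>
    (disc y > 0 \<longrightarrow> (sgd (root1 y) \<longrightarrow> att1 (fst i) M) \<and> (sgd (root2 y) \<longrightarrow> att2 (snd i) M))"
proof (cases "disc y > 0")
  case False
  then have "disc y < 0" using y by (auto simp: branch_locus_iff)
  then have idx: "idx sgd (base_pt M) = {(0, 0)}" using M(2) by (simp add: idx_def nbh_def)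
  have "\<exists>j\<in>idx sgd (base_pt M). nf M = sec j (base_pt M)"
    using nforms_sec[OF nf_props(1)[OF M(1)]] nf_base_pt[OF M(1)] nbh_disc[OF y M(2)] by simp
  then show ?thesis using False i idx idx_cong[OF M(2)] by auto
next
  case True
  let ?x = "base_pt M"
  define a1 a2 where "a1 = root1 ?x" and "a2 = root2 ?x"
  have x0: "disc ?x > 0" "sgn (a1\<^sup>2 - 1) = sgn ((root1 y)\<^sup>2 - 1)" "sgn (a2\<^sup>2 - 1) = sgn ((root2 y)\<^sup>2 - 1)"
    using M(2) True by (simp_all add: nbh_def a1_def a2_def)
  note x = x0(1) sgd_cong[OF x0(2)] sgd_cong[OF x0(3)]
  have lt: "a2 < a1" using x roots_less_iff by (simp add: a1_def a2_def)
  have bp: "base_pt M = (a1 + a2, a1 * a2)" using roots_sum_prod[of ?x] x(1) by (simp add: a1_def a2_def)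
  have sec: "sec j ?x = nfD a1 a2 (fst j) (snd j)" for j using x(1) by (simp add: sec_def a1_def a2_def)
  have ix: "idx sgd y = signs sgd a1 \<times> signs sgd a2"
    using idx_cong[OF M(2)] x(1) by (simp add: idx_def a1_def a2_def)
  have pm: "e * e = 1" if "e \<in> signs sgd a" "sgd a" for e a
    using that(1) sgd_noteq[OF that(2)] that(2) by (auto simp: signs_def)
  have att: "(sgd a1 \<longrightarrow> att1 (fst j) M) \<and> (sgd a2 \<longrightarrow> att2 (snd j) M)"
    if j: "j \<in> idx sgd y" "nf M = sec j ?x" for j
  proof -
    have deg: "degenerates M (nfD a1 a2 (fst j) (snd j))"
      using nf_props(2)[OF M(1)] unfolding j(2) sec .
    have e: "fst j \<in> signs sgd a1" "snd j \<in> signs sgd a2" using j(1) unfolding ix mem_Times_iff by blast+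
    show ?thesis
      using degenerates_att(1)[OF deg att_nfD(1)[OF nfD_SpI[OF e] lt refl]]
        degenerates_att(2)[OF deg att_nfD(2)[OF nfD_SpI[OF e] lt refl]] pm e by blast
  qed
  show ?thesis
  proof
    assume "nf M = sec i ?x"
    then show "disc y > 0 \<longrightarrow> (sgd (root1 y) \<longrightarrow> att1 (fst i) M) \<and> (sgd (root2 y) \<longrightarrow> att2 (snd i) M)"
      using att[OF i] x by simp
  next
    assume "disc y > 0 \<longrightarrow> (sgd (root1 y) \<longrightarrow> att1 (fst i) M) \<and> (sgd (root2 y) \<longrightarrow> att2 (snd i) M)"
    then have ai: "sgd a1 \<Longrightarrow> att1 (fst i) M" "sgd a2 \<Longrightarrow> att2 (snd i) M" using True x by auto
    obtain j where j: "j \<in> idx sgd y" "nf M = sec j ?x"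
      using nforms_sec[OF nf_props(1)[OF M(1)]] nf_base_pt[OF M(1)] nbh_disc[OF y M(2)] idx_cong[OF M(2)]
      by auto
    have e: "fst j \<in> signs sgd a1" "snd j \<in> signs sgd a2" "fst i \<in> signs sgd a1" "snd i \<in> signs sgd a2"
      using j(1) i unfolding ix mem_Times_iff by blast+
    have "fst j = fst i"
    proof (rule ccontr)
      assume "fst j \<noteq> fst i"
      note c = signs_cases[OF e(1) e(3) this]
      have "fst j = - fst i" using c(2) by auto
      then show False
        using att_exclusive(1)[OF M(1) bp lt c(1), of "fst i"] ai(1)[OF c(1)] att[OF j] c(1) by simp
    qed
    moreover have "snd j = snd i"
    proof (rule ccontr)
      assume "snd j \<noteq> snd i"
      note c = signs_cases[OF e(2) e(4) this]
      have "snd j = - snd i" using c(2) by auto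
      then show False
        using att_exclusive(2)[OF M(1) bp lt c(1), of "snd i"] ai(2)[OF c(1)] att[OF j] c(1) by simp
    qed
    ultimately have "j = i" by (simp add: prod_eq_iff)
    then show "nf M = sec i ?x" using j(2) by simp
  qed
qed

lemma openin_sheet:
  assumes y: "y \<in> regular" and i: "i \<in> idx sgd y"
  shows "openin quot ((\<lambda>x. cls (sec i x)) ` nbh y)"
  unfolding openin_quot_iff
proof
  show "(\<lambda>x. cls (sec i x)) ` nbh y \<subseteq> cls ` X" using sec_in(3)[OF y _ i] by blast
  define A1 where "A1 = (if disc y > 0 \<and> sgd (root1 y) then {M. att1 (fst i) M} else UNIV)"
  define A2 where "A2 = (if disc y > 0 \<and> sgd (root2 y) then {M. att2 (snd i) M} else UNIV)"
  have "open A1" "open A2"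
    unfolding A1_def A2_def by (auto intro!: open_attains continuous_intros)
  moreover have "open (base_pt -` nbh y)"
    using continuous_on_base_pt[of UNIV] open_nbh[OF y] by (simp add: continuous_on_open_vimage)
  ultimately have "open (base_pt -` nbh y \<inter> A1 \<inter> A2)" by blast
  moreover have "{M \<in> X. cls M \<in> (\<lambda>x. cls (sec i x)) ` nbh y} = X \<inter> (base_pt -` nbh y \<inter> A1 \<inter> A2)"
  proof -
    have "cls M \<in> (\<lambda>x. cls (sec i x)) ` nbh y \<longleftrightarrow> base_pt M \<in> nbh y \<and> M \<in> A1 \<and> M \<in> A2" if "M \<in> X" for M
      using cls_sec_iff[OF y i that] nf_eq_sec_iff[OF y i that] by (auto simp only: A1_def A2_def split: if_splits)
    then show ?thesis by blast
  qed
  ultimately show "openin (top_of_set X) {M \<in> X. cls M \<in> (\<lambda>x. cls (sec i x)) ` nbh y}"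
    by (simp add: openin_open_Int)
qed

lemma continuous_map_sheet:
  assumes y: "y \<in> regular" and i: "i \<in> idx sgd y"
  shows "continuous_map (top_of_set (nbh y)) quot (\<lambda>x. cls (sec i x))"
proof -
  have "continuous_map (top_of_set (nbh y)) (top_of_set X) (sec i)"
    using continuous_on_sec sec_in(3)[OF y _ i] by (auto simp: continuous_map_subtopology_eu)
  then have "continuous_map (top_of_set (nbh y)) quot (cls \<circ> sec i)"
    using continuous_map_cls by (rule continuous_map_compose)
  then show ?thesis by (simp add: comp_def)
qed

lemma sheets_disjoint:
  assumes y: "y \<in> regular" and ij: "i \<in> idx sgd y" "j \<in> idx sgd y" "i \<noteq> j"
  shows "(\<lambda>x. cls (sec i x)) ` nbh y \<inter> (\<lambda>x. cls (sec j x)) ` nbh y = {}"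
proof (rule ccontr)
  assume "\<not> ?thesis"
  then obtain x where x: "x \<in> nbh y" "cls (sec i x) \<in> (\<lambda>x. cls (sec j x)) ` nbh y" by blast
  note s = sec_in[OF y x(1) ij(1)]
  have "sec i x = sec j x"
    using x(2) cls_sec_iff[OF y ij(2) s(3)] nf_Z[OF s(1)] s(2) by simp
  then show False using sec_inj[of i sgd x j] ij idx_cong[OF x(1)] by simp
qed

lemma sheets_cover:
  assumes y: "y \<in> regular" and M: "M \<in> X" "base_pt M \<in> nbh y"
  shows "\<exists>i\<in>idx sgd y. cls M = cls (sec i (base_pt M))"
proof -
  obtain i where "i \<in> idx sgd y" "nf M = sec i (base_pt M)"
    using nforms_sec[OF nf_props(1)[OF M(1)]] nf_base_pt[OF M(1)] nbh_disc[OF y M(2)] idx_cong[OF M(2)] by auto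
  then show ?thesis using cls_nf[OF M(1)] by metis
qed

lemma idx_nonempty: "idx sgd y \<noteq> {}"
  by (simp add: idx_def signs_def)

lemma continuous_map_base:
  assumes p: "\<And>M. M \<in> X \<Longrightarrow> p (cls M) = base_pt M"
  shows "continuous_map quot euclidean p"
proof -
  have "continuous_map (top_of_set X) euclidean base_pt"
    using continuous_on_base_pt by simp
  then have "continuous_map (top_of_set X) euclidean (p \<circ> cls)"
    by (rule continuous_map_eq) (simp add: p)
  then show ?thesis by (simp add: continuous_map_quot_iff)
qed

text \<open>The normal forms \<open>sec i x\<close>, one for each label, give the continuous
  sections, and their images are open by \<open>openin_sheet\<close>.\<close>

lemma covering_map_base:
  assumes p: "\<And>M. M \<in> X \<Longrightarrow> p (cls M) = base_pt M"
  defines "R \<equiv> {c \<in> topspace quot. p c \<in> regular}"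
  shows "covering_map (subtopology quot R) (top_of_set regular) p"
proof (rule covering_mapI)
  show "continuous_map (subtopology quot R) (top_of_set regular) p"
    using continuous_map_base[OF p] by (auto simp: continuous_map_in_subtopology R_def continuous_map_from_subtopology)
  fix y assume "y \<in> topspace (top_of_set regular)"
  then have y: "y \<in> regular" by simp
  have sub: "(\<lambda>x. cls (sec i x)) ` nbh y \<subseteq> R" if "i \<in> idx sgd y" for i
    using sec_in[OF y _ that] p nbh_regular[OF y] by (auto simp: R_def topspace_quot)
  have "open_sections (subtopology quot R) (top_of_set regular) p (nbh y) (idx sgd y) (\<lambda>i x. cls (sec i x))"
    unfolding open_sections_def
  proof (intro conjI ballI impI)
    show "openin (top_of_set regular) (nbh y)"
      using open_nbh[OF y] nbh_regular[OF y] by (simp add: open_subset)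
    show "idx sgd y \<noteq> {}" by (rule idx_nonempty)
    show "continuous_map (subtopology (top_of_set regular) (nbh y)) (subtopology quot R) (\<lambda>x. cls (sec i x))"
      if "i \<in> idx sgd y" for i
      using continuous_map_sheet[OF y that] sub[OF that] nbh_regular[OF y]
      by (auto simp: continuous_map_in_subtopology subtopology_subtopology Int_absorb1)
    show "openin (subtopology quot R) ((\<lambda>x. cls (sec i x)) ` nbh y)" if "i \<in> idx sgd y" for i
      using openin_sheet[OF y that] sub[OF that] by (simp add: openin_subtopology_Int2 Int_absorb2 openin_subset_topspace_eq openin_subtopology) blast
    show "p (cls (sec i x)) = x" if "i \<in> idx sgd y" "x \<in> nbh y" for i x
      using p sec_in[OF y that(2,1)] by simp
    show "(\<lambda>x. cls (sec i x)) ` nbh y \<inter> (\<lambda>x. cls (sec j x)) ` nbh y = {}"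
      if "i \<in> idx sgd y" "j \<in> idx sgd y" "i \<noteq> j" for i j
      using sheets_disjoint[OF y that] .
    show "{c \<in> topspace (subtopology quot R). p c \<in> nbh y} \<subseteq> (\<Union>i\<in>idx sgd y. (\<lambda>x. cls (sec i x)) ` nbh y)"
    proof
      fix c assume "c \<in> {c \<in> topspace (subtopology quot R). p c \<in> nbh y}"
      then obtain M where M: "M \<in> X" "c = cls M" "base_pt M \<in> nbh y" using p by (auto simp: topspace_quot)
      then show "c \<in> (\<Union>i\<in>idx sgd y. (\<lambda>x. cls (sec i x)) ` nbh y)"
        using sheets_cover[OF y M(1,3)] by blast
    qed
  qed
  then show "\<exists>T I s. y \<in> T \<and> open_sections (subtopology quot R) (top_of_set regular) p T (I :: (real \<times> real) set) s"
    using nbh_self[OF y] by blast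
qed

lemma card_fibre:
  assumes p: "\<And>M. M \<in> X \<Longrightarrow> p (cls M) = base_pt M"
  shows "card {c \<in> topspace quot. p c = x} = card {z \<in> nforms sgd. base_pt z = x}"
proof -
  have "{c \<in> topspace quot. p c = x} = cls ` {z \<in> nforms sgd. base_pt z = x}"
    using p Z_subset unfolding topspace_quot_Z by force
  then show ?thesis using inj_on_cls_Z by (simp add: card_image inj_on_subset)
qed

end

section \<open>The two quotients\<close>

text \<open>On these vectors \<open>(0, y)\<close> the form \<^const>\<open>qf\<close> of \<open>M_ABC A B C\<close> is
  \<open>y\<^sup>T(cA + d)By\<close>, which only sees \<open>B\<close> and hence has more invariant signs.\<close>

definition V_right :: "(real^(2 + 2)) set" where
  "V_right = {x. \<forall>k. x $ Inl k = 0}"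

text \<open>Block diagonal matrices preserve the test vectors \<open>(0, y)\<close>, so all signs
  with \<open>a\<^sup>2 \<noteq> 1\<close> are detected.\<close>

interpretation kI: krein SpI HI V_right "\<lambda>a. a\<^sup>2 \<noteq> 1"
proof
  show "spinv N \<in> HI" if N: "N \<in> HI" for N :: "2 dmat"
  proof -
    obtain R :: "2 sqmat" where R: "invertible R" "N = dgl R" using N by (auto simp: HI_def GL_def)
    have "invertible (matrix_inv R)" using matrix_inv_invertible[OF R(1)] by (auto simp: invertible_def)
    moreover from this have "spinv N = dgl (matrix_inv R)"
    proof -
      have "matrix_inv (matrix_inv R) = R"
        using matrix_inv_invertible[OF R(1)] by (intro matrix_inv_eqI)
      then show ?thesis
        unfolding R(2) spinv_dgl[OF R(1)] unfolding dgl_def matrix_inv_transpose[OF \<open>invertible (matrix_inv R)\<close>] by simp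
    qed
    ultimately show ?thesis by (auto simp: HI_def GL_def)
  qed
  show "N *v x \<in> V_right" if "N \<in> HI" "x \<in> V_right" for N x
    using that by (auto simp: HI_def V_right_def dgl_def matrix_vector_mult_def sum_UNIV_Plus)
  show "\<exists>N\<in>HI. \<exists>b1 b2 c1 c2. conj_act N M = Dg a1 a2 b1 b2 c1 c2"
    if "M \<in> SpI" "base_pt M = (a1 + a2, a1 * a2)" "a1 \<noteq> a2" for M a1 a2
    by (rule SpI_diag_distinct[OF that]) blast
  show "\<exists>b1 b2 c1 c2. Dg a a b1 b2 c1 c2 \<in> SpI \<inter> closure (orbit HI conj_act M)"
    if "M \<in> SpI" "base_pt M = (2 * a, a\<^sup>2)" for M a
    by (rule SpI_double[OF that]) (unfold actI.degenerates_def, blast)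
  show "\<exists>N\<in>HI. conj_act N M = nfN u v"
    if "M \<in> SpI" "base_pt M = (2 * u, u\<^sup>2 + v\<^sup>2)" "0 < v" for M u v
    by (rule SpI_complex[OF that]) blast
qed (auto simp: HI_Sp HI_mult SpI_subset_Sp[THEN subsetD] actI.act_in V_right_def axis_def sgn_real_def split: if_splits)

text \<open>All vectors are test vectors here. The form is then semidefinite only for
  \<open>a\<^sup>2 < 1\<close>, and for \<open>a\<^sup>2 > 1\<close> the flip of
  \<open>nfD_flip_fst\<close> identifies the two signs.\<close>

interpretation kS: krein Sp Sp UNIV "\<lambda>a. a\<^sup>2 < 1"
proof
  show "\<exists>N\<in>Sp. conj_act N (nfD a1 a2 (- 1) e2) = nfD a1 a2 1 e2" if "\<not> a1\<^sup>2 < 1" "a1\<^sup>2 \<noteq> 1" for a1 a2 e2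
    using nfD_flip_fst[of a1 a2 e2] that by fastforce
  show "\<exists>N\<in>Sp. \<exists>b1 b2 c1 c2. conj_act N M = Dg a1 a2 b1 b2 c1 c2"
    if "M \<in> Sp" "base_pt M = (a1 + a2, a1 * a2)" "a1 \<noteq> a2" for M a1 a2
    by (rule Sp_diag_distinct[OF that]) blast
  show "\<exists>b1 b2 c1 c2. Dg a a b1 b2 c1 c2 \<in> Sp \<inter> closure (orbit Sp conj_act M)"
    if "M \<in> Sp" "base_pt M = (2 * a, a\<^sup>2)" for M a
    by (rule Sp_double[OF that]) (unfold actS.degenerates_def, blast)
  show "\<exists>N\<in>Sp. conj_act N M = nfN u v"
    if "M \<in> Sp" "base_pt M = (2 * u, u\<^sup>2 + v\<^sup>2)" "0 < v" for M u v
    by (rule Sp_complex[OF that]) blast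
qed (auto simp: HI_Sp Sp_mult SpI_subset_Sp[THEN subsetD] Sp_spinv_mem conj_act_mem sgn_real_def split: if_splits)

lemma orbit_SpI: "x \<in> topspace (top_of_set SpI) \<Longrightarrow> orbit GL GL_act x = orbit HI conj_act x"
  using orbit_GL_act by simp

lemma SpI_rel_eq: "SpI_rel = orbit_closure_rel (top_of_set SpI) HI conj_act"
  unfolding SpI_rel_def by (rule orbit_closure_rel_cong) (rule orbit_SpI)

lemma SpI_class_eq: "SpI_class = git_class (top_of_set SpI) HI conj_act"
  unfolding SpI_class_def by (rule git_class_cong) (rule orbit_SpI)

lemma SpI_git_eq: "SpI_git = git_quotient (top_of_set SpI) HI conj_act"
  unfolding SpI_git_def by (rule git_quotient_cong) (rule orbit_SpI)

lemmas class_eqs = SpI_class_eq Sp_class_def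
lemmas git_eqs = SpI_git_eq Sp_git_def

text \<open>The class meets \<open>SpI\<close> because its normal form lies there, and
  \<open>base_pt\<close> is constant on the class; so \<open>the_elem\<close> is applied to a
  singleton.\<close>

lemma p1_class: assumes M: "M \<in> Sp" shows "p1 (Sp_class M) = base_pt M"
proof -
  have base: "(trace (block_A M'), det (block_A M')) = base_pt M'" if "M' \<in> SpI" for M' :: "2 dmat"
    using that by (rule SpI_exists) (use that in \<open>auto simp: base_pt_M_ABC\<close>)
  have "(\<lambda>M. (trace (block_A M), det (block_A M))) ` (Sp_class M \<inter> SpI) = {base_pt M}"
  proof (intro equalityI subsetI)
    fix x assume "x \<in> (\<lambda>M. (trace (block_A M), det (block_A M))) ` (Sp_class M \<inter> SpI)"
    then obtain M' where M': "M' \<in> Sp_class M" "M' \<in> SpI" "x = base_pt M'" using base by auto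
    then have "M' \<in> Sp" "kS.nf M' = kS.nf M" unfolding class_eqs kS.cls_eq[OF M] by auto
    then show "x \<in> {base_pt M}" using kS.nf_base_pt M M'(3) by (metis singletonI)
  next
    fix x assume "x \<in> {base_pt M}"
    have z: "kS.nf M \<in> SpI" using kS.nf_props(1)[OF M] nforms_SpI by blast
    have "kS.nf M \<in> Sp_class M"
      unfolding class_eqs kS.cls_eq[OF M] using kS.nf_in[OF M] kS.nf_Z[OF kS.nf_props(1)[OF M]] by simp
    moreover have "base_pt (kS.nf M) = x" using kS.nf_base_pt[OF M] \<open>x \<in> {base_pt M}\<close> by simp
    ultimately show "x \<in> (\<lambda>M. (trace (block_A M), det (block_A M))) ` (Sp_class M \<inter> SpI)"
      using z base[OF z] by (intro image_eqI[of _ _ "kS.nf M"]) auto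
  qed
  then show ?thesis by (simp add: p1_def)
qed

text \<open>A degeneration under the smaller group is one under the larger group. Hence the
  symplectic normal form depends only on the linear one, which makes \<open>p0\<close> well
  defined.\<close>

lemma kS_nf_kI_nf: assumes M: "M \<in> SpI" shows "kS.nf (kI.nf M) = kS.nf M"
proof -
  have "actI.degenerates M (kI.nf M)" using kI.nf_props(2)[OF M] .
  then have "actS.degenerates M (kI.nf M)" by (rule actI_imp_actS)
  then show ?thesis using kS.degenerates_nf_eq SpI_subset_Sp M by blast
qed

lemma p0_class: assumes M: "M \<in> SpI" shows "p0 (SpI_class M) = Sp_class M"
proof -
  have "Sp_class ` SpI_class M = {Sp_class M}"
  proof (intro equalityI subsetI)
    fix d assume "d \<in> Sp_class ` SpI_class M"
    then obtain M' where M': "M' \<in> SpI" "kI.nf M' = kI.nf M" "d = Sp_class M'"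
      unfolding class_eqs kI.cls_eq[OF M] by auto
    then have "kS.nf M' = kS.nf M" using kS_nf_kI_nf[OF M] kS_nf_kI_nf[OF M'(1)] by simp
    then show "d \<in> {Sp_class M}"
      using M'(1,3) M SpI_subset_Sp kS.cls_eq_iff[of M' M] unfolding class_eqs by blast
  next
    fix d assume "d \<in> {Sp_class M}"
    moreover have "M \<in> SpI_class M" unfolding class_eqs kI.cls_eq[OF M] using M by simp
    ultimately show "d \<in> Sp_class ` SpI_class M" by blast
  qed
  then show ?thesis by (simp add: p0_def)
qed

lemma p2_class: "M \<in> SpI \<Longrightarrow> p2 (SpI_class M) = base_pt M"
  using SpI_subset_Sp by (auto simp: p2_def p0_class p1_class)

section \<open>The covering \<open>p0\<close>\<close>

text \<open>The map induced by \<open>p0\<close> on sheet labels.\<close>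

definition redi :: "real \<times> real \<Rightarrow> real \<times> real \<Rightarrow> real \<times> real" where
  "redi y i = (if disc y < 0 then (0, 0) else (kS.red (root1 y) (fst i), kS.red (root2 y) (snd i)))"

abbreviation "idxI \<equiv> idx (\<lambda>a. a\<^sup>2 \<noteq> 1)"
abbreviation "idxS \<equiv> idx (\<lambda>a. a\<^sup>2 < 1)"

lemma redi_idx: "i \<in> idxI y \<Longrightarrow> redi y i \<in> idxS y"
  by (auto simp: redi_def idx_def kS.red_signs)

lemma idxS_subset: "j \<in> idxS y \<Longrightarrow> j \<in> idxI y"
  by (auto simp: idx_def signs_def split: if_splits)

text \<open>Together with \<open>idxS_subset\<close> this makes \<open>redi\<close> a retraction of
  the labels of \<open>p2\<close> onto those of \<open>p1\<close>, so every sheet of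
  \<open>p1\<close> has a sheet of \<open>p2\<close> above it.\<close>

lemma redi_idxS: "j \<in> idxS y \<Longrightarrow> redi y j = j"
  by (auto simp: redi_def idx_def signs_def kS.red_def split: if_splits)

lemma red_cong: "sgn (a\<^sup>2 - 1) = sgn (b\<^sup>2 - 1) \<Longrightarrow> kS.red a e = kS.red b e"
  by (auto simp: kS.red_def sgn_real_def split: if_splits)

lemma redi_cong: "x \<in> nbh y \<Longrightarrow> redi x i = redi y i"
proof (cases "disc y < 0")
  case False
  assume "x \<in> nbh y"
  then have "disc x > 0" "sgn ((root1 x)\<^sup>2 - 1) = sgn ((root1 y)\<^sup>2 - 1)"
      "sgn ((root2 x)\<^sup>2 - 1) = sgn ((root2 y)\<^sup>2 - 1)"
    using False by (simp_all add: nbh_def)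
  with red_cong[OF this(2)] red_cong[OF this(3)] show ?thesis using False by (simp add: redi_def)
qed (simp add: redi_def nbh_def)

lemma kS_nf_sec:
  assumes x: "x \<in> regular" and i: "i \<in> idxI x"
  shows "kS.nf (sec i x) = sec (redi x i) x"
proof -
  have d: "disc x \<noteq> 0" using x by (auto simp: branch_locus_iff)
  have z: "sec (redi x i) x \<in> nforms (\<lambda>a. a\<^sup>2 < 1)" using sec_nforms(1)[OF d redi_idx[OF i]] .
  have S: "sec i x \<in> Sp" using sec_nforms(1)[OF d i] nforms_SpI SpI_subset_Sp by blast
  have "actS.degenerates (sec i x) (sec (redi x i) x)"
  proof (cases "disc x < 0")
    case True
    then have "sec (redi x i) x = sec i x" by (simp add: sec_def)
    then show ?thesis using actS.degenerates_refl[OF S] by simp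
  next
    case False
    then show ?thesis using kS.degenerates_red[of "fst i" "root1 x" "snd i" "root2 x"] i
      by (simp add: sec_def redi_def idx_def mem_Times_iff)
  qed
  then show ?thesis using kS.nf_eqI[OF S z] by blast
qed

lemma Sp_class_sec_iff:
  assumes y: "y \<in> regular" and x: "x \<in> nbh y" and i: "i \<in> idxI y" and j: "j \<in> idxS y"
  shows "Sp_class (sec i x) = Sp_class (sec j x) \<longleftrightarrow> redi y i = j"
proof -
  have xr: "x \<in> regular" using nbh_regular[OF y] x by blast
  have ij: "i \<in> idxI x" "j \<in> idxS x" using kI.idx_cong[OF x] kS.idx_cong[OF x] i j by simp_all
  have S: "sec i x \<in> Sp" "sec j x \<in> Sp"
    using kI.sec_in(3)[OF y x i] kS.sec_in(3)[OF y x j] SpI_subset_Sp by blast+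
  have "kS.nf (sec i x) = sec (redi y i) x"
    using kS_nf_sec[OF xr ij(1)] redi_cong[OF x] by simp
  moreover have "kS.nf (sec j x) = sec j x" using kS.nf_Z[OF kS.sec_in(1)[OF y x j]] .
  ultimately have "Sp_class (sec i x) = Sp_class (sec j x) \<longleftrightarrow> sec (redi y i) x = sec j x"
    unfolding class_eqs kS.cls_eq_iff[OF S] by simp
  then show ?thesis
    using sec_inj[of "redi y i" "\<lambda>a. a\<^sup>2 < 1" x j] redi_idx[OF ij(1)] redi_cong[OF x] ij(2) by auto
qed

lemma topspace_SpI_git: "topspace (SpI_git :: 2 dmat set topology) = SpI_class ` SpI"
  unfolding git_eqs class_eqs by (rule kI.topspace_quot)

lemma topspace_Sp_git: "topspace (Sp_git :: 2 dmat set topology) = Sp_class ` Sp"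
  unfolding git_eqs class_eqs by (rule kS.topspace_quot)

lemma continuous_map_p0: "continuous_map SpI_git Sp_git p0"
proof -
  have "continuous_map (top_of_set SpI) Sp_git (Sp_class :: 2 dmat \<Rightarrow> _)"
    unfolding git_eqs class_eqs
    by (rule continuous_map_from_subtopology_mono[OF kS.continuous_map_cls SpI_subset_Sp])
  then have "continuous_map (top_of_set SpI) Sp_git (p0 \<circ> SpI_class)"
    by (rule continuous_map_eq) (simp add: p0_class)
  then show ?thesis unfolding git_eqs class_eqs kI.continuous_map_quot_iff .
qed

text \<open>Over the sheet \<open>j\<close>, where \<open>p1\<close> is injective, a section of
  \<open>p0\<close> is \<open>p1\<close> followed by a section of \<open>p2\<close>. The labels
  \<open>i\<close> that occur are those with \<open>redi y i = j\<close>.\<close>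

lemma open_sections_p0:
  assumes y: "y \<in> regular" and j: "j \<in> idxS y"
  shows "open_sections (subtopology SpI_git (preimage2 regular))
      (subtopology Sp_git (preimage1 regular)) p0
      ((\<lambda>x. Sp_class (sec j x)) ` nbh y) {i \<in> idxI y. redi y i = j} (\<lambda>i d. SpI_class (sec i (p1 d)))"
    (is "open_sections ?X ?Y p0 ?T ?I ?s")
proof -
  have secI: "sec i x \<in> SpI" "base_pt (sec i x) = x" if "i \<in> idxI y" "x \<in> nbh y" for i x
    using kI.sec_in[OF y that(2,1)] by auto
  have secS: "sec j x \<in> Sp" "p1 (Sp_class (sec j x)) = x" if "x \<in> nbh y" for x
    using kS.sec_in[OF y that j] by (auto simp: p1_class)
  have TY: "?T \<subseteq> preimage1 regular"
    using secS nbh_regular[OF y] by (auto simp: preimage1_def topspace_Sp_git)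
  have sI: "?s i ` ?T = (\<lambda>x. SpI_class (sec i x)) ` nbh y" for i
    using secS(2) by (auto simp: image_image)
  have IX: "(\<lambda>x. SpI_class (sec i x)) ` nbh y \<subseteq> preimage2 regular" if "i \<in> idxI y" for i
    using secI[OF that] nbh_regular[OF y] by (auto simp: preimage2_def topspace_SpI_git p2_class)
  show ?thesis
    unfolding open_sections_def
  proof (intro conjI ballI impI)
    have "openin Sp_git ?T" unfolding git_eqs class_eqs using kS.openin_sheet[OF y j] .
    then show "openin ?Y ?T" using TY by (metis inf.absorb1 openin_subtopology_Int)
    show "?I \<noteq> {}" using idxS_subset[OF j] redi_idxS[OF j] by blast
    show "continuous_map (subtopology ?Y ?T) ?X (?s i)" if "i \<in> ?I" for i
    proof -
      have i: "i \<in> idxI y" using that by simp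
      have "continuous_map Sp_git euclidean p1"
        unfolding git_eqs by (rule kS.continuous_map_base) (simp add: p1_class[unfolded class_eqs])
      then have "continuous_map (subtopology Sp_git ?T) (top_of_set (nbh y)) p1"
        using secS(2) by (auto simp: continuous_map_in_subtopology continuous_map_from_subtopology)
      moreover have "continuous_map (top_of_set (nbh y)) SpI_git (\<lambda>x. SpI_class (sec i x))"
        unfolding git_eqs class_eqs by (rule kI.continuous_map_sheet[OF y i])
      ultimately have "continuous_map (subtopology Sp_git ?T) SpI_git ((\<lambda>x. SpI_class (sec i x)) \<circ> p1)"
        by (rule continuous_map_compose)
      moreover have "subtopology ?Y ?T = subtopology Sp_git ?T"
        using TY by (simp add: subtopology_subtopology Int_absorb1)
      moreover have "(?s i) ` ?T \<subseteq> preimage2 regular" using sI IX[OF i] by simp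
      ultimately show ?thesis
        by (auto simp: continuous_map_in_subtopology comp_def)
    qed
    show "openin ?X (?s i ` ?T)" if "i \<in> ?I" for i
    proof -
      have i: "i \<in> idxI y" using that by simp
      have "openin SpI_git (?s i ` ?T)" unfolding sI unfolding git_eqs class_eqs by (rule kI.openin_sheet[OF y i])
      then show ?thesis using IX[OF i] unfolding sI by (metis inf.absorb1 openin_subtopology_Int)
    qed
    show "p0 (?s i d) = d" if iI: "i \<in> ?I" and dT: "d \<in> ?T" for i d
    proof -
      obtain x where x: "x \<in> nbh y" "d = Sp_class (sec j x)" using dT by blast
      have i: "i \<in> idxI y" "redi y i = j" using iI by simp_all
      have "?s i d = SpI_class (sec i x)" using x secS(2) by simp
      then have "p0 (?s i d) = Sp_class (sec i x)" using secI(1)[OF i(1) x(1)] by (simp only: p0_class)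
      also have "\<dots> = d" using Sp_class_sec_iff[OF y x(1) i(1) j] i(2) x(2) by blast
      finally show ?thesis .
    qed
    show "?s i ` ?T \<inter> ?s k ` ?T = {}" if "i \<in> ?I" "k \<in> ?I" "i \<noteq> k" for i k
      unfolding sI unfolding class_eqs using kI.sheets_disjoint[OF y _ _ that(3)] that(1,2) by blast
    show "{c \<in> topspace ?X. p0 c \<in> ?T} \<subseteq> (\<Union>i\<in>?I. ?s i ` ?T)"
    proof
      fix c assume "c \<in> {c \<in> topspace ?X. p0 c \<in> ?T}"
      then obtain M x where M: "M \<in> SpI" "c = SpI_class M" and x: "x \<in> nbh y" "Sp_class M = Sp_class (sec j x)"
        by (auto simp: topspace_SpI_git p0_class)
      have bx: "base_pt M = x"
        using arg_cong[OF x(2), of p1] secS[OF x(1)] p1_class M(1) SpI_subset_Sp by auto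
      obtain i where i: "i \<in> idxI y" "c = SpI_class (sec i x)"
        using kI.sheets_cover[OF y M(1)] x(1) M(2) bx unfolding class_eqs by auto
      have "Sp_class (sec i x) = Sp_class (sec j x)"
        using arg_cong[OF i(2), of p0] M x(2) secI(1)[OF i(1) x(1)] by (simp add: p0_class)
      then have "i \<in> ?I" using i(1) Sp_class_sec_iff[OF y x(1) i(1) j] by simp
      moreover have "c \<in> ?s i ` ?T" unfolding sI using i(2) x(1) by blast
      ultimately show "c \<in> (\<Union>i\<in>?I. ?s i ` ?T)" by blast
    qed
  qed
qed

lemma preimage1_regular_cases:
  assumes "d \<in> preimage1 regular"
  obtains j where "p1 d \<in> regular" "j \<in> idxS (p1 d)" "d = Sp_class (sec j (p1 d))"
proof -
  obtain M where M: "M \<in> Sp" "d = Sp_class M" using assms by (auto simp: preimage1_def topspace_Sp_git)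
  then have b: "base_pt M = p1 d" by (simp add: p1_class)
  have y: "p1 d \<in> regular" using assms by (auto simp: preimage1_def)
  show ?thesis
    using that[OF y] kS.sheets_cover[OF y M(1)] nbh_self[OF y] M(2) b unfolding class_eqs by auto
qed

lemma covering_map_p0:
  "covering_map (subtopology SpI_git (preimage2 regular))
     (subtopology Sp_git (preimage1 regular)) p0"
proof (rule covering_mapI)
  have "p0 c \<in> preimage1 regular" if c: "c \<in> preimage2 regular" for c
  proof -
    obtain M where "M \<in> SpI" "c = SpI_class M" using c by (auto simp: preimage2_def topspace_SpI_git)
    then show ?thesis
      using c SpI_subset_Sp by (auto simp: preimage2_def preimage1_def p2_def topspace_Sp_git p0_class)
  qed
  then show "continuous_map (subtopology SpI_git (preimage2 regular))
     (subtopology Sp_git (preimage1 regular)) p0"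
    using continuous_map_p0 by (auto simp: continuous_map_in_subtopology continuous_map_from_subtopology)
  fix d assume "d \<in> topspace (subtopology Sp_git (preimage1 regular))"
  then obtain j where j: "p1 d \<in> regular" "j \<in> idxS (p1 d)" "d = Sp_class (sec j (p1 d))"
    using preimage1_regular_cases[of d] by auto
  then have "d \<in> (\<lambda>x. Sp_class (sec j x)) ` nbh (p1 d)" using nbh_self[OF j(1)] by (rule_tac image_eqI)
  then show "\<exists>T I s. d \<in> T \<and> open_sections (subtopology SpI_git (preimage2 regular))
     (subtopology Sp_git (preimage1 regular)) p0 T (I :: (real \<times> real) set) s"
    using open_sections_p0[OF j(1,2)] by (intro exI conjI)
qed

lemma covering_map_p1:
  "covering_map (subtopology Sp_git (preimage1 regular)) (top_of_set regular) p1"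
  unfolding preimage1_def git_eqs by (rule kS.covering_map_base) (simp add: p1_class[unfolded class_eqs])

section \<open>Counting\<close>

lemma card_preimage1: "card (preimage1 {x}) = card {z \<in> nforms (\<lambda>a. a\<^sup>2 < 1). base_pt z = x}"
  using kS.card_fibre[of p1 x] p1_class by (simp add: preimage1_def git_eqs class_eqs)

lemma card_preimage2: "card (preimage2 {x}) = card {z \<in> nforms (\<lambda>a. a\<^sup>2 \<noteq> 1). base_pt z = x}"
  using kI.card_fibre[of p2 x] p2_class by (simp add: preimage2_def git_eqs class_eqs)

text \<open>The number of sheets of \<open>p0\<close>: each real root with square above 1 has two
  signs that the symplectic group identifies.\<close>

definition flips :: "real \<times> real \<Rightarrow> nat" where
  "flips y = (if disc y < 0 then 1 else
     (if (root1 y)\<^sup>2 > 1 then 2 else 1) * (if (root2 y)\<^sup>2 > 1 then 2 else 1))"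

lemma card_red:
  assumes "a\<^sup>2 \<noteq> 1" "e' \<in> signs (\<lambda>a. a\<^sup>2 < 1) a"
  shows "card {e \<in> signs (\<lambda>a. a\<^sup>2 \<noteq> 1) a. kS.red a e = e'} = (if a\<^sup>2 > 1 then 2 else 1)"
proof (cases "a\<^sup>2 > 1")
  case True
  then have "{e \<in> signs (\<lambda>a. a\<^sup>2 \<noteq> 1) a. kS.red a e = e'} = {1, - 1}"
    using assms by (auto simp: signs_def kS.red_def)
  then show ?thesis using True by simp
next
  case False
  then have "{e \<in> signs (\<lambda>a. a\<^sup>2 \<noteq> 1) a. kS.red a e = e'} = {e'}"
    using assms by (auto simp: signs_def kS.red_def)
  then show ?thesis using False by simp
qed

lemma card_redi:
  assumes y: "y \<in> regular" and j: "j \<in> idxS y"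
  shows "card {i \<in> idxI y. redi y i = j} = flips y"
proof (cases "disc y < 0")
  case True
  then have "{i \<in> idxI y. redi y i = j} = {(0, 0)}" using j by (auto simp: idx_def redi_def)
  then show ?thesis using True by (simp add: flips_def)
next
  case False
  then have r: "(root1 y)\<^sup>2 \<noteq> 1" "(root2 y)\<^sup>2 \<noteq> 1" using y by (auto simp: branch_locus_iff)
  have "{i \<in> idxI y. redi y i = j} =
     {e \<in> signs (\<lambda>a. a\<^sup>2 \<noteq> 1) (root1 y). kS.red (root1 y) e = fst j} \<times>
     {e \<in> signs (\<lambda>a. a\<^sup>2 \<noteq> 1) (root2 y). kS.red (root2 y) e = snd j}"
    using False by (auto simp: idx_def redi_def)
  then show ?thesis
    using False r j card_red[of "root1 y" "fst j"] card_red[of "root2 y" "snd j"]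
    by (simp add: card_cartesian_product flips_def idx_def mem_Times_iff)
qed

lemma card_preimage0:
  assumes d: "d \<in> preimage1 regular" shows "card (preimage0 d) = flips (p1 d)"
proof -
  obtain j where y: "p1 d \<in> regular" and j: "j \<in> idxS (p1 d)" and dj: "d = Sp_class (sec j (p1 d))"
    using preimage1_regular_cases[OF d] .
  let ?y = "p1 d" and ?I = "{i \<in> idxI (p1 d). redi (p1 d) i = j}"
  note ny = nbh_self[OF y]
  have "preimage0 d = (\<lambda>i. SpI_class (sec i ?y)) ` ?I"
  proof (intro equalityI subsetI)
    fix c assume "c \<in> preimage0 d"
    then obtain M where M: "M \<in> SpI" "c = SpI_class M" "Sp_class M = d"
      by (auto simp: preimage0_def topspace_SpI_git p0_class)
    then have b: "base_pt M = ?y" using p1_class SpI_subset_Sp by auto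
    obtain i where i: "i \<in> idxI ?y" "c = SpI_class (sec i ?y)"
      using kI.sheets_cover[OF y M(1)] ny M(2) b unfolding class_eqs by auto
    have "Sp_class (sec i ?y) = d"
      using arg_cong[OF i(2), of p0] M kI.sec_in(3)[OF y ny i(1)] by (simp add: p0_class)
    then have "redi ?y i = j" using Sp_class_sec_iff[OF y ny i(1) j] dj by simp
    then show "c \<in> (\<lambda>i. SpI_class (sec i ?y)) ` ?I" using i by blast
  next
    fix c assume "c \<in> (\<lambda>i. SpI_class (sec i ?y)) ` ?I"
    then obtain i where i: "i \<in> idxI ?y" "redi ?y i = j" "c = SpI_class (sec i ?y)" by blast
    have S: "sec i ?y \<in> SpI" using kI.sec_in(3)[OF y ny i(1)] .
    have "p0 c = d" using Sp_class_sec_iff[OF y ny i(1) j] i(2,3) dj S by (simp add: p0_class)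
    then show "c \<in> preimage0 d" using i(3) S by (auto simp: preimage0_def topspace_SpI_git)
  qed
  moreover have "inj_on (\<lambda>i. SpI_class (sec i ?y)) ?I"
  proof (rule inj_onI)
    fix i k assume ik: "i \<in> ?I" "k \<in> ?I" "SpI_class (sec i ?y) = SpI_class (sec k ?y)"
    show "i = k"
    proof (rule ccontr)
      assume "i \<noteq> k"
      then show False using kI.sheets_disjoint[OF y _ _ \<open>i \<noteq> k\<close>] ik ny unfolding class_eqs by blast
    qed
  qed
  ultimately show ?thesis using card_redi[OF y j] by (simp add: card_image)
qed

lemma flips_cong: "x \<in> nbh y \<Longrightarrow> flips x = flips y"
proof (cases "disc y < 0")
  case False
  assume "x \<in> nbh y"
  then have "disc x > 0" and s: "sgn ((root1 x)\<^sup>2 - 1) = sgn ((root1 y)\<^sup>2 - 1)"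
      "sgn ((root2 x)\<^sup>2 - 1) = sgn ((root2 y)\<^sup>2 - 1)"
    using False by (simp_all add: nbh_def)
  have "1 < a\<^sup>2 \<longleftrightarrow> 1 < b\<^sup>2" if "sgn (a\<^sup>2 - 1) = sgn (b\<^sup>2 - 1)" for a b :: real
    using that by (auto simp: sgn_real_def split: if_splits)
  from this[OF s(1)] this[OF s(2)] show ?thesis using False \<open>disc x > 0\<close> by (simp add: flips_def)
qed (simp add: flips_def nbh_def)

text \<open>Local constancy on the sets \<open>nbh y\<close> and connectedness give constant sheet
  numbers without identifying the components with the named regions.\<close>

lemma constant_on_component:
  assumes D: "D \<in> components regular" and f: "\<And>x y. x \<in> nbh y \<Longrightarrow> f x = f y"
    and xy: "x \<in> D" "y \<in> D"
  shows "f x = f y"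
proof (rule connected_local_const[OF in_components_connected[OF D] xy])
  show "\<forall>a\<in>D. \<forall>\<^sub>F b in at a within D. f a = f b"
  proof
    fix a assume "a \<in> D"
    then have a: "a \<in> regular" using in_components_subset[OF D] by blast
    have "\<forall>\<^sub>F b in at a within D. b \<in> nbh a"
      using eventually_at_topological open_nbh[OF a] nbh_self[OF a] by blast
    then show "\<forall>\<^sub>F b in at a within D. f a = f b"
      by eventually_elim (simp add: f)
  qed
qed

lemma card_signs: "card (signs sgd a) = (if a\<^sup>2 \<noteq> 1 \<and> sgd a then 2 else 1)"
  by (simp add: signs_def)

lemma sheet_numbers_constant:
  assumes D: "D \<in> components regular"
  shows "\<exists>k0 k1 :: nat. 0 < k0 \<and> 0 < k1 \<and>
        (\<forall>d \<in> preimage1 D. card (preimage0 d) = k0) \<and> (\<forall>x \<in> D. card (preimage1 {x}) = k1)"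
proof -
  have sub: "D \<subseteq> regular" by (rule in_components_subset[OF D])
  obtain y where y: "y \<in> D" using in_components_nonempty[OF D] by blast
  have "card (preimage0 d) = flips y" if "d \<in> preimage1 D" for d
  proof -
    have "d \<in> preimage1 regular" "p1 d \<in> D" using that sub by (auto simp: preimage1_def)
    then show ?thesis using card_preimage0 constant_on_component[OF D, of flips, OF flips_cong] y by metis
  qed
  moreover have "card (preimage1 {x}) = card (idxS y)" if "x \<in> D" for x
  proof -
    have "disc x \<noteq> 0" using that sub by (auto simp: branch_locus_iff)
    moreover have "idxS x = idxS y" using constant_on_component[OF D, of idxS, OF kS.idx_cong that y] by simp
    ultimately show ?thesis by (simp add: card_preimage1 card_nforms_sec)
  qed
  moreover have "flips y > 0" by (simp add: flips_def)
  moreover have "card (idxS y) > 0" by (simp add: idx_def card_cartesian_product card_signs)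
  ultimately show ?thesis by blast
qed

text \<open>Each root contributes the number of its signs. Since only distinctness of the roots is
  assumed, this covers the branch lines off the parabola as well as regular points.\<close>

lemma fibre_cards_distinct:
  assumes "a2 < a1" "x = (a1 + a2, a1 * a2)"
  shows "card (preimage2 {x}) = (if a1\<^sup>2 = 1 then 1 else 2) * (if a2\<^sup>2 = 1 then 1 else 2)"
    "card (preimage1 {x}) = (if a1\<^sup>2 < 1 then 2 else 1) * (if a2\<^sup>2 < 1 then 2 else 1)"
proof -
  have r: "root1 x = a1" "root2 x = a2" using roots_of_sum_prod[of a2 a1] assms by simp_all
  have d: "disc x > 0" unfolding assms(2) disc_sum_prod using assms(1) by simp
  show "card (preimage2 {x}) = (if a1\<^sup>2 = 1 then 1 else 2) * (if a2\<^sup>2 = 1 then 1 else 2)"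
    "card (preimage1 {x}) = (if a1\<^sup>2 < 1 then 2 else 1) * (if a2\<^sup>2 < 1 then 2 else 1)"
    using d by (auto simp: card_preimage1 card_preimage2 card_nforms_sec idx_def r card_cartesian_product card_signs)
qed

lemma fibre_cards_double:
  assumes "disc x = 0"
  shows "card (preimage2 {x}) = (if (fst x / 2)\<^sup>2 = 1 then 1 else 3)"
    "card (preimage1 {x}) = (if (fst x / 2)\<^sup>2 < 1 then 3 else 1)"
  using card_nforms_double[OF assms, of "\<lambda>a. a\<^sup>2 \<noteq> 1"] card_nforms_double[OF assms, of "\<lambda>a. a\<^sup>2 < 1"]
  by (auto simp: card_preimage1 card_preimage2)

lemma fibre_cards_complex:
  assumes "disc x < 0" shows "card (preimage2 {x}) = 1" "card (preimage1 {x}) = 1"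
  using assms by (simp_all add: card_preimage1 card_preimage2 card_nforms_sec idx_def)

text \<open>The two product identities translate the position of a point relative to the branch
  lines into the position of the roots relative to 1 and -1.\<close>

lemma disc_pos_roots:
  assumes "disc (t, d) > 0"
  obtains a1 a2 where "a2 < a1" "t = a1 + a2" "d = a1 * a2"
    "(1 - a1) * (1 - a2) = 1 - t + d" "(1 + a1) * (1 + a2) = 1 + t + d"
proof -
  define a1 a2 where "a1 = root1 (t, d)" and "a2 = root2 (t, d)"
  have td: "t = a1 + a2" "d = a1 * a2"
    using roots_sum_prod[of "(t, d)"] assms unfolding a1_def a2_def by auto
  have "(1 - a1) * (1 - a2) = 1 - t + d" "(1 + a1) * (1 + a2) = 1 + t + d"
    unfolding td by (simp_all add: algebra_simps)
  moreover have "a2 < a1" using roots_less_iff assms unfolding a1_def a2_def by blast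
  ultimately show ?thesis using that td by blast
qed

lemma square_less_1_iff: "a\<^sup>2 < 1 \<longleftrightarrow> - 1 < a \<and> a < (1::real)"
  using abs_square_less_1[of a] by auto

lemma signs_of_factors:
  fixes x y :: real
  shows "x * y > 0 \<Longrightarrow> x > 0 \<and> y > 0 \<or> x < 0 \<and> y < 0" "x * y < 0 \<Longrightarrow> x > 0 \<and> y < 0 \<or> x < 0 \<and> y > 0"
  by (auto simp: zero_less_mult_iff mult_less_0_iff)

lemma cards_E2: "x \<in> region_E2 \<Longrightarrow> card (preimage2 {x}) = 4 \<and> card (preimage1 {x}) = 4"
proof -
  assume "x \<in> region_E2"
  then obtain t d where x: "x = (t, d)" "- 2 < t" "t < 2" "- t - 1 < d" "t - 1 < d" "d < t\<^sup>2 / 4"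
    by (auto simp: region_E2_def)
  then have "disc (t, d) > 0" by (simp add: disc_def)
  then obtain a1 a2 where a: "a2 < a1" "t = a1 + a2" "d = a1 * a2"
    "(1 - a1) * (1 - a2) = 1 - t + d" "(1 + a1) * (1 + a2) = 1 + t + d" by (rule disc_pos_roots)
  have "(1 - a1) * (1 - a2) > 0" "(1 + a1) * (1 + a2) > 0" using a x by simp_all
  \<comment> \<open>Both roots lie on the same side of 1 and on the same side of -1; the bounds on
    their sum \<open>t\<close> place them in between.\<close>
  from signs_of_factors(1)[OF this(1)] signs_of_factors(1)[OF this(2)]
  have "a1 < 1" "a2 < 1" "- 1 < a1" "- 1 < a2" using a(1,2) x(2,3) by auto
  then show ?thesis using fibre_cards_distinct[OF a(1)] x(1) a(2,3)
    by (simp add: square_less_1_iff power2_eq_1_iff)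
qed

lemma cards_EH: "x \<in> region_EHp \<union> region_EHm \<Longrightarrow> card (preimage2 {x}) = 4 \<and> card (preimage1 {x}) = 2"
proof -
  assume "x \<in> region_EHp \<union> region_EHm"
  then obtain t d where x: "x = (t, d)" "0 < t \<and> \<bar>d + 1\<bar> < t \<or> t < 0 \<and> \<bar>d + 1\<bar> < - t"
    by (auto simp: region_EHp_def region_EHm_def)
  have "(t / 2 - 1)\<^sup>2 \<ge> 0" "(t / 2 + 1)\<^sup>2 \<ge> 0" by simp_all
  then have "t - 1 \<le> t\<^sup>2 / 4" "- t - 1 \<le> t\<^sup>2 / 4" by (simp_all add: power2_eq_square algebra_simps)
  then have "disc (t, d) > 0" using x(2) by (auto simp: disc_def)
  then obtain a1 a2 where a: "a2 < a1" "t = a1 + a2" "d = a1 * a2"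
    "(1 - a1) * (1 - a2) = 1 - t + d" "(1 + a1) * (1 + a2) = 1 + t + d" by (rule disc_pos_roots)
  from x(2) have "a1 > 1 \<and> a2 < 1 \<and> - 1 < a2 \<or> a2 < - 1 \<and> - 1 < a1 \<and> a1 < 1"
  proof
    assume "0 < t \<and> \<bar>d + 1\<bar> < t"
    then have "(1 - a1) * (1 - a2) < 0" "(1 + a1) * (1 + a2) > 0" unfolding a(4,5) by auto
    from signs_of_factors(2)[OF this(1)] signs_of_factors(1)[OF this(2)]
    show ?thesis using a(1) by auto
  next
    assume "t < 0 \<and> \<bar>d + 1\<bar> < - t"
    then have "(1 - a1) * (1 - a2) > 0" "(1 + a1) * (1 + a2) < 0" unfolding a(4,5) by auto
    from signs_of_factors(1)[OF this(1)] signs_of_factors(2)[OF this(2)]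
    show ?thesis using a(1) by auto
  qed
  then show ?thesis using fibre_cards_distinct[OF a(1)] x(1) a(2,3)
    by (auto simp: square_less_1_iff power2_eq_1_iff)
qed

lemma cards_H: "x \<in> region_Hpp \<union> region_Hmp \<union> region_Hmm \<Longrightarrow> card (preimage2 {x}) = 4 \<and> card (preimage1 {x}) = 1"
proof -
  assume "x \<in> region_Hpp \<union> region_Hmp \<union> region_Hmm"
  then obtain t d where x: "x = (t, d)" 
    "2 < t \<and> t - 1 < d \<and> d < t\<^sup>2 / 4 \<or> d < - 1 \<and> \<bar>t\<bar> < - d - 1 \<or> t < - 2 \<and> - t - 1 < d \<and> d < t\<^sup>2 / 4"
    by (auto simp: region_Hpp_def region_Hmp_def region_Hmm_def)
  have "0 \<le> t\<^sup>2 / 4" by simp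
  then have "d < t\<^sup>2 / 4" using x(2) by linarith
  then have "disc (t, d) > 0" by (simp add: disc_def)
  then obtain a1 a2 where a: "a2 < a1" "t = a1 + a2" "d = a1 * a2"
    "(1 - a1) * (1 - a2) = 1 - t + d" "(1 + a1) * (1 + a2) = 1 + t + d" by (rule disc_pos_roots)
  from x(2) have "a1 > 1 \<and> a2 > 1 \<or> a1 > 1 \<and> a2 < - 1 \<or> a1 < - 1 \<and> a2 < - 1"
  proof (elim disjE)
    assume *: "2 < t \<and> t - 1 < d \<and> d < t\<^sup>2 / 4"
    then have "(1 - a1) * (1 - a2) > 0" unfolding a(4) by auto
    from signs_of_factors(1)[OF this] show ?thesis using a(1,2) * by auto
  next
    assume "d < - 1 \<and> \<bar>t\<bar> < - d - 1"
    then have "(1 - a1) * (1 - a2) < 0" "(1 + a1) * (1 + a2) < 0" unfolding a(4,5) by auto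
    from signs_of_factors(2)[OF this(1)] signs_of_factors(2)[OF this(2)]
    show ?thesis using a(1) by auto
  next
    assume *: "t < - 2 \<and> - t - 1 < d \<and> d < t\<^sup>2 / 4"
    then have "(1 + a1) * (1 + a2) > 0" unfolding a(5) by auto
    from signs_of_factors(1)[OF this] show ?thesis using a(1,2) * by auto
  qed
  then show ?thesis using fibre_cards_distinct[OF a(1)] x(1) a(2,3)
    by (auto simp: square_less_1_iff power2_eq_1_iff)
qed

lemma cards_N: "x \<in> region_N \<Longrightarrow> card (preimage2 {x}) = 1 \<and> card (preimage1 {x}) = 1"
  using fibre_cards_complex[of x] by (auto simp: region_N_def disc_def)

lemma cards_Gamma_d:
  "x \<in> Gamma_d2 \<Longrightarrow> card (preimage2 {x}) = 3 \<and> card (preimage1 {x}) = 3"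
  "x \<in> Gamma_d1 \<union> Gamma_d3 \<Longrightarrow> card (preimage2 {x}) = 3 \<and> card (preimage1 {x}) = 1"
  using fibre_cards_double[of x] unfolding square_less_1_iff power2_eq_1_iff
  by (auto simp: Gamma_d_def Gamma_d1_def Gamma_d2_def Gamma_d3_def disc_def)

lemma cards_Gamma_1:
  "x \<in> Gamma_1_2 \<Longrightarrow> card (preimage2 {x}) = 2 \<and> card (preimage1 {x}) = 2"
  "x \<in> Gamma_1_1 \<union> Gamma_1_3 \<Longrightarrow> card (preimage2 {x}) = 2 \<and> card (preimage1 {x}) = 1"
proof -
  \<comment> \<open>On this line the roots are 1 and \<open>t - 1\<close>; which is larger depends
    on \<open>t < 2\<close>, and at \<open>t = 2\<close> they coincide.\<close>
  have lt: "card (preimage2 {(t, t - 1)}) = (if (t - 1)\<^sup>2 = 1 then 1 else 2) \<and>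
      card (preimage1 {(t, t - 1)}) = (if (t - 1)\<^sup>2 < 1 then 2 else 1)" if "t \<noteq> 2" for t
    using fibre_cards_distinct[of "t - 1" 1 "(t, t - 1)"] fibre_cards_distinct[of 1 "t - 1" "(t, t - 1)"] that
    by (cases "t < 2") auto
  show "x \<in> Gamma_1_2 \<Longrightarrow> card (preimage2 {x}) = 2 \<and> card (preimage1 {x}) = 2"
    "x \<in> Gamma_1_1 \<union> Gamma_1_3 \<Longrightarrow> card (preimage2 {x}) = 2 \<and> card (preimage1 {x}) = 1"
    using lt[of "fst x"] unfolding square_less_1_iff power2_eq_1_iff
    by (auto simp: Gamma_1_def Gamma_1_1_def Gamma_1_2_def Gamma_1_3_def)
qed

lemma cards_Gamma_m1:
  "x \<in> Gamma_m1_2 \<Longrightarrow> card (preimage2 {x}) = 2 \<and> card (preimage1 {x}) = 2"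
  "x \<in> Gamma_m1_1 \<union> Gamma_m1_3 \<Longrightarrow> card (preimage2 {x}) = 2 \<and> card (preimage1 {x}) = 1"
proof -
  have lt: "card (preimage2 {(t, - t - 1)}) = (if (t + 1)\<^sup>2 = 1 then 1 else 2) \<and>
      card (preimage1 {(t, - t - 1)}) = (if (t + 1)\<^sup>2 < 1 then 2 else 1)" if "t \<noteq> - 2" for t
    using fibre_cards_distinct[of "- 1" "t + 1" "(t, - t - 1)"] fibre_cards_distinct[of "t + 1" "- 1" "(t, - t - 1)"] that
    by (cases "t > - 2") auto
  show "x \<in> Gamma_m1_2 \<Longrightarrow> card (preimage2 {x}) = 2 \<and> card (preimage1 {x}) = 2"
    "x \<in> Gamma_m1_1 \<union> Gamma_m1_3 \<Longrightarrow> card (preimage2 {x}) = 2 \<and> card (preimage1 {x}) = 1"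
    using lt[of "fst x"] unfolding square_less_1_iff power2_eq_1_iff
    by (auto simp: Gamma_m1_def Gamma_m1_1_def Gamma_m1_2_def Gamma_m1_3_def)
qed

text \<open>At the two points of tangency 1 or -1 is a double root; at \<open>(0, -1)\<close> the
  roots are 1 and -1. In each case all signs are 0.\<close>

lemma cards_points:
  "x \<in> {(2, 1), (- 2, 1), (0, - 1)} \<Longrightarrow> card (preimage2 {x}) = 1 \<and> card (preimage1 {x}) = 1"
  using fibre_cards_double[of x] fibre_cards_distinct[of "- 1" 1 x] by (auto simp: disc_def)

theorem mainTheorem2:
  shows
   "\<comment> \<open>the quotients and the maps are well defined\<close>
    (equiv SpI (SpI_rel :: 2 dmat rel) \<and> equiv Sp (Sp_rel :: 2 dmat rel) \<and>
     (\<forall>d \<in> topspace Sp_git. \<exists>M \<in> SpI :: 2 dmat set. d = Sp_class M) \<and>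
     (\<forall>A B C :: 2 sqmat. M_ABC A B C \<in> SpI \<longrightarrow>
        p0 (SpI_class (M_ABC A B C)) = Sp_class (M_ABC A B C) \<and>
        p1 (Sp_class (M_ABC A B C)) = (trace A, det A))) \<and>
    \<comment> \<open>(i)\<close>
    (covering_map (subtopology SpI_git (preimage2 (- branch_locus)))
                  (subtopology Sp_git (preimage1 (- branch_locus))) p0 \<and>
     covering_map (subtopology Sp_git (preimage1 (- branch_locus)))
                  (top_of_set (- branch_locus)) p1 \<and>
     (\<forall>D \<in> components (- branch_locus). \<exists>k0 k1 :: nat. 0 < k0 \<and> 0 < k1 \<and>
        (\<forall>d \<in> preimage1 D. card (preimage0 d) = k0) \<and>
        (\<forall>x \<in> D. card (preimage1 {x}) = k1))) \<and>
    \<comment> \<open>(ii)\<close>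
    (\<forall>x :: real \<times> real.
      let n = (card (preimage2 {x}), card (preimage1 {x})) in
       (x \<in> region_E2 \<longrightarrow> n = (4, 4)) \<and>
       (x \<in> region_EHp \<union> region_EHm \<longrightarrow> n = (4, 2)) \<and>
       (x \<in> region_Hpp \<union> region_Hmp \<union> region_Hmm \<longrightarrow> n = (4, 1)) \<and>
       (x \<in> region_N \<longrightarrow> n = (1, 1)) \<and>
       (x \<in> Gamma_d2 \<longrightarrow> n = (3, 3)) \<and>
       (x \<in> Gamma_d1 \<union> Gamma_d3 \<longrightarrow> n = (3, 1)) \<and>
       (x \<in> Gamma_1_2 \<union> Gamma_m1_2 \<longrightarrow> n = (2, 2)) \<and>
       (x \<in> Gamma_1_1 \<union> Gamma_1_3 \<union> Gamma_m1_1 \<union> Gamma_m1_3 \<longrightarrow> n = (2, 1)) \<and>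
       (x \<in> {(2, 1), (-2, 1), (0, -1)} \<longrightarrow> n = (1, 1)))"
proof (intro conjI)
  show "equiv SpI (SpI_rel :: 2 dmat rel)" unfolding SpI_rel_eq by (rule kI.equiv_rel)
  show "equiv Sp (Sp_rel :: 2 dmat rel)" unfolding Sp_rel_def by (rule kS.equiv_rel)
  show "\<forall>d \<in> topspace Sp_git. \<exists>M \<in> SpI :: 2 dmat set. d = Sp_class M"
    unfolding git_eqs class_eqs kS.topspace_quot_Z using nforms_SpI by blast
  show "\<forall>A B C :: 2 sqmat. M_ABC A B C \<in> SpI \<longrightarrow>
        p0 (SpI_class (M_ABC A B C)) = Sp_class (M_ABC A B C) \<and>
        p1 (Sp_class (M_ABC A B C)) = (trace A, det A)"
    using SpI_subset_Sp by (auto simp: p0_class p1_class base_pt_M_ABC)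
  show "covering_map (subtopology SpI_git (preimage2 (- branch_locus)))
                  (subtopology Sp_git (preimage1 (- branch_locus))) p0"
    by (rule covering_map_p0)
  show "covering_map (subtopology Sp_git (preimage1 (- branch_locus)))
                  (top_of_set (- branch_locus)) p1"
    by (rule covering_map_p1)
  show "\<forall>D \<in> components (- branch_locus). \<exists>k0 k1 :: nat. 0 < k0 \<and> 0 < k1 \<and>
        (\<forall>d \<in> preimage1 D. card (preimage0 d) = k0) \<and>
        (\<forall>x \<in> D. card (preimage1 {x}) = k1)"
    using sheet_numbers_constant by blast
qed (unfold Let_def prod.inject,
    use cards_E2 cards_EH cards_H cards_N cards_Gamma_d cards_Gamma_1 cards_Gamma_m1 cards_points in blast)

end
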